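(* Let $1\le m<n$, let $J\subset S$ be the generic link of the ideal $I=I_m(X)$ of maximal minors of a generic $m\times n$ matrix $X$ over a field $K$, and let $\operatorname{in}(J)$ be its initial ideal with respect to the term order $<_1$ on $S$ (all as defined in the context). Then $\operatorname{in}(J)^{(\ell)}=\operatorname{in}(J)^{\ell}$ for all $\ell\in\mathbb N$.
   Context: Let $K$ be a field, $1\le m<n$ integers, $X=(x_{i,j})$ an $m\times n$ matrix of indeterminates, $R=K[X]$, and $I=I_m(X)$ the ideal generated by the $m$-minors $\Delta_1,\ldots,\Delta_\eta$ of $X$, $\eta=\binom nm$, enumerated so that for $j=1,\ldots,n-m+1$ the minor $\Delta_j$ is the one on columns $j,j+1,\ldots,j+m-1$. Let $Y=(Y_{i,j})$ be an $(n-m+1)\times\eta$ matrix of indeterminates, $S=R[Y]$, $\mathfrak a\subset S$ the ideal generated by the entries of $Y[\Delta_1,\ldots,\Delta_\eta]^T$. The generic link of $I$ is $J=\mathfrak a:IS$. Term order. Fix an antidiagonal term order $<$ on $R$ (one for which the initial term of every minor of $X$ is, up to sign, the product of the variables on its main antidiagonal), e.g. the reverse lexicographic order extending $x_{m,n}>x_{m,n-1}>\cdots>x_{m,1}>x_{m-1,n}>\cdots>x_{1,1}$. With $g=n-m+1$, order the $Y$-variables by $Y_{1,1}>Y_{2,2}>\cdots>Y_{g,g}>$ the remaining $Y_{i,j}$ (in any fixed order). For a monomial $u\in S$ let $u_x\in R$ be its image under the $R$-algebra map $S\to R$ sending every $Y_{i,j}$ to $1$. Define $u<_1 v$ iff $u/u_x$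 is lexicographically smaller than $v/v_x$, or $u/u_x=v/v_x$ and $u_x<v_x$. Put $\operatorname{in}(J)=\operatorname{in}_{<_1}(J)$; this is a squarefree monomial ideal. For a radical ideal $\mathfrak b$ of a Noetherian ring $A$, the $\ell$th symbolic power is $\mathfrak b^{(\ell)}=\bigcap_{\mathfrak p\in\operatorname{Ass}(\mathfrak b)}\mathfrak p^\ell A_{\mathfrak p}\cap A$. *)

theory Defs
  imports
    "HOL-Library.Poly_Mapping"
    "HOL-Algebra.Ideal_Product"
    "Jordan_Normal_Form.Determinant"
    "Jordan_Normal_Form.DL_Submatrix"
begin

section \<open>Ideal quotients, localization and symbolic powers\<close>

definition ideal_quotient :: "('a, 'b) ring_scheme \<Rightarrow> 'a set \<Rightarrow> 'a set \<Rightarrow> 'a set" where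
  "ideal_quotient A I H = {f \<in> carrier A. \<forall>h\<in>H. f \<otimes>\<^bsub>A\<^esub> h \<in> I}"

text \<open>The associated primes of \<open>A/I\<close>: the prime ideals that are annihilators of a single
  residue class, i.e. of the form \<open>I : f\<close>.\<close>

definition ass_primes :: "('a, 'b) ring_scheme \<Rightarrow> 'a set \<Rightarrow> 'a set set" where
  "ass_primes A I = {p. primeideal p A \<and> (\<exists>f\<in>carrier A. p = ideal_quotient A I {f})}"

text \<open>The fraction \<open>a/s\<close> is the set of all pairs \<open>(b, t)\<close> with \<open>u (t a - s b) = 0\<close> for some
  \<open>u\<close> outside \<open>p\<close>. The ring \<open>A\<close> need not be a domain.\<close>

definition loc_class :: "('a, 'b) ring_scheme \<Rightarrow> 'a set \<Rightarrow> 'a \<Rightarrow> 'a \<Rightarrow> ('a \<times> 'a) set" where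
  "loc_class A p a s = {(b, t) \<in> carrier A \<times> (carrier A - p).
     \<exists>u\<in>carrier A - p. u \<otimes>\<^bsub>A\<^esub> (t \<otimes>\<^bsub>A\<^esub> a) = u \<otimes>\<^bsub>A\<^esub> (s \<otimes>\<^bsub>A\<^esub> b)}"

text \<open>The operations take the union over all representatives; the classes united coincide.\<close>

definition local_ring :: "('a, 'b) ring_scheme \<Rightarrow> 'a set \<Rightarrow> ('a \<times> 'a) set ring" where
  "local_ring A p =
     \<lparr>carrier = {loc_class A p a s | a s. a \<in> carrier A \<and> s \<in> carrier A - p},
      monoid.mult = (\<lambda>E F. \<Union>(a, s)\<in>E. \<Union>(b, t)\<in>F. loc_class A p (a \<otimes>\<^bsub>A\<^esub> b) (s \<otimes>\<^bsub>A\<^esub> t)),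
      one = loc_class A p \<one>\<^bsub>A\<^esub> \<one>\<^bsub>A\<^esub>,
      zero = loc_class A p \<zero>\<^bsub>A\<^esub> \<one>\<^bsub>A\<^esub>,
      add = (\<lambda>E F. \<Union>(a, s)\<in>E. \<Union>(b, t)\<in>F.
               loc_class A p ((t \<otimes>\<^bsub>A\<^esub> a) \<oplus>\<^bsub>A\<^esub> (s \<otimes>\<^bsub>A\<^esub> b)) (s \<otimes>\<^bsub>A\<^esub> t))\<rparr>"

text \<open>\<open>I A\<^sub>p \<inter> A\<close>, the preimage under \<open>A \<rightarrow> A\<^sub>p\<close> of the extension of \<open>I\<close> to \<open>A\<^sub>p\<close>.\<close>

definition local_contraction :: "('a, 'b) ring_scheme \<Rightarrow> 'a set \<Rightarrow> 'a set \<Rightarrow> 'a set" where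
  "local_contraction A p I =
     {a \<in> carrier A. loc_class A p a \<one>\<^bsub>A\<^esub>
        \<in> genideal (local_ring A p) ((\<lambda>x. loc_class A p x \<one>\<^bsub>A\<^esub>) ` I)}"

text \<open>Powers of ideals are taken in the library's semiring of ideals. The comprehension
  over the carrier makes the intersection over an empty set of primes equal to \<open>A\<close>.\<close>

definition symbolic_power :: "('a, 'b) ring_scheme \<Rightarrow> 'a set \<Rightarrow> nat \<Rightarrow> 'a set" where
  "symbolic_power A I l =
     {a \<in> carrier A. \<forall>p\<in>ass_primes A I.
        a \<in> local_contraction A p (p [^]\<^bsub>ideals_set A\<^esub> l)}"


section \<open>Polynomials, term orders and initial ideals\<close>

text \<open>Exponent vectors are written additively, as finitely supported functions to \<open>nat\<close>.\<close>

type_synonym 'v monomial = "'v \<Rightarrow>\<^sub>0 nat"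
type_synonym ('v, 'k) mpoly = "'v monomial \<Rightarrow>\<^sub>0 'k"

definition monomials :: "'v set \<Rightarrow> 'v monomial set" where
  "monomials V = {t. Poly_Mapping.keys t \<subseteq> V}"

definition poly_ring :: "'v set \<Rightarrow> ('v, 'k::comm_ring_1) mpoly ring" where
  "poly_ring V = \<lparr>carrier = {f. Poly_Mapping.keys f \<subseteq> monomials V},
     monoid.mult = (*), one = 1, zero = 0, add = (+)\<rparr>"

definition pvar :: "'v \<Rightarrow> ('v, 'k::comm_ring_1) mpoly" where
  "pvar v = Poly_Mapping.single (Poly_Mapping.single v 1) 1"

definition term_order :: "'v set \<Rightarrow> ('v monomial \<Rightarrow> 'v monomial \<Rightarrow> bool) \<Rightarrow> bool" where
  "term_order V lt \<longleftrightarrow>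
     (\<forall>s\<in>monomials V. \<not> lt s s) \<and>
     (\<forall>s\<in>monomials V. \<forall>t\<in>monomials V. \<forall>u\<in>monomials V. lt s t \<longrightarrow> lt t u \<longrightarrow> lt s u) \<and>
     (\<forall>s\<in>monomials V. \<forall>t\<in>monomials V. s \<noteq> t \<longrightarrow> lt s t \<or> lt t s) \<and>
     (\<forall>s\<in>monomials V. s \<noteq> 0 \<longrightarrow> lt 0 s) \<and>
     (\<forall>s\<in>monomials V. \<forall>t\<in>monomials V. \<forall>u\<in>monomials V. lt s t \<longrightarrow> lt (u + s) (u + t))"

text \<open>Meaningful for nonzero polynomials in the variables for which \<open>lt\<close> is a term order.\<close>

definition initial_monomial ::
    "('v monomial \<Rightarrow> 'v monomial \<Rightarrow> bool) \<Rightarrow> ('v, 'k::zero) mpoly \<Rightarrow> 'v monomial" where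
  "initial_monomial lt f =
     (THE t. t \<in> Poly_Mapping.keys f \<and> (\<forall>s\<in>Poly_Mapping.keys f. s \<noteq> t \<longrightarrow> lt s t))"

definition initial_term ::
    "('v monomial \<Rightarrow> 'v monomial \<Rightarrow> bool) \<Rightarrow> ('v, 'k::zero) mpoly \<Rightarrow> ('v, 'k) mpoly" where
  "initial_term lt f =
     Poly_Mapping.single (initial_monomial lt f)
       (Poly_Mapping.lookup f (initial_monomial lt f))"

definition initial_ideal ::
    "'v set \<Rightarrow> ('v monomial \<Rightarrow> 'v monomial \<Rightarrow> bool)
      \<Rightarrow> ('v, 'k::comm_ring_1) mpoly set \<Rightarrow> ('v, 'k) mpoly set" where
  "initial_ideal V lt H = genideal (poly_ring V) {initial_term lt f | f. f \<in> H \<and> f \<noteq> 0}"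


section \<open>The generic link of the ideal of maximal minors\<close>

text \<open>All indices start at 0: \<open>XVar i j\<close> is $x_{i+1,j+1}$ and \<open>YVar i j\<close> is $Y_{i+1,j+1}$.\<close>

datatype var = XVar nat nat | YVar nat nat

definition xvars :: "nat \<Rightarrow> nat \<Rightarrow> var set" where
  "xvars m n = {XVar i j | i j. i < m \<and> j < n}"

definition yvars :: "nat \<Rightarrow> nat \<Rightarrow> var set" where
  "yvars m n = {YVar i j | i j. i < n - m + 1 \<and> j < n choose m}"

definition svars :: "nat \<Rightarrow> nat \<Rightarrow> var set" where
  "svars m n = xvars m n \<union> yvars m n"

definition xmat :: "nat \<Rightarrow> nat \<Rightarrow> (var, 'k::field) mpoly mat" where
  "xmat m n = mat m n (\<lambda>(i, j). pvar (XVar i j))"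

definition ymat :: "nat \<Rightarrow> nat \<Rightarrow> (var, 'k::field) mpoly mat" where
  "ymat m n = mat (n - m + 1) (n choose m) (\<lambda>(i, j). pvar (YVar i j))"

definition minor :: "nat \<Rightarrow> nat \<Rightarrow> nat set \<Rightarrow> nat set \<Rightarrow> (var, 'k::field) mpoly" where
  "minor m n A B = det (submatrix (xmat m n) A B)"

text \<open>\<open>C k\<close> is the set of columns of the minor $\Delta_{k+1}$.\<close>

definition minor_enumeration :: "nat \<Rightarrow> nat \<Rightarrow> (nat \<Rightarrow> nat set) \<Rightarrow> bool" where
  "minor_enumeration m n C \<longleftrightarrow>
     bij_betw C {..<n choose m} {B. B \<subseteq> {..<n} \<and> card B = m} \<and>
     (\<forall>j<n - m + 1. C j = {j..<j + m})"

definition max_minor :: "nat \<Rightarrow> nat \<Rightarrow> (nat \<Rightarrow> nat set) \<Rightarrow> nat \<Rightarrow> (var, 'k::field) mpoly" where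
  "max_minor m n C k = minor m n {..<m} (C k)"

definition minors_ideal :: "nat \<Rightarrow> nat \<Rightarrow> (nat \<Rightarrow> nat set) \<Rightarrow> (var, 'k::field) mpoly set" where
  "minors_ideal m n C =
     genideal (poly_ring (xvars m n)) (max_minor m n C ` {..<n choose m})"

definition link_ci :: "nat \<Rightarrow> nat \<Rightarrow> (nat \<Rightarrow> nat set) \<Rightarrow> (var, 'k::field) mpoly set" where
  "link_ci m n C = genideal (poly_ring (svars m n))
     (set\<^sub>v (ymat m n *\<^sub>v vec (n choose m) (max_minor m n C)))"

definition generic_link :: "nat \<Rightarrow> nat \<Rightarrow> (nat \<Rightarrow> nat set) \<Rightarrow> (var, 'k::field) mpoly set" where
  "generic_link m n C =
     ideal_quotient (poly_ring (svars m n)) (link_ci m n C)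
       (genideal (poly_ring (svars m n)) (minors_ideal m n C))"

text \<open>Main antidiagonal of the submatrix on rows \<open>A\<close> and columns \<open>B\<close>, where \<open>pick A i\<close> is the
  \<open>i\<close>-th smallest element of \<open>A\<close>. The type argument fixes the coefficient field.\<close>

definition antidiagonal_order ::
    "'k::field itself \<Rightarrow> nat \<Rightarrow> nat \<Rightarrow> (var monomial \<Rightarrow> var monomial \<Rightarrow> bool) \<Rightarrow> bool" where
  "antidiagonal_order K m n lt \<longleftrightarrow>
     term_order (xvars m n) lt \<and>
     (\<forall>A B. A \<subseteq> {..<m} \<longrightarrow> B \<subseteq> {..<n} \<longrightarrow> card A = card B \<longrightarrow> A \<noteq> {} \<longrightarrow>
        (let d = (\<Prod>i<card A. pvar (XVar (pick A i) (pick B (card A - 1 - i)))) in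
         initial_term lt (minor m n A B :: (var, 'k) mpoly) \<in> {d, - d}))"

text \<open>A total order of the \<open>Y\<close>-variables, given as the list of their index pairs
  from the largest to the smallest.\<close>

definition y_order :: "nat \<Rightarrow> nat \<Rightarrow> (nat \<times> nat) list \<Rightarrow> bool" where
  "y_order m n ys \<longleftrightarrow>
     distinct ys \<and> set ys = {..<n - m + 1} \<times> {..<n choose m} \<and>
     (\<forall>j<n - m + 1. ys ! j = (j, j))"

definition x_part :: "var monomial \<Rightarrow> var monomial" where
  "x_part = Poly_Mapping.mapp (\<lambda>v e. case v of XVar i j \<Rightarrow> e | YVar i j \<Rightarrow> 0)"

definition y_exponents :: "(nat \<times> nat) list \<Rightarrow> var monomial \<Rightarrow> nat list" where
  "y_exponents ys u = map (\<lambda>(i, j). Poly_Mapping.lookup u (YVar i j)) ys"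

definition link_order ::
    "(nat \<times> nat) list \<Rightarrow> (var monomial \<Rightarrow> var monomial \<Rightarrow> bool)
      \<Rightarrow> var monomial \<Rightarrow> var monomial \<Rightarrow> bool" where
  "link_order ys lt u v \<longleftrightarrow>
     (y_exponents ys (u - x_part u), y_exponents ys (v - x_part v)) \<in> lex less_than \<or>
     u - x_part u = v - x_part v \<and> lt (x_part u) (x_part v)"

end

theory Submission
  imports Defs
begin

text \<open>
  Put \<open>g = n - m + 1\<close>, count from 0, and count the rows of \<open>X\<close> from the bottom. Then the main antidiagonals
  of the maximal minors are the products over \<open>t < m\<close> of the variables in row \<open>t\<close> and column \<open>c t + t\<close>,
  where \<open>c\<close> is a weakly increasing map from rows to \<open>{..<g}\<close>. The constant maps belong to the first \<open>g\<close>
  minors. Hence the generator \<open>F i\<close> of the complete intersection has the leading monomial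
  \<open>L i\<close>, the product of \<open>Y i i\<close> and the variables in row \<open>t\<close>, column \<open>i + t\<close>, and these monomials are
  pairwise coprime. The variables occurring in them form an array with \<open>g\<close> columns: entry 0 of
  column \<open>i\<close> is \<open>Y i i\<close>, and entry \<open>t + 1\<close> is the variable in row \<open>t\<close> and column \<open>i + t\<close> of \<open>X\<close>.

  The heart of the proof is a description of the initial ideal (\<open>in_J_eq\<close>). Choose one entry in each
  column of the array, and call the choice bad if it contains some \<open>Y i i\<close> or is not weakly increasing.
  A monomial lies in the initial ideal iff for every bad choice it is divisible by a chosen variable;
  so the ideal is the intersection of the primes generated by the bad choices.

  These divisibilities are necessary. If \<open>f\<close> is in the link, the product of \<open>f\<close> with any
  maximal minor is in the complete intersection, and by coprimality (\<open>coprime_leads_groebner\<close>) its leading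
  monomial is divisible by some \<open>L i\<close>. For a bad choice there is a minor whose antidiagonal avoids all chosen
  variables, so the chosen variable of column \<open>i\<close> divides the leading monomial of \<open>f\<close> (\<open>lead_J_heavy\<close>).

  They are sufficient because the monomials with this property are the multiples of the \<open>L i\<close> and of the
  monomials of staircases \<open>1 = a 0 \<le> \<dots> \<le> a g = m\<close>, which keep in column \<open>i\<close> the entries outside of
  the interval from \<open>a i\<close> to \<open>a (i + 1)\<close>; and the latter are leading monomials of explicit elements of the link.
  Regard row \<open>i\<close> of \<open>Y\<close> as an alternating \<open>m\<close>-form on \<open>n\<close>-space, contract it with the rows of \<open>X\<close> that are kept in
  column \<open>i\<close>, and take the wedge product over \<open>i\<close>. Its degree is \<open>n\<close>, so it has a single coefficient,
  the polynomial \<open>link_poly\<close>. It belongs to the link since only \<open>g - 1\<close> vectors besides the rows of \<open>X\<close>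
  are needed for a basis, so that in each term one of the \<open>g\<close> forms is evaluated at rows of \<open>X\<close>
  only (\<open>link_poly_mult_minor\<close>). Its leading term is found by a summation by parts that uses only
  the initial terms of 2-minors of adjacent rows and columns (\<open>off_path_monomial_less\<close>).

  For the symbolic powers, the primes of the bad choices are associated and their powers are primary. So a monomial
  of an element of the \<open>l\<close>-th symbolic power has degree at least \<open>l\<close> in the variables of each bad
  choice. The packing theorem \<open>array_packing\<close>, a min-max property of the arrays, splits off \<open>l\<close>
  factors, each a full column or a staircase, and the monomial lies in the \<open>l\<close>-th power.
\<close>

section \<open>Packing arrays into columns and staircases\<close>

text \<open>The bad choices index the primes whose intersection is the initial ideal. Entry 0 of a column stands
  for the variable \<open>Y i i\<close>, the entries \<open>1, \<dots>, m\<close> for variables of \<open>X\<close>.\<close>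

definition bad_choice :: "nat \<Rightarrow> nat \<Rightarrow> (nat \<Rightarrow> nat) \<Rightarrow> bool" where
  "bad_choice g m \<sigma> \<longleftrightarrow> (\<forall>i<g. \<sigma> i \<le> m) \<and>
     ((\<exists>i<g. \<sigma> i = 0) \<or> (\<exists>i j. i < j \<and> j < g \<and> \<sigma> j < \<sigma> i))"

definition staircase :: "nat \<Rightarrow> nat \<Rightarrow> (nat \<Rightarrow> nat) \<Rightarrow> bool" where
  "staircase g m a \<longleftrightarrow> a 0 = 1 \<and> a g = m \<and> (\<forall>i<g. a i \<le> a (Suc i))"

definition column_array :: "nat \<Rightarrow> nat \<Rightarrow> nat \<Rightarrow> nat" where
  "column_array i = (\<lambda>j s. of_bool (j = i))"

text \<open>Entry 0 always belongs to the array of a staircase, because \<open>a i \<ge> 1\<close>.\<close>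

definition staircase_array :: "(nat \<Rightarrow> nat) \<Rightarrow> nat \<Rightarrow> nat \<Rightarrow> nat" where
  "staircase_array a = (\<lambda>i s. of_bool (s < a i \<or> a (Suc i) < s))"

definition generator_arrays :: "nat \<Rightarrow> nat \<Rightarrow> (nat \<Rightarrow> nat \<Rightarrow> nat) set" where
  "generator_arrays g m = column_array ` {..<g} \<union> staircase_array ` {a. staircase g m a}"

text \<open>A choice through two inverted entries and zeros of the other columns is bad, so inverted entries
  have sum at least \<open>L\<close>. The staircase number \<open>k\<close> follows the highest entries of value at most \<open>k\<close>
  in the preceding columns. If an entry lies above this staircase, its value exceeds \<open>k\<close>; if it
  lies below, it is inverted with an entry of value at most \<open>k\<close>, so its value is at least \<open>L - k\<close>. Either way
  it is used by no more staircases of that kind than its value. Both kinds do not occur for the same entry: a zero of its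
  column and an entry of value less than \<open>L\<close> in an earlier column would be inverted.\<close>

lemma staircase_packing:
  fixes w :: "nat \<Rightarrow> nat \<Rightarrow> nat"
  assumes m: "1 \<le> m" and g: "2 \<le> g" and L: "0 < L"
    and zero: "\<And>i. i < g \<Longrightarrow> \<exists>s\<le>m. w i s = 0"
    and cover: "\<And>\<sigma>. bad_choice g m \<sigma> \<Longrightarrow> L \<le> (\<Sum>i<g. w i (\<sigma> i))"
  shows "\<exists>a. (\<forall>k<L. staircase g m (a k)) \<and>
    (\<forall>i<g. \<forall>s\<le>m. (\<Sum>k<L. staircase_array (a k) i s) \<le> w i s)"
proof -
  obtain z where z: "\<And>i. i < g \<Longrightarrow> z i \<le> m" and wz: "\<And>i. i < g \<Longrightarrow> w i (z i) = 0"
    using zero by metis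
  have bottom: "L \<le> w i 0" if "i < g" for i
  proof -
    have "bad_choice g m (z(i := 0))" unfolding bad_choice_def using that z by auto
    from cover[OF this] have "L \<le> (\<Sum>j<g. w j ((z(i := 0)) j))" .
    also have "\<dots> = (\<Sum>j\<in>{i}. w j ((z(i := 0)) j))"
      by (rule sum.mono_neutral_right) (use that wz in auto)
    finally show ?thesis by simp
  qed
  have inversion: "L \<le> w j s' + w i s" if "j < i" "i < g" "s < s'" "s' \<le> m" for i j s s'
  proof -
    let ?t = "z(j := s', i := s)"
    have "bad_choice g m ?t" unfolding bad_choice_def
    proof (intro conjI disjI2 allI impI)
      show "?t k \<le> m" if "k < g" for k using z[OF that] \<open>s < s'\<close> \<open>s' \<le> m\<close> by auto
      show "\<exists>k k'. k < k' \<and> k' < g \<and> ?t k' < ?t k"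
        using that by (intro exI[of _ j] exI[of _ i]) auto
    qed
    from cover[OF this] have "L \<le> (\<Sum>k<g. w k (?t k))" .
    also have "\<dots> = (\<Sum>k\<in>{j, i}. w k (?t k))"
      by (rule sum.mono_neutral_right) (use that wz in auto)
    finally show ?thesis using that by simp
  qed
  have zpos: "1 \<le> z i" if "i < g" for i
    using bottom[OF that] wz[OF that] L by (cases "z i") auto
  define B where "B k i = {s. s \<le> m \<and> (\<exists>j<i. w j s \<le> k)}" for k i
  define a where "a k i = (if i = 0 then 1 else if i = g then m else Max (B k i))" for k i
  have finB: "finite (B k i)" for k i unfolding B_def by simp
  have zB: "z j \<in> B k i" if "j < i" "i \<le> g" for j k i
    unfolding B_def using that z wz by force
  have aB: "a k i \<in> B k i" if "0 < i" "i < g" for k i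
    unfolding a_def using that Max_in[OF finB, of k i] zB[of 0 i k] by auto
  have Ba: "s \<le> a k i" if "s \<in> B k i" "0 < i" "i \<le> g" for s k i
    using that Max_ge[OF finB that(1)] unfolding a_def B_def by auto
  have st: "staircase g m (a k)" for k
    unfolding staircase_def
  proof (intro conjI allI impI)
    show "a k 0 = 1" "a k g = m" using g by (auto simp: a_def)
    fix i assume i: "i < g"
    show "a k i \<le> a k (Suc i)"
    proof (cases "i = 0")
      case True
      have "1 \<le> z 0" using zpos g by simp
      also have "z 0 \<le> a k (Suc i)" by (rule Ba[OF zB]) (use i in auto)
      finally show ?thesis using True by (simp add: a_def)
    next
      case False
      have "a k i \<in> B k (Suc i)" using aB[of i k] False i unfolding B_def by (auto intro: less_SucI)
      then show ?thesis by (rule Ba) (use i in auto)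
    qed
  qed
  have count: "(\<Sum>k<L. staircase_array (a k) i s) \<le> w i s" if i: "i < g" and s: "s \<le> m" for i s
  proof -
    let ?K = "{k. k < L \<and> (s < a k i \<or> a k (Suc i) < s)}"
    have "(\<Sum>k<L. staircase_array (a k) i s) = card ?K"
      unfolding staircase_array_def by (simp add: lessThan_def Collect_conj_eq[symmetric] of_bool_def sum.If_cases)
    also have "\<dots> \<le> w i s"
    proof (cases "\<exists>k<L. a k (Suc i) < s")
      case True
      then obtain k2 where k2: "k2 < L" "a k2 (Suc i) < s" by auto
      have zi: "z i < s" using Ba[OF zB[of i "Suc i" k2]] i k2 by auto
      have no: "\<not> s < a k i" if k: "k < L" for k
      proof
        assume *: "s < a k i"
        show False
        proof (cases "i = 0")
          case True then show ?thesis using * zi by (simp add: a_def)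
        next
          case False
          then have "a k i \<in> B k i" using aB i by simp
          then obtain j where j: "j < i" "w j (a k i) \<le> k" "a k i \<le> m" unfolding B_def by auto
          from inversion[OF j(1) i _ j(3), of "z i"] zi * wz[OF i] j k show False by simp
        qed
      qed
      have "?K \<subseteq> {..<w i s}"
      proof
        fix k assume k: "k \<in> ?K"
        then have *: "a k (Suc i) < s" using no by auto
        show "k \<in> {..<w i s}"
        proof (rule ccontr)
          assume "\<not> ?thesis"
          then have "s \<in> B k (Suc i)" unfolding B_def using s by auto
          from Ba[OF this] i * show False by simp
        qed
      qed
      from card_mono[OF _ this] show ?thesis by simp
    next
      case False
      have "?K \<subseteq> {L - w i s..<L}"
      proof
        fix k assume k: "k \<in> ?K"
        then have *: "s < a k i" "k < L" using False by auto
        have "L \<le> k + w i s"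
        proof (cases "i = 0")
          case True then show ?thesis using * bottom[OF i] by (simp add: a_def)
        next
          case False
          then have "a k i \<in> B k i" using aB i by simp
          then obtain j where j: "j < i" "w j (a k i) \<le> k" "a k i \<le> m" unfolding B_def by auto
          from inversion[OF j(1) i *(1) j(3)] j show ?thesis by simp
        qed
        then show "k \<in> {L - w i s..<L}" using * by auto
      qed
      from card_mono[OF _ this] show ?thesis by simp
    qed
    finally show ?thesis .
  qed
  show ?thesis using st count by blast
qed

text \<open>Removing a column whose entries are all positive lowers the sum along every choice by exactly one.
  By induction this leaves the case in which each column contains a zero.\<close>

theorem array_packing:
  fixes w :: "nat \<Rightarrow> nat \<Rightarrow> nat"
  assumes m: "1 \<le> m" and g: "2 \<le> g"
    and cover: "\<And>\<sigma>. bad_choice g m \<sigma> \<Longrightarrow> l \<le> (\<Sum>i<g. w i (\<sigma> i))"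
  shows "\<exists>H. (\<forall>k<l. H k \<in> generator_arrays g m) \<and>
    (\<forall>i<g. \<forall>s\<le>m. (\<Sum>k<l. H k i s) \<le> w i s)"
  using cover
proof (induction l arbitrary: w)
  case 0
  then show ?case by simp
next
  case (Suc l)
  show ?case
  proof (cases "\<exists>i<g. \<forall>s\<le>m. 0 < w i s")
    case True
    then obtain i where i: "i < g" and pos: "\<And>s. s \<le> m \<Longrightarrow> 0 < w i s" by auto
    define w' where "w' = w(i := \<lambda>s. w i s - 1)"
    have "l \<le> (\<Sum>j<g. w' j (\<sigma> j))" if \<sigma>: "bad_choice g m \<sigma>" for \<sigma>
    proof -
      have p: "0 < w i (\<sigma> i)" using \<sigma> pos i unfolding bad_choice_def by auto
      have "(\<Sum>j<g. w j (\<sigma> j)) = (\<Sum>j<g. w' j (\<sigma> j) + of_bool (j = i))"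
        by (rule sum.cong) (use p in \<open>auto simp: w'_def\<close>)
      also have "\<dots> = (\<Sum>j<g. w' j (\<sigma> j)) + 1" using i by (simp add: sum.distrib of_bool_def)
      finally show ?thesis using Suc.prems[OF \<sigma>] by simp
    qed
    then have "\<And>\<sigma>. bad_choice g m \<sigma> \<Longrightarrow> l \<le> (\<Sum>j<g. w' j (\<sigma> j))" .
    from Suc.IH[of w', OF this] obtain H where H: "\<forall>k<l. H k \<in> generator_arrays g m"
      "\<forall>i<g. \<forall>s\<le>m. (\<Sum>k<l. H k i s) \<le> w' i s" by blast
    let ?H = "H(l := column_array i)"
    have "(\<Sum>k<Suc l. ?H k j s) \<le> w j s" if "j < g" "s \<le> m" for j s
    proof -
      have "(\<Sum>k<Suc l. ?H k j s) = (\<Sum>k<l. H k j s) + of_bool (j = i)"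
        by (simp add: column_array_def)
      then show ?thesis using H(2) that pos[of s] by (fastforce simp: w'_def split: if_splits)
    qed
    moreover have "\<forall>k<Suc l. ?H k \<in> generator_arrays g m"
      using H(1) i by (auto simp: generator_arrays_def less_Suc_eq)
    ultimately show ?thesis by blast
  next
    case False
    then have "\<And>i. i < g \<Longrightarrow> \<exists>s\<le>m. w i s = 0" by auto
    from staircase_packing[OF m g _ this Suc.prems] obtain a where
      a: "\<forall>k<Suc l. staircase g m (a k)"
      "\<forall>i<g. \<forall>s\<le>m. (\<Sum>k<Suc l. staircase_array (a k) i s) \<le> w i s"
      by auto
    show ?thesis
      by (rule exI[of _ "\<lambda>k. staircase_array (a k)"]) (use a in \<open>auto simp: generator_arrays_def\<close>)
  qed
qed

section \<open>Localization at a prime ideal\<close>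

context primeideal
begin

definition frac_eq :: "'a \<Rightarrow> 'a \<Rightarrow> 'a \<Rightarrow> 'a \<Rightarrow> bool" where
  "frac_eq a s b t \<longleftrightarrow> (\<exists>u\<in>carrier R - I. u \<otimes> (t \<otimes> a) = u \<otimes> (s \<otimes> b))"

abbreviation denoms :: "'a set" where "denoms \<equiv> carrier R - I"

abbreviation (input) frac :: "'a \<Rightarrow> 'a \<Rightarrow> ('a \<times> 'a) set" where "frac \<equiv> loc_class R I"

abbreviation (input) Q :: "('a \<times> 'a) set ring" where "Q \<equiv> local_ring R I"

lemma denoms_one: "\<one> \<in> denoms"
  using I_notcarr one_imp_carrier by auto

lemma denoms_mult: "s \<in> denoms \<Longrightarrow> t \<in> denoms \<Longrightarrow> s \<otimes> t \<in> denoms"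
  using I_prime by auto

lemma frac_eqI: "u \<in> denoms \<Longrightarrow> u \<otimes> (t \<otimes> a) = u \<otimes> (s \<otimes> b) \<Longrightarrow> frac_eq a s b t"
  unfolding frac_eq_def by blast

lemma frac_eqI1:
  "a \<in> carrier R \<Longrightarrow> b \<in> carrier R \<Longrightarrow> s \<in> denoms \<Longrightarrow> t \<in> denoms \<Longrightarrow> t \<otimes> a = s \<otimes> b \<Longrightarrow> frac_eq a s b t"
  by (rule frac_eqI[OF denoms_one]) simp

lemma frac_eq_refl: "frac_eq a s a s"
  unfolding frac_eq_def using denoms_one by blast

lemma frac_eq_sym: "frac_eq a s b t \<Longrightarrow> frac_eq b t a s"
  unfolding frac_eq_def by metis

lemma frac_eq_trans:
  assumes car: "a \<in> carrier R" "b \<in> carrier R" "c \<in> carrier R" "s \<in> denoms" "t \<in> denoms" "r \<in> denoms"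
    and 1: "frac_eq a s b t" and 2: "frac_eq b t c r"
  shows "frac_eq a s c r"
proof -
  obtain u v where u: "u \<in> denoms" "u \<otimes> (t \<otimes> a) = u \<otimes> (s \<otimes> b)"
    and v: "v \<in> denoms" "v \<otimes> (r \<otimes> b) = v \<otimes> (t \<otimes> c)"
    using 1 2 unfolding frac_eq_def by blast
  note c = car[simplified] u(1)[simplified] v(1)[simplified]
  have "(t \<otimes> (u \<otimes> v)) \<otimes> (r \<otimes> a) = (v \<otimes> r) \<otimes> (u \<otimes> (t \<otimes> a))"
    using c by (simp add: m_ac)
  also have "\<dots> = (v \<otimes> r) \<otimes> (u \<otimes> (s \<otimes> b))" using u by simp
  also have "\<dots> = (u \<otimes> s) \<otimes> (v \<otimes> (r \<otimes> b))" using c by (simp add: m_ac)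
  also have "\<dots> = (u \<otimes> s) \<otimes> (v \<otimes> (t \<otimes> c))" using v by simp
  also have "\<dots> = (t \<otimes> (u \<otimes> v)) \<otimes> (s \<otimes> c)" using c by (simp add: m_ac)
  finally show ?thesis using car u v denoms_mult by (intro frac_eqI) auto
qed

lemma mem_loc_class: "(b, t) \<in> frac a s \<longleftrightarrow> b \<in> carrier R \<and> t \<in> denoms \<and> frac_eq a s b t"
  unfolding loc_class_def frac_eq_def by auto

lemma loc_class_eq_iff:
  assumes "a \<in> carrier R" "b \<in> carrier R" "s \<in> denoms" "t \<in> denoms"
  shows "frac a s = frac b t \<longleftrightarrow> frac_eq a s b t"
proof
  assume "frac a s = frac b t"
  then have "(b, t) \<in> frac a s" using mem_loc_class assms frac_eq_refl by auto
  then show "frac_eq a s b t" using mem_loc_class by blast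
next
  assume eq: "frac_eq a s b t"
  have "frac a s \<subseteq> frac b t"
    if ab: "a \<in> carrier R" "b \<in> carrier R" "s \<in> denoms" "t \<in> denoms" and eq: "frac_eq a s b t"
    for a b s t
  proof (rule subrelI)
    fix c r assume "(c, r) \<in> frac a s"
    then have c: "c \<in> carrier R" "r \<in> denoms" "frac_eq a s c r" by (simp_all only: mem_loc_class)
    have "frac_eq b t c r"
      by (rule frac_eq_trans[OF ab(2,1) c(1) ab(4,3) c(2) frac_eq_sym[OF eq] c(3)])
    then show "(c, r) \<in> frac b t" using c by (simp only: mem_loc_class)
  qed
  from this[OF assms eq] this[OF assms(2,1,4,3) frac_eq_sym[OF eq]]
  show "frac a s = frac b t" by (rule subset_antisym)
qed

text \<open>The operations of the local ring unite over all representatives. The union is a single class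
  as soon as the result respects equality of fractions.\<close>

lemma union_over_class:
  assumes a: "a \<in> carrier R" "s \<in> denoms" and b: "b \<in> carrier R" "t \<in> denoms"
    and resp: "\<And>a' s' b' t'. a' \<in> carrier R \<Longrightarrow> s' \<in> denoms \<Longrightarrow> b' \<in> carrier R \<Longrightarrow> t' \<in> denoms \<Longrightarrow>
      frac_eq a s a' s' \<Longrightarrow> frac_eq b t b' t' \<Longrightarrow> F a' s' b' t' = F a s b t"
  shows "(\<Union>(a', s')\<in>frac a s. \<Union>(b', t')\<in>frac b t. F a' s' b' t') = F a s b t"
proof -
  have 1: "(a, s) \<in> frac a s" "(b, t) \<in> frac b t"
    using a b frac_eq_refl mem_loc_class by auto
  have 2: "F a' s' b' t' = F a s b t"
    if "(a', s') \<in> frac a s" "(b', t') \<in> frac b t" for a' s' b' t'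
    by (rule resp) (use that in \<open>simp_all only: mem_loc_class\<close>)
  show ?thesis
  proof (intro equalityI subsetI)
    fix x assume "x \<in> (\<Union>(a', s')\<in>frac a s. \<Union>(b', t')\<in>frac b t. F a' s' b' t')"
    then obtain a' s' b' t' where "(a', s') \<in> frac a s" "(b', t') \<in> frac b t"
      "x \<in> F a' s' b' t'" by auto
    then show "x \<in> F a s b t" using 2 by blast
  next
    fix x assume "x \<in> F a s b t"
    then show "x \<in> (\<Union>(a', s')\<in>frac a s. \<Union>(b', t')\<in>frac b t. F a' s' b' t')"
      using 1 by blast
  qed
qed

lemma loc_mult:
  assumes a: "a \<in> carrier R" "s \<in> denoms" and b: "b \<in> carrier R" "t \<in> denoms"
  shows "frac a s \<otimes>\<^bsub>Q\<^esub> frac b t = frac (a \<otimes> b) (s \<otimes> t)"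
  unfolding local_ring_def monoid.simps
proof (rule union_over_class[OF a b, of "\<lambda>a s b t. frac (a \<otimes> b) (s \<otimes> t)"])
  fix a' s' b' t'
  assume a': "a' \<in> carrier R" "s' \<in> denoms" and b': "b' \<in> carrier R" "t' \<in> denoms"
    and "frac_eq a s a' s'" "frac_eq b t b' t'"
  then obtain u v where u: "u \<in> denoms" "u \<otimes> (s' \<otimes> a) = u \<otimes> (s \<otimes> a')"
    and v: "v \<in> denoms" "v \<otimes> (t' \<otimes> b) = v \<otimes> (t \<otimes> b')"
    unfolding frac_eq_def by blast
  note c = a[simplified] b[simplified] a'[simplified] b'[simplified] u(1)[simplified] v(1)[simplified]
  have "(u \<otimes> v) \<otimes> ((s \<otimes> t) \<otimes> (a' \<otimes> b')) = (u \<otimes> (s \<otimes> a')) \<otimes> (v \<otimes> (t \<otimes> b'))"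
    using c by (simp add: m_ac)
  also have "\<dots> = (u \<otimes> (s' \<otimes> a)) \<otimes> (v \<otimes> (t' \<otimes> b))" using u v by simp
  also have "\<dots> = (u \<otimes> v) \<otimes> ((s' \<otimes> t') \<otimes> (a \<otimes> b))" using c by (simp add: m_ac)
  finally have "frac_eq (a' \<otimes> b') (s' \<otimes> t') (a \<otimes> b) (s \<otimes> t)"
    using u v denoms_mult by (intro frac_eqI) auto
  then show "frac (a' \<otimes> b') (s' \<otimes> t') = frac (a \<otimes> b) (s \<otimes> t)"
    using a b a' b' denoms_mult by (subst loc_class_eq_iff) auto
qed

lemma loc_add:
  assumes a: "a \<in> carrier R" "s \<in> denoms" and b: "b \<in> carrier R" "t \<in> denoms"
  shows "frac a s \<oplus>\<^bsub>Q\<^esub> frac b t =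
    frac ((t \<otimes> a) \<oplus> (s \<otimes> b)) (s \<otimes> t)"
  unfolding local_ring_def ring_record_simps
proof (rule union_over_class[OF a b, of "\<lambda>a s b t. frac ((t \<otimes> a) \<oplus> (s \<otimes> b)) (s \<otimes> t)"])
  fix a' s' b' t'
  assume a': "a' \<in> carrier R" "s' \<in> denoms" and b': "b' \<in> carrier R" "t' \<in> denoms"
    and "frac_eq a s a' s'" "frac_eq b t b' t'"
  then obtain u v where u: "u \<in> denoms" "u \<otimes> (s' \<otimes> a) = u \<otimes> (s \<otimes> a')"
    and v: "v \<in> denoms" "v \<otimes> (t' \<otimes> b) = v \<otimes> (t \<otimes> b')"
    unfolding frac_eq_def by blast
  note c = a[simplified] b[simplified] a'[simplified] b'[simplified] u(1)[simplified] v(1)[simplified]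
  have "(u \<otimes> v) \<otimes> ((s \<otimes> t) \<otimes> ((t' \<otimes> a') \<oplus> (s' \<otimes> b'))) =
      (u \<otimes> (s \<otimes> a')) \<otimes> (v \<otimes> (t \<otimes> t')) \<oplus> (v \<otimes> (t \<otimes> b')) \<otimes> (u \<otimes> (s \<otimes> s'))"
    using c by (simp add: m_ac r_distr)
  also have "\<dots> = (u \<otimes> (s' \<otimes> a)) \<otimes> (v \<otimes> (t \<otimes> t')) \<oplus> (v \<otimes> (t' \<otimes> b)) \<otimes> (u \<otimes> (s \<otimes> s'))"
    using u v by simp
  also have "\<dots> = (u \<otimes> v) \<otimes> ((s' \<otimes> t') \<otimes> ((t \<otimes> a) \<oplus> (s \<otimes> b)))"
    using c by (simp add: m_ac r_distr)
  finally have "frac_eq ((t' \<otimes> a') \<oplus> (s' \<otimes> b')) (s' \<otimes> t') ((t \<otimes> a) \<oplus> (s \<otimes> b)) (s \<otimes> t)"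
    using u v denoms_mult by (intro frac_eqI) auto
  then show "frac ((t' \<otimes> a') \<oplus> (s' \<otimes> b')) (s' \<otimes> t') = frac ((t \<otimes> a) \<oplus> (s \<otimes> b)) (s \<otimes> t)"
    using a b a' b' denoms_mult by (subst loc_class_eq_iff) auto
qed

lemma local_ring_carrierE:
  assumes "E \<in> carrier Q"
  obtains a s where "a \<in> carrier R" "s \<in> denoms" "E = frac a s"
  using assms unfolding local_ring_def by auto

lemma local_ring_carrierI:
  "a \<in> carrier R \<Longrightarrow> s \<in> denoms \<Longrightarrow> frac a s \<in> carrier Q"
  unfolding local_ring_def by auto

lemma local_ring_one: "\<one>\<^bsub>Q\<^esub> = frac \<one> \<one>"
  and local_ring_zero: "\<zero>\<^bsub>Q\<^esub> = frac \<zero> \<one>"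
  unfolding local_ring_def by auto

lemma loc_class_eqI:
  assumes "a \<in> carrier R" "b \<in> carrier R" "s \<in> denoms" "t \<in> denoms" "t \<otimes> a = s \<otimes> b"
  shows "frac a s = frac b t"
  using assms frac_eqI1 loc_class_eq_iff by auto

text \<open>The extension of an ideal is defined as a generated ideal, hence through the ideals of the localization;
  nothing can be said about it before the localization is known to be a ring.\<close>

theorem local_ring_cring: "cring Q"
proof (rule cringI)
  note mult = denoms_mult and one = denoms_one
  note ops = loc_mult loc_add local_ring_one local_ring_zero
  show "abelian_group Q"
  proof (rule abelian_groupI)
    fix x y assume xy: "x \<in> carrier Q" "y \<in> carrier Q"
    obtain a s where x: "a \<in> carrier R" "s \<in> denoms" "x = frac a s"
      by (rule local_ring_carrierE[OF xy(1)])
    obtain b t where y: "b \<in> carrier R" "t \<in> denoms" "y = frac b t"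
      by (rule local_ring_carrierE[OF xy(2)])
    show "x \<oplus>\<^bsub>Q\<^esub> y \<in> carrier Q"
      using x y mult by (simp only: ops) (intro local_ring_carrierI, auto)
    show "x \<oplus>\<^bsub>Q\<^esub> y = y \<oplus>\<^bsub>Q\<^esub> x"
      using x y mult by (simp only: ops) (simp add: m_comm a_comm)
  next
    show "\<zero>\<^bsub>Q\<^esub> \<in> carrier Q"
      unfolding local_ring_zero using local_ring_carrierI one by auto
  next
    fix x y z assume xyz: "x \<in> carrier Q" "y \<in> carrier Q"
      "z \<in> carrier Q"
    obtain a s where x: "a \<in> carrier R" "s \<in> denoms" "x = frac a s"
      by (rule local_ring_carrierE[OF xyz(1)])
    obtain b t where y: "b \<in> carrier R" "t \<in> denoms" "y = frac b t"
      by (rule local_ring_carrierE[OF xyz(2)])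
    obtain c r where z: "c \<in> carrier R" "r \<in> denoms" "z = frac c r"
      by (rule local_ring_carrierE[OF xyz(3)])
    have "x \<oplus>\<^bsub>Q\<^esub> y \<oplus>\<^bsub>Q\<^esub> z =
        frac (r \<otimes> (t \<otimes> a \<oplus> s \<otimes> b) \<oplus> (s \<otimes> t) \<otimes> c) ((s \<otimes> t) \<otimes> r)"
      unfolding x y z using x y z mult by (simp only: loc_add) (simp add: loc_add mult)
    also have "\<dots> = frac ((t \<otimes> r) \<otimes> a \<oplus> s \<otimes> (r \<otimes> b \<oplus> t \<otimes> c)) (s \<otimes> (t \<otimes> r))"
      using x(1,2) y(1,2) z(1,2) by (simp add: m_ac r_distr a_ac)
    also have "\<dots> = x \<oplus>\<^bsub>Q\<^esub> (y \<oplus>\<^bsub>Q\<^esub> z)"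
      unfolding x y z using x y z mult by (simp only: loc_add) (simp add: loc_add mult)
    finally show "x \<oplus>\<^bsub>Q\<^esub> y \<oplus>\<^bsub>Q\<^esub> z = x \<oplus>\<^bsub>Q\<^esub> (y \<oplus>\<^bsub>Q\<^esub> z)" .
  next
    fix x assume "x \<in> carrier Q"
    then obtain a s where x: "a \<in> carrier R" "s \<in> denoms" "x = frac a s"
      using local_ring_carrierE by metis
    show "\<zero>\<^bsub>Q\<^esub> \<oplus>\<^bsub>Q\<^esub> x = x"
      unfolding local_ring_zero x using x one by (simp add: loc_add)
    have "frac (\<ominus> a) s \<oplus>\<^bsub>Q\<^esub> x = frac (s \<otimes> (\<ominus> a) \<oplus> s \<otimes> a) (s \<otimes> s)"
      unfolding x using x by (simp add: loc_add)
    also have "\<dots> = frac \<zero> \<one>"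
      by (rule loc_class_eqI) (use x one mult in \<open>auto simp: r_minus l_neg\<close>)
    finally show "\<exists>y\<in>carrier Q. y \<oplus>\<^bsub>Q\<^esub> x = \<zero>\<^bsub>Q\<^esub>"
      unfolding local_ring_zero using local_ring_carrierI x by blast
  qed
  show "comm_monoid Q"
  proof (rule comm_monoidI)
    fix x y assume xy: "x \<in> carrier Q" "y \<in> carrier Q"
    obtain a s where x: "a \<in> carrier R" "s \<in> denoms" "x = frac a s"
      by (rule local_ring_carrierE[OF xy(1)])
    obtain b t where y: "b \<in> carrier R" "t \<in> denoms" "y = frac b t"
      by (rule local_ring_carrierE[OF xy(2)])
    show "x \<otimes>\<^bsub>Q\<^esub> y \<in> carrier Q"
      using x y mult by (simp only: ops) (intro local_ring_carrierI, auto)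
    show "x \<otimes>\<^bsub>Q\<^esub> y = y \<otimes>\<^bsub>Q\<^esub> x"
      using x y mult by (simp only: ops) (simp add: m_comm)
  next
    show "\<one>\<^bsub>Q\<^esub> \<in> carrier Q"
      unfolding local_ring_one using local_ring_carrierI one by auto
  next
    fix x y z assume xyz: "x \<in> carrier Q" "y \<in> carrier Q"
      "z \<in> carrier Q"
    obtain a s where x: "a \<in> carrier R" "s \<in> denoms" "x = frac a s"
      by (rule local_ring_carrierE[OF xyz(1)])
    obtain b t where y: "b \<in> carrier R" "t \<in> denoms" "y = frac b t"
      by (rule local_ring_carrierE[OF xyz(2)])
    obtain c r where z: "c \<in> carrier R" "r \<in> denoms" "z = frac c r"
      by (rule local_ring_carrierE[OF xyz(3)])
    show "x \<otimes>\<^bsub>Q\<^esub> y \<otimes>\<^bsub>Q\<^esub> z = x \<otimes>\<^bsub>Q\<^esub> (y \<otimes>\<^bsub>Q\<^esub> z)"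
      unfolding x y z using x(1,2) y(1,2) z(1,2) mult
      by (simp add: loc_mult m_assoc)
  next
    fix x assume "x \<in> carrier Q"
    then obtain a s where x: "a \<in> carrier R" "s \<in> denoms" "x = frac a s"
      using local_ring_carrierE by metis
    show "\<one>\<^bsub>Q\<^esub> \<otimes>\<^bsub>Q\<^esub> x = x"
      unfolding local_ring_one x using x one by (simp add: loc_mult)
  qed
  fix x y z assume xyz: "x \<in> carrier Q" "y \<in> carrier Q"
    "z \<in> carrier Q"
  obtain a s where x: "a \<in> carrier R" "s \<in> denoms" "x = frac a s"
    by (rule local_ring_carrierE[OF xyz(1)])
  obtain b t where y: "b \<in> carrier R" "t \<in> denoms" "y = frac b t"
    by (rule local_ring_carrierE[OF xyz(2)])
  obtain c r where z: "c \<in> carrier R" "r \<in> denoms" "z = frac c r"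
    by (rule local_ring_carrierE[OF xyz(3)])
  have "(x \<oplus>\<^bsub>Q\<^esub> y) \<otimes>\<^bsub>Q\<^esub> z = frac ((t \<otimes> a \<oplus> s \<otimes> b) \<otimes> c) ((s \<otimes> t) \<otimes> r)"
    unfolding x y z using x(1,2) y(1,2) z(1,2) mult by (simp add: loc_add loc_mult)
  also have "\<dots> = frac ((t \<otimes> r) \<otimes> (a \<otimes> c) \<oplus> (s \<otimes> r) \<otimes> (b \<otimes> c)) ((s \<otimes> r) \<otimes> (t \<otimes> r))"
    by (rule loc_class_eqI) (use x(1,2) y(1,2) z(1,2) mult in \<open>auto simp: m_ac r_distr l_distr\<close>)
  also have "\<dots> = x \<otimes>\<^bsub>Q\<^esub> z \<oplus>\<^bsub>Q\<^esub> y \<otimes>\<^bsub>Q\<^esub> z"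
    unfolding x y z using x(1,2) y(1,2) z(1,2) mult by (simp add: loc_add loc_mult)
  finally show "(x \<oplus>\<^bsub>Q\<^esub> y) \<otimes>\<^bsub>Q\<^esub> z =
      x \<otimes>\<^bsub>Q\<^esub> z \<oplus>\<^bsub>Q\<^esub> y \<otimes>\<^bsub>Q\<^esub> z" .
qed

text \<open>The fractions with numerator in \<open>K\<close> form an ideal that contains the image of \<open>K\<close>. An element of the
  contraction is therefore equal to such a fraction, and clearing denominators gives \<open>u\<close>.\<close>

theorem local_contraction_witness:
  assumes K: "ideal K R" and x: "x \<in> local_contraction R I K"
  shows "\<exists>u\<in>denoms. u \<otimes> x \<in> K"
proof -
  interpret L: cring Q by (rule local_ring_cring)
  interpret K: ideal K R by (rule K)
  note mult = denoms_mult and one = denoms_one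
  let ?E = "{frac a s | a s. a \<in> K \<and> s \<in> denoms}"
  have "ideal ?E Q"
  proof (rule idealI)
    show "ring Q" by unfold_locales
    show "subgroup ?E (add_monoid Q)"
    proof (rule L.add.subgroupI)
      show "?E \<subseteq> carrier Q" using local_ring_carrierI K.a_subset by fastforce
      show "?E \<noteq> {}" using K.zero_closed one by blast
    next
      fix y assume "y \<in> ?E"
      then obtain a s where y: "a \<in> K" "s \<in> denoms" "y = frac a s" by blast
      have aR: "a \<in> carrier R" using y K.Icarr by auto
      have "y \<oplus>\<^bsub>Q\<^esub> frac (\<ominus> a) s = frac (s \<otimes> a \<oplus> s \<otimes> (\<ominus> a)) (s \<otimes> s)"
        unfolding y using y aR by (simp add: loc_add)
      also have "\<dots> = \<zero>\<^bsub>Q\<^esub>" unfolding local_ring_zero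
        by (rule loc_class_eqI) (use y aR one mult in \<open>auto simp: r_minus r_neg\<close>)
      finally have "frac (\<ominus> a) s = \<ominus>\<^bsub>Q\<^esub> y"
        using y aR local_ring_carrierI L.minus_equality L.a_comm by (metis a_inv_closed)
      then show "\<ominus>\<^bsub>Q\<^esub> y \<in> ?E" using y K.a_inv_closed by blast
    next
      fix y z assume "y \<in> ?E" "z \<in> ?E"
      then obtain a s b t where y: "a \<in> K" "s \<in> denoms" "y = frac a s"
        and z: "b \<in> K" "t \<in> denoms" "z = frac b t" by blast
      have "y \<oplus>\<^bsub>Q\<^esub> z = frac (t \<otimes> a \<oplus> s \<otimes> b) (s \<otimes> t)"
        unfolding y z using y z K.Icarr by (intro loc_add) auto
      moreover have "t \<otimes> a \<oplus> s \<otimes> b \<in> K" using y z K.I_l_closed K.a_closed by auto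
      ultimately show "y \<oplus>\<^bsub>Q\<^esub> z \<in> ?E" using mult y z by blast
    qed
    fix y z assume "y \<in> ?E" and zc: "z \<in> carrier Q"
    then obtain a s where y: "a \<in> K" "s \<in> denoms" "y = frac a s" by blast
    obtain b t where z: "b \<in> carrier R" "t \<in> denoms" "z = frac b t"
      using local_ring_carrierE[OF zc] by blast
    have *: "z \<otimes>\<^bsub>Q\<^esub> y = frac (b \<otimes> a) (t \<otimes> s)"
      unfolding y z using y z K.Icarr by (intro loc_mult) auto
    have "b \<otimes> a \<in> K" using y z K.I_l_closed by auto
    then show "z \<otimes>\<^bsub>Q\<^esub> y \<in> ?E" using * mult y z by blast
    moreover have "y \<in> carrier Q" using y local_ring_carrierI K.Icarr by blast
    ultimately show "y \<otimes>\<^bsub>Q\<^esub> z \<in> ?E" using L.m_comm zc by simp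
  qed
  moreover have "(\<lambda>x. frac x \<one>) ` K \<subseteq> ?E" using one by blast
  ultimately have "frac x \<one> \<in> ?E"
    using x unfolding local_contraction_def genideal_def by blast
  then obtain a s where a: "a \<in> K" "s \<in> denoms" "frac x \<one> = frac a s" by blast
  have xR: "x \<in> carrier R" using x unfolding local_contraction_def by blast
  have "frac_eq x \<one> a s"
    using a loc_class_eq_iff[of x a "\<one>" s] xR one K.Icarr by blast
  then obtain u where u: "u \<in> denoms" "u \<otimes> (s \<otimes> x) = u \<otimes> (\<one> \<otimes> a)"
    unfolding frac_eq_def by blast
  have "(u \<otimes> s) \<otimes> x = u \<otimes> a" using u a xR K.Icarr by (simp add: m_assoc)
  moreover have "u \<otimes> a \<in> K" using u a K.I_l_closed by auto
  ultimately show ?thesis using mult[OF u(1) a(2)] by (intro bexI[of _ "u \<otimes> s"]) auto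
qed

end

lemma subset_local_contraction:
  assumes "K \<subseteq> carrier R"
  shows "K \<subseteq> local_contraction R p K"
  using assms unfolding local_contraction_def genideal_def by auto

section \<open>Polynomials and leading monomials\<close>

abbreviation lookup where "lookup \<equiv> Poly_Mapping.lookup"
abbreviation keys where "keys \<equiv> Poly_Mapping.keys"
abbreviation single where "single \<equiv> Poly_Mapping.single"

lemma monomials_zero: "0 \<in> monomials V"
  unfolding monomials_def by simp

lemma monomials_add: "s \<in> monomials V \<Longrightarrow> t \<in> monomials V \<Longrightarrow> s + t \<in> monomials V"
  unfolding monomials_def using keys_add[of s t] by blast

lemma keys_nat_add: "keys (s + t :: 'v \<Rightarrow>\<^sub>0 nat) = keys s \<union> keys t"
  by (auto simp: in_keys_iff lookup_add)

lemma monomials_add_iff: "s + t \<in> monomials V \<longleftrightarrow> s \<in> monomials V \<and> t \<in> monomials V"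
  unfolding monomials_def by (simp add: keys_nat_add)

lemma monomials_sum: "(\<And>x. x \<in> X \<Longrightarrow> f x \<in> monomials V) \<Longrightarrow> sum f X \<in> monomials V"
  by (induction X rule: infinite_finite_induct) (auto intro: monomials_add monomials_zero)

lemma monomials_single: "v \<in> V \<Longrightarrow> single v k \<in> monomials V"
  unfolding monomials_def by simp

lemma monomials_lookup: "t \<in> monomials V \<Longrightarrow> v \<notin> V \<Longrightarrow> lookup t v = 0"
  unfolding monomials_def by (auto simp: in_keys_iff)

lemma poly_ring_simps [simp]:
  "\<zero>\<^bsub>poly_ring V\<^esub> = 0" "\<one>\<^bsub>poly_ring V\<^esub> = 1"
  "f \<otimes>\<^bsub>poly_ring V\<^esub> h = f * h" "f \<oplus>\<^bsub>poly_ring V\<^esub> h = f + h"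
  unfolding poly_ring_def by simp_all

abbreviation (input) polys :: "'v set \<Rightarrow> ('v, 'k::comm_ring_1) mpoly set" where
  "polys V \<equiv> carrier (poly_ring V)"

lemma poly_ring_carrier: "f \<in> polys V \<longleftrightarrow> keys f \<subseteq> monomials V"
  unfolding poly_ring_def by simp

lemma carrier_add: "f \<in> polys V \<Longrightarrow> h \<in> polys V \<Longrightarrow> f + h \<in> polys V"
  unfolding poly_ring_carrier using keys_add[of f h] by blast

lemma carrier_zero: "0 \<in> polys V" and carrier_one: "1 \<in> polys V"
  unfolding poly_ring_carrier by (auto simp: monomials_zero)

lemma carrier_uminus: "f \<in> polys V \<Longrightarrow> - f \<in> polys V"
  unfolding poly_ring_carrier by (auto simp: in_keys_iff)

lemma carrier_mult: "f \<in> polys V \<Longrightarrow> h \<in> polys V \<Longrightarrow> f * h \<in> polys V"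
  unfolding poly_ring_carrier using keys_mult[of f h] monomials_add by blast

lemma carrier_sum: "(\<And>x. x \<in> X \<Longrightarrow> f x \<in> polys V) \<Longrightarrow> sum f X \<in> polys V"
  by (induction X rule: infinite_finite_induct) (auto intro: carrier_add carrier_zero)

lemma carrier_prod: "(\<And>x. x \<in> X \<Longrightarrow> f x \<in> polys V) \<Longrightarrow> prod f X \<in> polys V"
  by (induction X rule: infinite_finite_induct) (auto intro: carrier_mult carrier_one)

lemma carrier_single: "t \<in> monomials V \<Longrightarrow> single t c \<in> polys V"
  unfolding poly_ring_carrier by simp

lemma carrier_pvar: "v \<in> V \<Longrightarrow> pvar v \<in> polys V"
  unfolding pvar_def by (intro carrier_single monomials_single)

lemma carrier_signof: "of_int (sign p) \<in> polys V"
  by (auto simp: sign_def intro: carrier_one carrier_uminus)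

lemma carrier_det:
  assumes "A \<in> carrier_mat n n"
    and "\<And>i j. i < n \<Longrightarrow> j < n \<Longrightarrow> A $$ (i, j) \<in> polys V"
  shows "det A \<in> polys V"
  unfolding det_def'[OF assms(1)]
  by (intro carrier_sum carrier_mult carrier_prod carrier_signof assms(2))
    (auto dest: permutes_in_image)

lemma carrier_mono: "V \<subseteq> W \<Longrightarrow> f \<in> polys V \<Longrightarrow> f \<in> polys W"
  unfolding poly_ring_carrier monomials_def by blast

lemma poly_ring_cring: "cring (poly_ring V)"
proof (rule cringI)
  show "abelian_group (poly_ring V)"
    by (rule abelian_groupI)
      (auto simp: algebra_simps intro: carrier_add carrier_zero carrier_uminus
        intro!: bexI[of _ "- _"])
  show "comm_monoid (poly_ring V)"
    by (rule comm_monoidI) (auto simp: algebra_simps intro: carrier_mult carrier_one)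
qed (simp add: algebra_simps)

lemma poly_ring_minus: "f \<in> polys V \<Longrightarrow> \<ominus>\<^bsub>poly_ring V\<^esub> f = - f"
proof -
  interpret cring "poly_ring V" by (rule poly_ring_cring)
  assume f: "f \<in> polys V"
  show ?thesis by (rule minus_equality) (use f carrier_uminus in auto)
qed

lemma poly_idealI:
  assumes "I \<subseteq> polys V" "0 \<in> I"
    and "\<And>f h. f \<in> I \<Longrightarrow> h \<in> I \<Longrightarrow> f + h \<in> I"
    and mult: "\<And>f h. f \<in> polys V \<Longrightarrow> h \<in> I \<Longrightarrow> f * h \<in> I"
  shows "ideal I (poly_ring V)"
proof -
  interpret cring "poly_ring V" by (rule poly_ring_cring)
  have neg: "- f \<in> I" if "f \<in> I" for f
    using mult[OF carrier_uminus[OF carrier_one] that] by simp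
  show ?thesis
  proof (rule idealI)
    show "subgroup I (add_monoid (poly_ring V))"
    proof (rule add.subgroupI)
      show "\<ominus>\<^bsub>poly_ring V\<^esub> a \<in> I" if "a \<in> I" for a
        using that neg assms(1) poly_ring_minus[of a V] by auto
    qed (use assms in auto)
    show "x \<otimes>\<^bsub>poly_ring V\<^esub> a \<in> I" "a \<otimes>\<^bsub>poly_ring V\<^esub> x \<in> I"
      if "a \<in> I" "x \<in> polys V" for a x
      using that mult[of x a] by (simp_all add: mult.commute)
  qed unfold_locales
qed

context
  fixes I :: "('v, 'k::comm_ring_1) mpoly set" and V :: "'v set"
  assumes I: "ideal I (poly_ring V)"
begin

interpretation ideal I "poly_ring V" by (rule I)

lemma poly_ideal_carrier: "f \<in> I \<Longrightarrow> f \<in> polys V"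
  by (rule Icarr)

lemma poly_ideal_zero: "0 \<in> I"
  using additive_subgroup.zero_closed[OF is_additive_subgroup] by simp

lemma poly_ideal_add: "f \<in> I \<Longrightarrow> h \<in> I \<Longrightarrow> f + h \<in> I"
  using additive_subgroup.a_closed[OF is_additive_subgroup] by simp

lemma poly_ideal_mult: "f \<in> polys V \<Longrightarrow> h \<in> I \<Longrightarrow> f * h \<in> I"
  using I_l_closed by simp

lemma poly_ideal_mult_right: "f \<in> polys V \<Longrightarrow> h \<in> I \<Longrightarrow> h * f \<in> I"
  using I_r_closed by simp

lemma poly_ideal_sum: "(\<And>x. x \<in> X \<Longrightarrow> f x \<in> I) \<Longrightarrow> sum f X \<in> I"
  by (induction X rule: infinite_finite_induct) (auto intro: poly_ideal_add poly_ideal_zero)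

end

lemma genideal_poly:
  assumes "H \<subseteq> polys V"
  shows "ideal (genideal (poly_ring V) H) (poly_ring V)" "H \<subseteq> genideal (poly_ring V) H"
proof -
  interpret cring "poly_ring V" by (rule poly_ring_cring)
  show "ideal (genideal (poly_ring V) H) (poly_ring V)" "H \<subseteq> genideal (poly_ring V) H"
    using genideal_ideal[OF assms] genideal_self[OF assms] by auto
qed

lemma genideal_least: "ideal I R \<Longrightarrow> H \<subseteq> I \<Longrightarrow> genideal R H \<subseteq> I"
  unfolding genideal_def by auto

lemma poly_eq_sum_single: "f = (\<Sum>t\<in>keys f. single t (lookup f t))"
  by (rule poly_mapping_eqI) (simp add: lookup_sum lookup_single when_def in_keys_iff)

lemma lookup_mult_sum:
  fixes f h :: "('v, 'k::comm_ring_1) mpoly"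
  shows "lookup (f * h) u = (\<Sum>s\<in>keys f. \<Sum>t\<in>keys h. lookup f s * lookup h t when s + t = u)"
proof -
  have "f * h = (\<Sum>s\<in>keys f. single s (lookup f s)) * (\<Sum>t\<in>keys h. single t (lookup h t))"
    using poly_eq_sum_single[of f] poly_eq_sum_single[of h] by simp
  then have "f * h = (\<Sum>s\<in>keys f. \<Sum>t\<in>keys h. single (s + t) (lookup f s * lookup h t))"
    by (simp add: sum_product mult_single)
  then show ?thesis by (simp add: lookup_sum lookup_single)
qed

lemma keys_sum_cases:
  assumes "t \<in> keys (sum f X)"
  obtains x where "x \<in> X" "t \<in> keys (f x)"
proof -
  have "(\<Sum>x\<in>X. lookup (f x) t) \<noteq> 0" using assms by (simp add: in_keys_iff lookup_sum)
  then obtain x where "x \<in> X" "lookup (f x) t \<noteq> 0" by (rule sum.not_neutral_contains_not_neutral)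
  then show ?thesis using that by (simp add: in_keys_iff)
qed

text \<open>The relational form of the initial monomial. It makes sense for total orders that are
  not well-founded, such as the order by decreasing weight in \<open>wt_ideal_primary\<close>.\<close>

definition is_lead :: "('v monomial \<Rightarrow> 'v monomial \<Rightarrow> bool) \<Rightarrow> ('v, 'k::zero) mpoly \<Rightarrow> 'v monomial \<Rightarrow> bool" where
  "is_lead lt f t \<longleftrightarrow> t \<in> keys f \<and> (\<forall>s\<in>keys f. s \<noteq> t \<longrightarrow> lt s t)"

locale monomial_order =
  fixes V :: "'v set" and lt :: "'v monomial \<Rightarrow> 'v monomial \<Rightarrow> bool"
  assumes irrefl: "s \<in> monomials V \<Longrightarrow> \<not> lt s s"
    and trans: "\<lbrakk>s \<in> monomials V; t \<in> monomials V; u \<in> monomials V; lt s t; lt t u\<rbrakk> \<Longrightarrow> lt s u"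
    and total: "\<lbrakk>s \<in> monomials V; t \<in> monomials V; s \<noteq> t\<rbrakk> \<Longrightarrow> lt s t \<or> lt t s"
    and add_left: "\<lbrakk>s \<in> monomials V; t \<in> monomials V; u \<in> monomials V; lt s t\<rbrakk> \<Longrightarrow> lt (u + s) (u + t)"
begin

lemma add_right: "\<lbrakk>s \<in> monomials V; t \<in> monomials V; u \<in> monomials V; lt s t\<rbrakk> \<Longrightarrow> lt (s + u) (t + u)"
  using add_left[of s t u] by (simp add: add.commute)

lemma add_cancel: "\<lbrakk>s \<in> monomials V; t \<in> monomials V; u \<in> monomials V; lt (s + u) (t + u)\<rbrakk> \<Longrightarrow> lt s t"
proof (rule ccontr)
  assume m: "s \<in> monomials V" "t \<in> monomials V" "u \<in> monomials V" and l: "lt (s + u) (t + u)" and "\<not> lt s t"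
  then have "s = t \<or> lt t s" using total by blast
  then show False
  proof
    assume "s = t" then show False using l irrefl[OF monomials_add[OF m(2,3)]] by simp
  next
    assume "lt t s"
    from add_right[OF m(2,1,3) this] l show False
      using trans[OF monomials_add[OF m(1,3)] monomials_add[OF m(2,3)] monomials_add[OF m(1,3)]]
        irrefl[OF monomials_add[OF m(1,3)]] by blast
  qed
qed

lemma add_less_le:
  assumes "s \<in> monomials V" "t \<in> monomials V" "s' \<in> monomials V" "t' \<in> monomials V"
    and "lt s t \<or> s = t" "lt s' t' \<or> s' = t'" "s \<noteq> t \<or> s' \<noteq> t'"
  shows "lt (s + s') (t + t')"
proof -
  have 1: "lt (s + s') (t + s') \<or> s = t" using add_right[OF assms(1,2,3)] assms(5) by blast
  have 2: "lt (t + s') (t + t') \<or> s' = t'" using add_left[OF assms(3,4,2)] assms(6) by blast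
  show ?thesis
    using 1 2 assms(7) trans[OF monomials_add[OF assms(1,3)] monomials_add[OF assms(2,3)] monomials_add[OF assms(2,4)]]
    by auto
qed

lemma lead_exists:
  fixes f :: "('v, 'k::zero) mpoly"
  assumes "f \<noteq> 0" "keys f \<subseteq> monomials V"
  shows "\<exists>t. is_lead lt f t"
proof -
  have "\<exists>t\<in>K. \<forall>s\<in>K. s \<noteq> t \<longrightarrow> lt s t" if "finite K" "K \<noteq> {}" "K \<subseteq> monomials V" for K
    using that
  proof (induction K rule: finite_ne_induct)
    case (insert x K)
    then obtain t where t: "t \<in> K" "\<forall>s\<in>K. s \<noteq> t \<longrightarrow> lt s t" by auto
    show ?case
    proof (cases "lt t x")
      case True
      have "lt s x" if "s \<in> insert x K" "s \<noteq> x" for s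
      proof (cases "s = t")
        case False
        then have s: "s \<in> K" "lt s t" using that t by auto
        show ?thesis by (rule trans[OF _ _ _ s(2) True]) (use insert.prems s t in auto)
      qed (use True in simp)
      then show ?thesis by blast
    next
      case False
      then have "lt x t" using total[of x t] t insert by blast
      then show ?thesis using t by blast
    qed
  qed simp
  from this[of "keys f"] show ?thesis using assms by (auto simp: is_lead_def)
qed

lemma lead_unique:
  assumes "is_lead lt f s" "is_lead lt f t" "keys f \<subseteq> monomials V"
  shows "s = t"
proof (rule ccontr)
  assume "s \<noteq> t"
  then have *: "lt s t" "lt t s" "s \<in> monomials V" "t \<in> monomials V"
    using assms by (auto simp: is_lead_def)
  show False using trans[OF *(3,4,3) *(1,2)] irrefl[OF *(3)] by simp
qed

lemma initial_monomial_eq: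
  assumes "is_lead lt f t" "keys f \<subseteq> monomials V"
  shows "initial_monomial lt f = t"
  unfolding initial_monomial_def
  by (rule the_equality) (use assms lead_unique in \<open>auto simp: is_lead_def\<close>)

lemma lead_mult:
  fixes f h :: "('v, 'k::field) mpoly"
  assumes f: "is_lead lt f s" and h: "is_lead lt h t"
    and car: "keys f \<subseteq> monomials V" "keys h \<subseteq> monomials V"
  shows "is_lead lt (f * h) (s + t)"
proof -
  have st: "s \<in> keys f" "t \<in> keys h" using f h by (auto simp: is_lead_def)
  have less: "lt (s' + t') (s + t)" if "s' \<in> keys f" "t' \<in> keys h" "s' \<noteq> s \<or> t' \<noteq> t" for s' t'
    using that f h car st by (intro add_less_le) (auto simp: is_lead_def)
  have stm: "s + t \<in> monomials V" using st car monomials_add by blast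
  have ne: "s' + t' \<noteq> s + t" if "s' \<in> keys f" "t' \<in> keys h" "s' \<noteq> s \<or> t' \<noteq> t" for s' t'
    using less[OF that] irrefl[OF stm] by metis
  have "lookup (f * h) (s + t) =
      (\<Sum>s'\<in>keys f. \<Sum>t'\<in>keys h. lookup f s' * lookup h t' when s' + t' = s + t)"
    by (rule lookup_mult_sum)
  also have "\<dots> = (\<Sum>s'\<in>keys f. \<Sum>t'\<in>keys h. if s' = s \<and> t' = t then lookup f s * lookup h t else 0)"
    by (intro sum.cong refl) (use ne in \<open>auto simp: when_def\<close>)
  also have "\<dots> = (\<Sum>s'\<in>keys f. if s' = s then lookup f s * lookup h t else 0)"
    by (intro sum.cong refl) (use st in \<open>auto simp: sum.delta\<close>)
  also have "\<dots> = lookup f s * lookup h t" using st by (simp add: sum.delta)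
  finally have "s + t \<in> keys (f * h)" using st by (simp add: in_keys_iff)
  moreover have "lt u (s + t)" if "u \<in> keys (f * h)" "u \<noteq> s + t" for u
    using that keys_mult[of f h] less by blast
  ultimately show ?thesis unfolding is_lead_def by blast
qed

lemma lead_add:
  fixes f h :: "('v, 'k::field) mpoly"
  assumes f: "is_lead lt f s" and h: "is_lead lt h t" and less: "lt t s"
    and car: "keys f \<subseteq> monomials V" "keys h \<subseteq> monomials V"
  shows "is_lead lt (f + h) s"
proof -
  have st: "s \<in> keys f" "t \<in> keys h" using f h by (auto simp: is_lead_def)
  have m: "s \<in> monomials V" "t \<in> monomials V" using st car by auto
  have hs: "lt u s" if "u \<in> keys h" for u
  proof (cases "u = t")
    case False
    then have "lt u t" using that h by (simp add: is_lead_def)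
    from trans[OF _ m(2,1) this less] show ?thesis using that car by auto
  qed (use less in simp)
  have "s \<notin> keys h" using hs irrefl[OF m(1)] by auto
  then have "s \<in> keys (f + h)" using st by (simp add: in_keys_iff lookup_add)
  moreover have "lt u s" if "u \<in> keys (f + h)" "u \<noteq> s" for u
    using that keys_add[of f h] hs f unfolding is_lead_def by blast
  ultimately show ?thesis unfolding is_lead_def by blast
qed

lemma lead_sum_single:
  assumes X: "finite X" "x0 \<in> X" and c: "c x0 \<noteq> 0"
    and less: "\<And>x. x \<in> X \<Longrightarrow> x \<noteq> x0 \<Longrightarrow> c x \<noteq> 0 \<Longrightarrow> lt (u x) (u x0)"
    and car: "u x0 \<in> monomials V"
  shows "is_lead lt (\<Sum>x\<in>X. single (u x) (c x)) (u x0)"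
proof -
  have ne: "u x \<noteq> u x0" if "x \<in> X" "x \<noteq> x0" "c x \<noteq> 0" for x
    using less[OF that] irrefl[OF car] by metis
  have "lookup (\<Sum>x\<in>X. single (u x) (c x)) (u x0) = (\<Sum>x\<in>X. if x = x0 then c x0 else 0)"
    unfolding lookup_sum
    by (intro sum.cong refl) (use ne in \<open>auto simp: lookup_single when_def\<close>)
  also have "\<dots> = c x0" using X by simp
  finally have 1: "u x0 \<in> keys (\<Sum>x\<in>X. single (u x) (c x))" using c by (simp add: in_keys_iff)
  have "lt t (u x0)" if t: "t \<in> keys (\<Sum>x\<in>X. single (u x) (c x))" "t \<noteq> u x0" for t
  proof -
    obtain x where x: "x \<in> X" "t \<in> keys (single (u x) (c x))"
      using keys_sum_cases[OF t(1)] .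
    then have "t = u x" "c x \<noteq> 0" by (auto split: if_splits)
    then show ?thesis using less[OF x(1)] t(2) by auto
  qed
  then show ?thesis using 1 unfolding is_lead_def by blast
qed

end

lemma term_order_monomial_order: "term_order V lt \<Longrightarrow> monomial_order V lt"
  unfolding term_order_def by unfold_locales blast+

lemma nat_incseq_subseq:
  fixes f :: "nat \<Rightarrow> nat"
  shows "\<exists>r :: nat \<Rightarrow> nat. strict_mono r \<and> incseq (f \<circ> r)"
proof -
  obtain r :: "nat \<Rightarrow> nat" where r: "strict_mono r" "monoseq (\<lambda>n. f (r n))"
    using seq_monosub by blast
  show ?thesis
  proof (cases "incseq (f \<circ> r)")
    case True then show ?thesis using r by blast
  next
    case False
    then have dec: "\<And>i j. i \<le> j \<Longrightarrow> f (r j) \<le> f (r i)"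
      using r(2) unfolding monoseq_def incseq_def by auto
    obtain N where N: "\<And>n. f (r N) \<le> f (r n)"
      using ex_has_least_nat[of "\<lambda>_. True" 0 "\<lambda>n. f (r n)"] by auto
    have "strict_mono (\<lambda>n. r (N + n))" using r(1) by (simp add: strict_mono_def)
    moreover have "f (r (N + n)) = f (r N)" for n using dec[of N "N + n"] N[of "N + n"] by simp
    then have "incseq (f \<circ> (\<lambda>n. r (N + n)))" by (simp add: incseq_def)
    ultimately show ?thesis by blast
  qed
qed

text \<open>Dickson's lemma: refine the subsequence for one coordinate after the other.\<close>

lemma dickson:
  fixes f :: "nat \<Rightarrow> 'v \<Rightarrow> nat"
  assumes "finite V"
  shows "\<exists>r :: nat \<Rightarrow> nat. strict_mono r \<and> (\<forall>v\<in>V. incseq (\<lambda>n. f (r n) v))"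
  using assms
proof (induction V rule: finite_induct)
  case empty
  then show ?case using strict_mono_id by auto
next
  case (insert v V)
  then obtain r where r: "strict_mono r" "\<forall>v\<in>V. incseq (\<lambda>n. f (r n) v)" by blast
  obtain q where q: "strict_mono q" "incseq ((\<lambda>n. f (r n) v) \<circ> q)"
    using nat_incseq_subseq by blast
  have "incseq (\<lambda>n. f (r (q n)) w)" if "w \<in> insert v V" for w
    using that q r strict_mono_less_eq[OF q(1)] unfolding incseq_def by auto
  then show ?case using strict_mono_o[OF r(1) q(1)] by (auto simp: o_def)
qed

text \<open>By Dickson's lemma an infinite descending chain has two members of which the earlier divides the later,
  and a divisor is never larger.\<close>

lemma term_order_wf:
  assumes V: "finite V" and lt: "term_order V lt"
  shows "wf {(s, t). s \<in> monomials V \<and> t \<in> monomials V \<and> lt s t}"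
  unfolding wf_iff_no_infinite_down_chain
proof
  interpret monomial_order V lt by (rule term_order_monomial_order[OF lt])
  assume "\<exists>f. \<forall>i. (f (Suc i), f i) \<in> {(s, t). s \<in> monomials V \<and> t \<in> monomials V \<and> lt s t}"
  then obtain f where f: "\<And>i. f i \<in> monomials V" "\<And>i. lt (f (Suc i)) (f i)" by blast
  have chain: "lt (f (i + Suc d)) (f i)" for i d
  proof (induction d)
    case (Suc d)
    then show ?case using f(2)[of "i + Suc d"] trans[OF f(1) f(1) f(1)] by auto
  qed (use f in simp)
  obtain r where r: "strict_mono r" "\<forall>v\<in>V. incseq (\<lambda>n. lookup (f (r n)) v)"
    using dickson[OF V, of "\<lambda>n. lookup (f n)"] by blast
  have le: "lookup (f (r 0)) v \<le> lookup (f (r 1)) v" for v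
    using r(2) monomials_lookup[OF f(1)] by (cases "v \<in> V") (auto simp: incseq_def)
  let ?d = "f (r 1) - f (r 0)"
  have eq: "f (r 1) = f (r 0) + ?d"
    using le by (intro poly_mapping_eqI) (simp add: lookup_add lookup_minus)
  then have d: "?d \<in> monomials V" using f(1)[of "r 1"] monomials_add_iff by metis
  have "r 0 < r 1" using r(1) by (simp add: strict_mono_def)
  then have *: "lt (f (r 1)) (f (r 0))"
    using chain[of "r 0" "r 1 - r 0 - 1"] by simp
  show False
  proof (cases "?d = 0")
    case True then show False using * eq irrefl f(1) by simp
  next
    case False
    then have "lt 0 ?d" using lt d unfolding term_order_def by blast
    from add_left[OF monomials_zero d f(1) this, of "r 0"] have "lt (f (r 0)) (f (r 1))" using eq by simp
    then show False using * irrefl trans f(1) by blast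
  qed
qed

section \<open>Polynomials with coprime leading monomials\<close>

definition mdvd :: "'v monomial \<Rightarrow> 'v monomial \<Rightarrow> bool" where
  "mdvd s t \<longleftrightarrow> (\<forall>v. lookup s v \<le> lookup t v)"

lemma mdvd_add: "mdvd s (s + t)"
  unfolding mdvd_def by (simp add: lookup_add)

lemma mdvdE:
  assumes "mdvd s t"
  obtains u where "t = s + u"
proof
  show "t = s + (t - s)"
    using assms by (intro poly_mapping_eqI) (simp add: mdvd_def lookup_add lookup_minus)
qed

lemma mdvd_disjoint_cancel:
  assumes "mdvd s (t + u)" "keys s \<inter> keys u = {}"
  shows "mdvd s t"
  unfolding mdvd_def
proof
  fix v
  show "lookup s v \<le> lookup t v"
  proof (cases "v \<in> keys u")
    case True
    then have "v \<notin> keys s" using assms(2) by blast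
    then show ?thesis by (simp add: in_keys_iff)
  next
    case False
    then show ?thesis
      using assms(1)[unfolded mdvd_def, rule_format, of v] by (simp add: lookup_add in_keys_iff)
  qed
qed

lemma carrier_lead:
  "is_lead lt f t \<Longrightarrow> f \<in> polys V \<Longrightarrow> t \<in> monomials V"
  unfolding is_lead_def poly_ring_carrier by auto

context
  fixes V :: "'v set" and lt and F :: "'i \<Rightarrow> ('v, 'k::field) mpoly" and L :: "'i \<Rightarrow> 'v monomial"
  assumes V: "finite V" and lt: "term_order V lt"
begin

interpretation monomial_order V lt by (rule term_order_monomial_order[OF lt])

lemma carrier_diff: "f \<in> polys V \<Longrightarrow> h \<in> polys V \<Longrightarrow> f - h \<in> polys V"
  using carrier_add[OF _ carrier_uminus, of f V h] by simp

text \<open>Division with remainder: if the leading monomial is divisible by some \<open>L i\<close>, it is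
  cancelled by a multiple of \<open>F i\<close>, otherwise it is moved to the remainder. Both steps lower the leading monomial.\<close>

lemma division:
  fixes h :: "('v, 'k) mpoly"
  assumes I: "ideal I (poly_ring V)"
    and F: "\<And>i. i \<in> X \<Longrightarrow> F i \<in> I"
    and L: "\<And>i. i \<in> X \<Longrightarrow> is_lead lt (F i) (L i)"
    and h: "h \<in> polys V"
  shows "\<exists>q r. q \<in> I \<and> r \<in> polys V \<and> h = q + r \<and>
    (\<forall>t\<in>keys r. \<forall>i\<in>X. \<not> mdvd (L i) t)"
proof -
  let ?P = "\<lambda>h :: ('v, 'k) mpoly. \<exists>q r. q \<in> I \<and> r \<in> polys V \<and> h = q + r \<and>
    (\<forall>t\<in>keys r. \<forall>i\<in>X. \<not> mdvd (L i) t)"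
  have zero: "?P 0"
    using poly_ideal_zero[OF I] carrier_zero by (intro exI[of _ 0]) auto
  have "\<forall>h. h \<in> polys V \<longrightarrow> is_lead lt h t \<longrightarrow> ?P h" for t
  proof (induction t rule: wf_induct_rule[OF term_order_wf[OF V lt]])
    case (1 t)
    show ?case
    proof (intro allI impI)
      fix h :: "('v, 'k) mpoly" assume h: "h \<in> polys V" and ht: "is_lead lt h t"
      have tm: "t \<in> monomials V" by (rule carrier_lead[OF ht h])
      have smaller: "?P h'"
        if h': "h' \<in> polys V" "\<And>s. s \<in> keys h' \<Longrightarrow> lt s t" for h' :: "('v, 'k) mpoly"
      proof (cases "h' = 0")
        case False
        then obtain s where s: "is_lead lt h' s" using lead_exists h' poly_ring_carrier by blast
        then have "lt s t" "s \<in> monomials V" using h' carrier_lead[OF s h'(1)] by (auto simp: is_lead_def)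
        then show ?thesis using 1 tm s h' by blast
      qed (use zero in simp)
      show "?P h"
      proof (cases "\<exists>i\<in>X. mdvd (L i) t")
        case False
        let ?s = "single t (lookup h t)"
        have "?P (h - ?s)"
        proof (rule smaller)
          show "h - ?s \<in> polys V"
            by (intro carrier_diff h carrier_single tm)
          show "lt s t" if "s \<in> keys (h - ?s)" for s
            using that ht by (cases "s = t") (auto simp: in_keys_iff lookup_minus lookup_single is_lead_def)
        qed
        then obtain q r where qr: "q \<in> I" "r \<in> polys V" "h - ?s = q + r"
          "\<forall>t\<in>keys r. \<forall>i\<in>X. \<not> mdvd (L i) t" by blast
        have "\<forall>t\<in>keys (r + ?s). \<forall>i\<in>X. \<not> mdvd (L i) t"
          using qr(4) False keys_add[of r ?s] by (fastforce split: if_splits)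
        moreover have "h = q + (r + ?s)" using qr(3) by (simp add: algebra_simps)
        moreover have "r + ?s \<in> polys V" using qr tm by (intro carrier_add carrier_single)
        ultimately show ?thesis using qr(1) by blast
      next
        case True
        then obtain i u where i: "i \<in> X" and u: "t = L i + u" using mdvdE by metis
        define c where "c = lookup h t / lookup (F i) (L i)"
        define p where "p = single u c * F i"
        have um: "u \<in> monomials V" and Lm: "L i \<in> monomials V" using tm u monomials_add_iff by auto
        have Fc: "F i \<in> polys V" using F[OF i] poly_ideal_carrier[OF I] by blast
        have F0: "lookup (F i) (L i) \<noteq> 0" using L[OF i] by (auto simp: is_lead_def in_keys_iff)
        have pI: "p \<in> I" unfolding p_def by (rule poly_ideal_mult[OF I carrier_single[OF um] F[OF i]])
        have pl: "lookup p (u + s) = c * lookup (F i) s" for s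
          unfolding p_def lookup_mult_sum
          by (cases "c = 0") (auto simp: when_def in_keys_iff)
        have pk: "\<exists>s. w = u + s \<and> s \<in> keys (F i)" if "w \<in> keys p" for w
          using that keys_mult[of "single u c" "F i"] unfolding p_def by (auto split: if_splits)
        have "?P (h - p)"
        proof (rule smaller)
          show "h - p \<in> polys V"
            using poly_ideal_carrier[OF I pI] by (intro carrier_diff h)
          show "lt w t" if w: "w \<in> keys (h - p)" for w
          proof -
            have "lookup p t = lookup h t" using pl[of "L i"] F0 by (simp add: u c_def add.commute)
            then have wt: "w \<noteq> t" using w by (auto simp: in_keys_iff lookup_minus)
            have "w \<in> keys h \<or> w \<in> keys p" using w by (auto simp: in_keys_iff lookup_minus)
            then show ?thesis
            proof
              assume "w \<in> keys h" then show ?thesis using ht wt by (auto simp: is_lead_def)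
            next
              assume "w \<in> keys p"
              then obtain s where s: "w = u + s" "s \<in> keys (F i)" using pk by blast
              then have "lt s (L i)" using L[OF i] wt u by (auto simp: is_lead_def add.commute)
              moreover have "s \<in> monomials V" using s Fc by (auto simp: poly_ring_carrier)
              ultimately show ?thesis using add_left[OF _ Lm um] s u by (simp add: add.commute)
            qed
          qed
        qed
        then obtain q r where qr: "q \<in> I" "r \<in> polys V" "h - p = q + r"
          "\<forall>t\<in>keys r. \<forall>i\<in>X. \<not> mdvd (L i) t" by blast
        have "h = (p + q) + r" using qr(3) by (simp add: algebra_simps)
        moreover have "p + q \<in> I" by (rule poly_ideal_add[OF I pI qr(1)])
        ultimately show ?thesis using qr by blast
      qed
    qed
  qed
  moreover have "\<exists>t. is_lead lt h t" if "h \<noteq> 0"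
    using lead_exists[OF that] h by (simp add: poly_ring_carrier)
  ultimately show ?thesis using zero h by (cases "h = 0") blast+
qed

end

text \<open>Buchberger's criterion for coprime leading monomials, by induction on the number of generators.
  Reducing the coefficient of the last generator modulo the others gives \<open>f = f2 + r * F k\<close> with \<open>f2\<close> in the ideal of
  the others and no monomial of \<open>r\<close> divisible by an earlier \<open>L i\<close>. The leading monomials of the two summands
  do not cancel: some \<open>L i\<close> divides the first, and if it divided the second, it would divide the
  leading monomial of \<open>r\<close>, being coprime to \<open>L k\<close>.\<close>

lemma coprime_leads_groebner:
  fixes F :: "nat \<Rightarrow> ('v, 'k::field) mpoly" and L :: "nat \<Rightarrow> 'v monomial"
  assumes V: "finite V" and lt: "term_order V lt"
    and F: "\<And>i. i < k \<Longrightarrow> F i \<in> polys V"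
    and L: "\<And>i. i < k \<Longrightarrow> is_lead lt (F i) (L i)"
    and coprime: "\<And>i j. i < j \<Longrightarrow> j < k \<Longrightarrow> keys (L i) \<inter> keys (L j) = {}"
    and f: "f \<in> genideal (poly_ring V) (F ` {..<k})" "is_lead lt f t"
  shows "\<exists>i<k. mdvd (L i) t"
  using F L coprime f
proof (induction k arbitrary: f t)
  case 0
  have "ideal {0} (poly_ring V)"
    by (rule poly_idealI) (auto intro: carrier_zero)
  from genideal_least[OF this, of "{}"] have "f = 0" using 0 by auto
  then show ?case using 0 by (auto simp: is_lead_def)
next
  case (Suc k)
  interpret monomial_order V lt by (rule term_order_monomial_order[OF lt])
  let ?I = "genideal (poly_ring V) (F ` {..<k})"
  have I: "ideal ?I (poly_ring V)" "F ` {..<k} \<subseteq> ?I"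
    using genideal_poly[OF image_subsetI, of "{..<k}" F V] Suc.prems(1) by auto
  have Fk: "F k \<in> polys V" using Suc.prems by simp
  let ?E = "{f + h * F k | f h. f \<in> ?I \<and> h \<in> polys V}"
  have "ideal ?E (poly_ring V)"
  proof (rule poly_idealI)
    show "?E \<subseteq> polys V"
      using poly_ideal_carrier[OF I(1)] Fk by (auto intro: carrier_add carrier_mult)
    show "0 \<in> ?E" using poly_ideal_zero[OF I(1)] carrier_zero by (intro CollectI exI[of _ 0]) auto
    show "x + y \<in> ?E" if "x \<in> ?E" "y \<in> ?E" for x y
    proof -
      from that obtain f h f' h' where "x = f + h * F k" "f \<in> ?I" "h \<in> polys V"
        "y = f' + h' * F k" "f' \<in> ?I" "h' \<in> polys V" by blast
      then show ?thesis using poly_ideal_add[OF I(1)]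
        by (intro CollectI exI[of _ "f + f'"] exI[of _ "h + h'"]) (auto simp: algebra_simps intro: carrier_add)
    qed
    show "x * y \<in> ?E" if "x \<in> polys V" "y \<in> ?E" for x y
    proof -
      from that obtain f h where "y = f + h * F k" "f \<in> ?I" "h \<in> polys V" by blast
      then show ?thesis using that(1) poly_ideal_mult[OF I(1) that(1)]
        by (intro CollectI exI[of _ "x * f"] exI[of _ "x * h"]) (auto simp: algebra_simps intro: carrier_mult)
    qed
  qed
  moreover have "F ` {..<Suc k} \<subseteq> ?E"
  proof
    fix x assume "x \<in> F ` {..<Suc k}"
    then have "x = F k \<or> x \<in> F ` {..<k}" by (auto simp: less_Suc_eq)
    then consider "x = F k" | "x \<in> ?I" using I(2) by blast
    then show "x \<in> ?E"
    proof cases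
      case 1 then show ?thesis using poly_ideal_zero[OF I(1)] carrier_one
        by (intro CollectI exI[of _ 0] exI[of _ 1]) auto
    next
      case 2 then show ?thesis using carrier_zero
        by (intro CollectI exI[of _ x] exI[of _ 0]) auto
    qed
  qed
  ultimately have "f \<in> ?E" using genideal_least Suc.prems(4) by blast
  then obtain f1 h where f1: "f = f1 + h * F k" "f1 \<in> ?I" "h \<in> polys V" by blast
  obtain q r where qr: "q \<in> ?I" "r \<in> polys V" "h = q + r"
    "\<forall>t\<in>keys r. \<forall>i\<in>{..<k}. \<not> mdvd (L i) t"
    using division[OF V lt I(1), where X = "{..<k}" and F = F and L = L and h = h] I(2) Suc.prems f1 by auto
  define f2 where "f2 = f1 + q * F k"
  have f2: "f2 \<in> ?I" "f = f2 + r * F k"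
    unfolding f2_def using poly_ideal_add[OF I(1) f1(2) poly_ideal_mult_right[OF I(1) Fk qr(1)]] f1 qr
    by (auto simp: algebra_simps)
  have f2c: "f2 \<in> polys V" using poly_ideal_carrier[OF I(1)] f2 by blast
  have IH: "\<exists>i<k. mdvd (L i) s" if "is_lead lt f2 s" for s
    using Suc.IH[of f2 s] Suc.prems f2 that by auto
  show ?case
  proof (cases "r = 0")
    case True
    then show ?thesis using IH[of t] f2 Suc.prems(5) by (auto intro: less_SucI)
  next
    case False
    then obtain s where s: "is_lead lt r s" using lead_exists qr poly_ring_carrier by blast
    have rk: "keys r \<subseteq> monomials V" "keys (F k) \<subseteq> monomials V" "keys f2 \<subseteq> monomials V"
      using qr Fk f2c by (auto simp: poly_ring_carrier)
    have rF: "is_lead lt (r * F k) (s + L k)"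
      by (rule lead_mult[OF s _ rk(1,2)]) (use Suc.prems in simp)
    have rFk: "keys (r * F k) \<subseteq> monomials V"
      using carrier_mult[OF qr(2) Fk] by (simp add: poly_ring_carrier)
    have fk: "keys f \<subseteq> monomials V"
      using carrier_add[OF f2c carrier_mult[OF qr(2) Fk]] f2(2) by (simp add: poly_ring_carrier)
    show ?thesis
    proof (cases "f2 = 0")
      case True
      then have "t = s + L k" using lead_unique[OF Suc.prems(5) _ fk] rF f2(2) by simp
      then show ?thesis using mdvd_add[of "L k" s] by (auto simp: add.commute)
    next
      case False
      then obtain w where w: "is_lead lt f2 w" using lead_exists rk by blast
      then obtain i where i: "i < k" "mdvd (L i) w" using IH by blast
      have "w \<noteq> s + L k"
      proof
        assume "w = s + L k"
        then have "mdvd (L i) s" using i Suc.prems(3)[of i k] mdvd_disjoint_cancel by auto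
        then show False using qr(4) s i by (auto simp: is_lead_def)
      qed
      moreover have "w \<in> monomials V" "s + L k \<in> monomials V"
        using w rF rk rFk by (auto simp: is_lead_def)
      ultimately consider "lt w (s + L k)" | "lt (s + L k) w" using total by blast
      then show ?thesis
      proof cases
        case 1
        have "t = s + L k"
          using lead_unique[OF Suc.prems(5) _ fk] lead_add[OF rF w 1 rFk rk(3)] f2(2) by (simp add: add.commute)
        then show ?thesis using mdvd_add[of "L k" s] by (auto simp: add.commute)
      next
        case 2
        have "t = w"
          using lead_unique[OF Suc.prems(5) _ fk] lead_add[OF w rF 2 rk(3) rFk] f2(2) by simp
        then show ?thesis using i less_SucI by blast
      qed
    qed
  qed
qed

section \<open>The term order of the link\<close>

text \<open>In the application the \<open>e k\<close> are the exponents of the \<open>Y\<close>-variables and \<open>p\<close> takes the \<open>x\<close>-part.\<close>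

lemma lex_order_term_order:
  fixes e :: "nat \<Rightarrow> 'v monomial \<Rightarrow> nat" and p :: "'v monomial \<Rightarrow> 'v monomial"
  assumes lt: "term_order W lt"
    and p: "\<And>u. u \<in> monomials V \<Longrightarrow> p u \<in> monomials W"
    and e_add: "\<And>k u v. e k (u + v) = e k u + e k v"
    and p_add: "\<And>u v. p (u + v) = p u + p v"
    and e0: "\<And>k. e k 0 = 0" and p0: "p 0 = 0"
    and inj: "\<And>u v. \<lbrakk>u \<in> monomials V; v \<in> monomials V; \<And>k. k < N \<Longrightarrow> e k u = e k v; p u = p v\<rbrakk> \<Longrightarrow> u = v"
  shows "term_order V (\<lambda>u v. (\<exists>k<N. (\<forall>j<k. e j u = e j v) \<and> e k u < e k v) \<or>
    (\<forall>k<N. e k u = e k v) \<and> lt (p u) (p v))"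
    (is "term_order V ?L")
proof -
  interpret monomial_order W lt by (rule term_order_monomial_order[OF lt])
  have cmp: "?L u v \<or> ?L v u \<or> (\<forall>k<N. e k u = e k v) \<and> p u = p v"
    if "u \<in> monomials V" "v \<in> monomials V" for u v
  proof (cases "\<forall>k<N. e k u = e k v")
    case True
    then show ?thesis using total[OF p[OF that(1)] p[OF that(2)]] by auto
  next
    case False
    define k where "k = (LEAST k. k < N \<and> e k u \<noteq> e k v)"
    have k: "k < N" "e k u \<noteq> e k v" using False LeastI_ex[of "\<lambda>k. k < N \<and> e k u \<noteq> e k v"] unfolding k_def by auto
    have "e j u = e j v" if "j < k" for j
      using not_less_Least[of j "\<lambda>k. k < N \<and> e k u \<noteq> e k v"] that k unfolding k_def[symmetric] by auto
    then show ?thesis using k by (metis linorder_neqE_nat)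
  qed
  have tr: "?L s u" if m: "s \<in> monomials V" "t \<in> monomials V" "u \<in> monomials V" and "?L s t" "?L t u" for s t u
  proof -
    from that(4) show ?thesis
    proof
      assume "\<exists>k<N. (\<forall>j<k. e j s = e j t) \<and> e k s < e k t"
      then obtain k where k: "k < N" "\<forall>j<k. e j s = e j t" "e k s < e k t" by blast
      from that(5) show ?thesis
      proof
        assume "\<exists>k<N. (\<forall>j<k. e j t = e j u) \<and> e k t < e k u"
        then obtain l where l: "l < N" "\<forall>j<l. e j t = e j u" "e l t < e l u" by blast
        have "e (min k l) s < e (min k l) u" using k l by (cases k l rule: linorder_cases) (auto simp: min_def)
        moreover have "\<forall>j<min k l. e j s = e j u" using k l by auto
        moreover have "min k l < N" using k by simp
        ultimately show ?thesis by blast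
      next
        assume "(\<forall>k<N. e k t = e k u) \<and> lt (p t) (p u)"
        then show ?thesis using k by auto
      qed
    next
      assume st: "(\<forall>k<N. e k s = e k t) \<and> lt (p s) (p t)"
      from that(5) show ?thesis
      proof
        assume "\<exists>k<N. (\<forall>j<k. e j t = e j u) \<and> e k t < e k u"
        then show ?thesis using st by auto
      next
        assume "(\<forall>k<N. e k t = e k u) \<and> lt (p t) (p u)"
        then show ?thesis using st trans[OF p[OF m(1)] p[OF m(2)] p[OF m(3)]] by auto
      qed
    qed
  qed
  have zero: "?L 0 s" if "s \<in> monomials V" "s \<noteq> 0" for s
  proof -
    have "\<not> ?L s 0"
    proof
      assume "?L s 0"
      then have "lt (p s) 0" using e0 p0 by auto
      moreover have "lt 0 (p s) \<or> p s = 0" using lt p[OF that(1)] unfolding term_order_def by blast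
      ultimately show False using irrefl[OF p[OF that(1)]] irrefl[OF monomials_zero]
        trans[OF p[OF that(1)] monomials_zero p[OF that(1)]] by auto
    qed
    then show ?thesis
      using cmp[OF that(1) monomials_zero] inj[OF that(1) monomials_zero] that(2) by blast
  qed
  have add: "?L (u + s) (u + t)"
    if m: "s \<in> monomials V" "t \<in> monomials V" "u \<in> monomials V" and "?L s t" for s t u
    using that(4) add_left[OF p[OF m(1)] p[OF m(2)] p[OF m(3)]] by (auto simp add: e_add p_add)
  have irr: "\<not> ?L s s" if "s \<in> monomials V" for s using irrefl[OF p[OF that]] by simp
  show ?thesis unfolding term_order_def
  proof (intro conjI ballI impI)
    show "?L s t \<or> ?L t s" if "s \<in> monomials V" "t \<in> monomials V" "s \<noteq> t" for s t
      using cmp[OF that(1,2)] inj[OF that(1,2)] that(3) by blast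
    show "\<not> ?L s s" if "s \<in> monomials V" for s by (rule irr[OF that])
    show "?L s u" if "s \<in> monomials V" "t \<in> monomials V" "u \<in> monomials V" "?L s t" "?L t u" for s t u
      by (rule tr[OF that])
    show "?L 0 s" if "s \<in> monomials V" "s \<noteq> 0" for s by (rule zero[OF that])
    show "?L (u + s) (u + t)" if "s \<in> monomials V" "t \<in> monomials V" "u \<in> monomials V" "?L s t" for s t u
      by (rule add[OF that])
  qed
qed

lemma lex_less_than_iff:
  assumes "length xs = length zs"
  shows "(xs, zs) \<in> lex less_than \<longleftrightarrow> (\<exists>k<length xs. (\<forall>j<k. xs ! j = zs ! j) \<and> xs ! k < (zs ! k :: nat))"
proof
  assume "(xs, zs) \<in> lex less_than"
  then obtain ps x y xs' zs' where "xs = ps @ x # xs'" "zs = ps @ y # zs'" "x < y"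
    unfolding lex_conv by auto
  then show "\<exists>k<length xs. (\<forall>j<k. xs ! j = zs ! j) \<and> xs ! k < zs ! k"
    by (intro exI[of _ "length ps"]) (auto simp: nth_append)
next
  assume "\<exists>k<length xs. (\<forall>j<k. xs ! j = zs ! j) \<and> xs ! k < zs ! k"
  then obtain k where k: "k < length xs" "\<forall>j<k. xs ! j = zs ! j" "xs ! k < zs ! k" by blast
  have "xs = take k xs @ xs ! k # drop (Suc k) xs" "zs = take k xs @ zs ! k # drop (Suc k) zs"
  proof -
    show "xs = take k xs @ xs ! k # drop (Suc k) xs" using k by (simp add: id_take_nth_drop)
    have "take k zs = take k xs" using k assms by (intro nth_equalityI) auto
    then show "zs = take k xs @ zs ! k # drop (Suc k) zs"
      using k assms id_take_nth_drop[of k zs] by simp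
  qed
  then show "(xs, zs) \<in> lex less_than"
    unfolding lex_conv using k assms by blast
qed

lemma lookup_x_part: "lookup (x_part u) v = (case v of XVar i j \<Rightarrow> lookup u v | YVar i j \<Rightarrow> 0)"
  unfolding x_part_def lookup_mapp by (auto simp: when_def in_keys_iff split: var.split)

lemma x_part_add: "x_part (u + v) = x_part u + x_part v"
  by (rule poly_mapping_eqI) (auto simp: lookup_x_part lookup_add split: var.split)

lemma x_part_zero: "x_part 0 = 0"
  by (rule poly_mapping_eqI) (auto simp: lookup_x_part split: var.split)

lemma x_part_monomials: "u \<in> monomials (svars m n) \<Longrightarrow> x_part u \<in> monomials (xvars m n)"
  unfolding monomials_def svars_def yvars_def
  by (auto simp: in_keys_iff lookup_x_part subset_iff split: var.splits)

definition y_exp :: "(nat \<times> nat) list \<Rightarrow> nat \<Rightarrow> var monomial \<Rightarrow> nat" where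
  "y_exp ys k u = lookup u (YVar (fst (ys ! k)) (snd (ys ! k)))"

lemma y_exp_eq_imp:
  assumes ys: "y_order m n ys" and u: "u \<in> monomials (svars m n)" and v: "v \<in> monomials (svars m n)"
    and eq: "\<And>k. k < length ys \<Longrightarrow> y_exp ys k u = y_exp ys k v"
  shows "lookup u (YVar i j) = lookup v (YVar i j)"
proof (cases "(i, j) \<in> set ys")
  case True
  then obtain k where "k < length ys" "ys ! k = (i, j)" by (auto simp: in_set_conv_nth)
  then show ?thesis using eq[of k] by (simp add: y_exp_def)
next
  case False
  then have "YVar i j \<notin> svars m n" using ys unfolding y_order_def svars_def xvars_def yvars_def by auto
  then show ?thesis using monomials_lookup[OF u] monomials_lookup[OF v] by simp
qed

lemma link_order_iff:
  assumes ys: "y_order m n ys" and u: "u \<in> monomials (svars m n)" and v: "v \<in> monomials (svars m n)"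
  shows "link_order ys lt u v \<longleftrightarrow>
    (\<exists>k<length ys. (\<forall>j<k. y_exp ys j u = y_exp ys j v) \<and> y_exp ys k u < y_exp ys k v) \<or>
    (\<forall>k<length ys. y_exp ys k u = y_exp ys k v) \<and> lt (x_part u) (x_part v)"
proof -
  have nth: "y_exponents ys (u - x_part u) ! k = y_exp ys k u" if "k < length ys" for k and u :: "var monomial"
    using that unfolding y_exponents_def y_exp_def
    by (simp add: case_prod_beta lookup_minus lookup_x_part)
  have len: "length (y_exponents ys w) = length ys" for w unfolding y_exponents_def by simp
  have 1: "(y_exponents ys (u - x_part u), y_exponents ys (v - x_part v)) \<in> lex less_than \<longleftrightarrow>
      (\<exists>k<length ys. (\<forall>j<k. y_exp ys j u = y_exp ys j v) \<and> y_exp ys k u < y_exp ys k v)"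
    by (subst lex_less_than_iff) (auto simp: len nth)
  have "u - x_part u = v - x_part v" if eq: "\<forall>k<length ys. y_exp ys k u = y_exp ys k v"
    using y_exp_eq_imp[OF ys u v] eq
    by (intro poly_mapping_eqI) (auto simp: lookup_minus lookup_x_part split: var.split)
  moreover have "\<forall>k<length ys. y_exp ys k u = y_exp ys k v" if "u - x_part u = v - x_part v"
    using nth that by metis
  ultimately have 2: "u - x_part u = v - x_part v \<longleftrightarrow> (\<forall>k<length ys. y_exp ys k u = y_exp ys k v)" by blast
  show ?thesis unfolding link_order_def 1 2 ..
qed

lemma link_order_term_order:
  assumes ys: "y_order m n ys" and lt: "term_order (xvars m n) lt"
  shows "term_order (svars m n) (link_order ys lt)"
proof -
  have "term_order (svars m n) (\<lambda>u v. (\<exists>k<length ys. (\<forall>j<k. y_exp ys j u = y_exp ys j v) \<and> y_exp ys k u < y_exp ys k v) \<or>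
    (\<forall>k<length ys. y_exp ys k u = y_exp ys k v) \<and> lt (x_part u) (x_part v))" (is "term_order _ ?L")
  proof (rule lex_order_term_order[OF lt x_part_monomials])
    fix u v assume u: "u \<in> monomials (svars m n)" and v: "v \<in> monomials (svars m n)"
      and y: "\<And>k. k < length ys \<Longrightarrow> y_exp ys k u = y_exp ys k v" and x: "x_part u = x_part v"
    show "u = v"
    proof (rule poly_mapping_eqI)
      fix w
      show "lookup u w = lookup v w"
        using arg_cong[OF x, of "\<lambda>u. lookup u w"] y_exp_eq_imp[OF ys u v y]
        by (cases w) (auto simp: lookup_x_part)
    qed
  qed (auto simp: y_exp_def lookup_add x_part_add x_part_zero)
  moreover have "link_order ys lt u v = ?L u v"
    if "u \<in> monomials (svars m n)" "v \<in> monomials (svars m n)" for u v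
    by (rule link_order_iff[OF ys that])
  ultimately show ?thesis
    unfolding term_order_def by (simp add: monomials_add monomials_zero cong: ball_cong)
qed

lemma finite_svars: "finite (svars m n)"
proof -
  have "svars m n = (\<lambda>(i, j). XVar i j) ` ({..<m} \<times> {..<n}) \<union>
      (\<lambda>(i, j). YVar i j) ` ({..<n - m + 1} \<times> {..<n choose m})"
    unfolding svars_def xvars_def yvars_def by auto
  then show ?thesis by simp
qed

section \<open>Determinants and staircase paths\<close>

text \<open>A permutation with a nonzero term fixes all indices outside the range of \<open>e\<close>, so the
  sum over the permutations reduces to those of the range.\<close>

lemma det_unit_rows_outside:
  fixes M :: "'a :: comm_ring_1 mat"
  assumes M: "M \<in> carrier_mat N N"
    and e: "inj_on e {0..<m}" "e ` {0..<m} \<subseteq> {0..<N}"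
    and unit: "\<And>q q'. q < N \<Longrightarrow> q' < N \<Longrightarrow> q \<notin> e ` {0..<m} \<Longrightarrow> M $$ (q, q') = (if q = q' then 1 else 0)"
  shows "det M = det (mat m m (\<lambda>(i, j). M $$ (e i, e j)))"
proof -
  let ?E = "e ` {0..<m}"
  have bij: "bij_betw e {0..<m} ?E" using e by (simp add: bij_betw_def)
  have "det M = (\<Sum>p | p permutes {0..<N}. signof p * (\<Prod>q = 0..<N. M $$ (q, p q)))"
    by (rule det_def'[OF M])
  also have "\<dots> = (\<Sum>p | p permutes ?E. signof p * (\<Prod>q = 0..<N. M $$ (q, p q)))"
  proof (rule sum.mono_neutral_right)
    show "finite {p. p permutes {0..<N}}" by (simp add: finite_permutations)
    show "{p. p permutes ?E} \<subseteq> {p. p permutes {0..<N}}" using permutes_subset[OF _ e(2)] by blast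
    show "\<forall>p\<in>{p. p permutes {0..<N}} - {p. p permutes ?E}. signof p * (\<Prod>q = 0..<N. M $$ (q, p q)) = 0"
    proof
      fix p assume "p \<in> {p. p permutes {0..<N}} - {p. p permutes ?E}"
      then have p: "p permutes {0..<N}" and np: "\<not> p permutes ?E" by auto
      have "\<exists>q\<in>{0..<N} - ?E. p q \<noteq> q"
      proof (rule ccontr)
        assume "\<not> ?thesis"
        then have "p q = q" if "q \<notin> ?E" for q
          using that permutes_not_in[OF p, of q] by blast
        then have "p permutes ?E" using p unfolding permutes_def by blast
        then show False using np by simp
      qed
      then obtain q where q: "q \<in> {0..<N}" "q \<notin> ?E" "p q \<noteq> q" by blast
      then have "M $$ (q, p q) = 0" using unit[of q "p q"] permutes_in_image[OF p, of q] by auto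
      then have "(\<Prod>q = 0..<N. M $$ (q, p q)) = 0" using q by (intro prod_zero) auto
      then show "signof p * (\<Prod>q = 0..<N. M $$ (q, p q)) = 0" by simp
    qed
  qed
  also have "\<dots> = (\<Sum>p | p permutes {0..<m}. signof p * (\<Prod>i = 0..<m. M $$ (e i, e (p i))))"
  proof (rule sum.reindex_bij_witness[of _ "map_permutation {0..<m} e" "map_permutation ?E (inv_into {0..<m} e)"])
    have inv: "bij_betw (inv_into {0..<m} e) ?E {0..<m}" by (rule bij_betw_inv_into[OF bij])
    fix p assume p: "p \<in> {p. p permutes ?E}"
    then show "map_permutation ?E (inv_into {0..<m} e) p \<in> {p. p permutes {0..<m}}"
      using map_permutation_permutes[OF inv] by auto
    show rt: "map_permutation {0..<m} e (map_permutation ?E (inv_into {0..<m} e) p) = p"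
      by (rule map_permutation_compose_inv[OF inv]) (use p in \<open>auto simp: f_inv_into_f\<close>)
    let ?p = "map_permutation ?E (inv_into {0..<m} e) p"
    have pp: "?p permutes {0..<m}" using map_permutation_permutes[OF inv] p by auto
    have pe: "p (e i) = e (?p i)" if "i \<in> {0..<m}" for i
      using map_permutation_apply[OF e(1) that, of ?p] rt by simp
    have sign: "sign p = sign ?p"
      using sign_map_permutation[OF e(1) pp] rt by simp
    have "(\<Prod>q = 0..<N. M $$ (q, p q)) = (\<Prod>q\<in>?E. M $$ (q, p q))"
    proof (rule prod.mono_neutral_right)
      show "\<forall>q\<in>{0..<N} - ?E. M $$ (q, p q) = 1"
        using p unit by (auto simp: permutes_not_in)
    qed (use e in auto)
    also have "\<dots> = (\<Prod>i = 0..<m. M $$ (e i, p (e i)))"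
      using e(1) by (simp add: prod.reindex)
    also have "\<dots> = (\<Prod>i = 0..<m. M $$ (e i, e (?p i)))" using pe by simp
    finally show "signof ?p * (\<Prod>i = 0..<m. M $$ (e i, e (?p i))) = signof p * (\<Prod>q = 0..<N. M $$ (q, p q))"
      using sign by simp
  next
    fix p assume p: "p \<in> {p. p permutes {0..<m}}"
    then show "map_permutation {0..<m} e p \<in> {p. p permutes ?E}"
      using map_permutation_permutes[OF bij] by auto
    show "map_permutation ?E (inv_into {0..<m} e) (map_permutation {0..<m} e p) = p"
      by (rule map_permutation_compose_inv[OF bij]) (use p e in auto)
  qed
  also have "\<dots> = det (mat m m (\<lambda>(i, j). M $$ (e i, e j)))"
    by (subst det_def'[of _ m]) (auto intro!: sum.cong prod.cong dest: permutes_in_image)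
  finally show ?thesis .
qed

text \<open>Multilinearity: each row is the sum of its parts in the \<open>g\<close> blocks of columns, and \<open>\<phi>\<close> picks
  one part of every row.\<close>

lemma det_split_rows:
  fixes M :: "'a :: comm_ring_1 mat"
  assumes M: "M \<in> carrier_mat N N" and blk: "\<And>q. q < N \<Longrightarrow> blk q < (g::nat)"
  shows "det M = (\<Sum>\<phi>\<in>PiE {0..<N} (\<lambda>_. {..<g}).
    det (mat N N (\<lambda>(q, q'). if blk q' = \<phi> q then M $$ (q, q') else 0)))"
proof -
  have "det M = (\<Sum>p | p permutes {0..<N}. signof p * (\<Prod>q = 0..<N. M $$ (q, p q)))"
    by (rule det_def'[OF M])
  also have "\<dots> = (\<Sum>p | p permutes {0..<N}. signof p *
      (\<Sum>\<phi>\<in>PiE {0..<N} (\<lambda>_. {..<g}). \<Prod>q = 0..<N. if blk (p q) = \<phi> q then M $$ (q, p q) else 0))"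
  proof (rule sum.cong[OF refl])
    fix p assume p: "p \<in> {p. p permutes {0..<N}}"
    have "(\<Prod>q = 0..<N. M $$ (q, p q)) =
        (\<Prod>q = 0..<N. \<Sum>i<g. if blk (p q) = i then M $$ (q, p q) else 0)"
    proof (rule prod.cong[OF refl])
      fix q assume "q \<in> {0..<N}"
      then have "blk (p q) < g" using p blk permutes_in_image[of p "{0..<N}" q] by auto
      then show "M $$ (q, p q) = (\<Sum>i<g. if blk (p q) = i then M $$ (q, p q) else 0)" by simp
    qed
    also have "\<dots> = (\<Sum>\<phi>\<in>PiE {0..<N} (\<lambda>_. {..<g}). \<Prod>q = 0..<N. if blk (p q) = \<phi> q then M $$ (q, p q) else 0)"
      by (rule prod_sum_PiE) auto
    finally show "signof p * (\<Prod>q = 0..<N. M $$ (q, p q)) = signof p *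
      (\<Sum>\<phi>\<in>PiE {0..<N} (\<lambda>_. {..<g}). \<Prod>q = 0..<N. if blk (p q) = \<phi> q then M $$ (q, p q) else 0)" by simp
  qed
  also have "\<dots> = (\<Sum>\<phi>\<in>PiE {0..<N} (\<lambda>_. {..<g}). \<Sum>p | p permutes {0..<N}. signof p *
      (\<Prod>q = 0..<N. if blk (p q) = \<phi> q then M $$ (q, p q) else 0))"
    by (simp only: sum_distrib_left) (rule sum.swap)
  also have "\<dots> = (\<Sum>\<phi>\<in>PiE {0..<N} (\<lambda>_. {..<g}).
    det (mat N N (\<lambda>(q, q'). if blk q' = \<phi> q then M $$ (q, q') else 0)))"
    by (intro sum.cong refl, subst det_def'[of _ N])
      (auto intro!: sum.cong prod.cong dest: permutes_in_image)
  finally show ?thesis .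
qed

lemma sum_PiE_insert:
  assumes "i \<notin> I"
  shows "(\<Sum>k\<in>PiE (insert i I) (\<lambda>_. A). f k) = (\<Sum>k\<in>PiE I (\<lambda>_. A). \<Sum>a\<in>A. f (k(i := a)))"
proof -
  have "(\<Sum>k\<in>PiE (insert i I) (\<lambda>_. A). f k) = (\<Sum>(a, k)\<in>A \<times> PiE I (\<lambda>_. A). f (k(i := a)))"
    unfolding PiE_insert_eq
    by (subst sum.reindex[OF inj_combinator[OF assms]]) (simp add: case_prod_beta' o_def)
  also have "\<dots> = (\<Sum>a\<in>A. \<Sum>k\<in>PiE I (\<lambda>_. A). f (k(i := a)))"
    by (simp add: sum.cartesian_product)
  also have "\<dots> = (\<Sum>k\<in>PiE I (\<lambda>_. A). \<Sum>a\<in>A. f (k(i := a)))" by (rule sum.swap)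
  finally show ?thesis .
qed

text \<open>The position \<open>q = i * m + t\<close> stands for row \<open>t\<close>, counted from the bottom, in block \<open>i\<close>. On the path
  are the positions missing in the array of the staircase, where \<open>t\<close> has entry \<open>t + 1\<close>.\<close>

definition on_path :: "(nat \<Rightarrow> nat) \<Rightarrow> nat \<Rightarrow> nat \<Rightarrow> bool" where
  "on_path a m q \<longleftrightarrow> a (q div m) \<le> Suc (q mod m) \<and> Suc (q mod m) \<le> a (Suc (q div m))"

text \<open>The column of \<open>X\<close> in which the antidiagonal of minor \<open>q div m\<close> meets row \<open>q mod m\<close> (from the bottom).\<close>

definition diagonal :: "nat \<Rightarrow> nat \<Rightarrow> nat" where
  "diagonal m q = q div m + q mod m"

lemma staircase_mono: "staircase g m a \<Longrightarrow> i \<le> j \<Longrightarrow> j \<le> g \<Longrightarrow> a i \<le> a j"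
proof (induction j)
  case (Suc j)
  then show ?case by (cases "i = Suc j") (auto simp: staircase_def intro: order_trans)
qed simp

lemma staircase_bounds: "staircase g m a \<Longrightarrow> i \<le> g \<Longrightarrow> 1 \<le> a i \<and> a i \<le> m"
  using staircase_mono[of g m a 0 i] staircase_mono[of g m a i g] unfolding staircase_def by auto

lemma block_index_less: "i < g \<Longrightarrow> t < m \<Longrightarrow> i * m + t < g * (m::nat)"
proof -
  assume "i < g" "t < m"
  then have "i * m + t < Suc i * m" by simp
  also have "\<dots> \<le> g * m" using \<open>i < g\<close> by (intro mult_le_mono1) simp
  finally show ?thesis .
qed

lemma path_less:
  assumes a: "staircase g m a"
    and q: "q < g * m" "on_path a m q" "q' < g * m" "on_path a m q'" and less: "q div m < q' div m"
  shows "diagonal m q < diagonal m q'"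
proof -
  have "q' div m < g" using q(3) by (simp add: less_mult_imp_div_less)
  then have "a (Suc (q div m)) \<le> a (q' div m)"
    using less by (intro staircase_mono[OF a]) auto
  then show ?thesis using q less unfolding on_path_def diagonal_def by linarith
qed

text \<open>Along the path the diagonal increases by one in each step, whether the step leads up in a block or
  over to the next block.\<close>

lemma path_bij:
  assumes a: "staircase g m a" and m: "1 \<le> m" and g: "1 \<le> g"
  shows "bij_betw (diagonal m) {q. q < g * m \<and> on_path a m q} {..<g + m - 1}"
  unfolding bij_betw_def
proof
  have blk: "q div m < g" if "q < g * m" for q using that by (simp add: less_mult_imp_div_less)
  show "inj_on (diagonal m) {q. q < g * m \<and> on_path a m q}"
  proof (rule inj_onI)
    fix q q' assume q: "q \<in> {q. q < g * m \<and> on_path a m q}" "q' \<in> {q. q < g * m \<and> on_path a m q}"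
      and eq: "diagonal m q = diagonal m q'"
    have "q div m = q' div m" using path_less[OF a, of q q'] path_less[OF a, of q' q] q eq by (cases "q div m" "q' div m" rule: linorder_cases) auto
    then show "q = q'" using eq unfolding diagonal_def by (metis add_left_imp_eq div_mult_mod_eq)
  qed
  show "diagonal m ` {q. q < g * m \<and> on_path a m q} = {..<g + m - 1}"
  proof (intro equalityI subsetI)
    fix j assume "j \<in> diagonal m ` {q. q < g * m \<and> on_path a m q}"
    then obtain q where q: "q < g * m" "j = diagonal m q" by auto
    have "q mod m < m" using m by simp
    then show "j \<in> {..<g + m - 1}" using blk[OF q(1)] q(2) unfolding diagonal_def by auto
  next
    fix j assume j: "j \<in> {..<g + m - 1}"
    define i where "i = Max {i. i < g \<and> i + a i \<le> Suc j}"
    have fin: "finite {i. i < g \<and> i + a i \<le> Suc j}" by simp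
    have "0 \<in> {i. i < g \<and> i + a i \<le> Suc j}" using a g unfolding staircase_def by auto
    then have i: "i < g" "i + a i \<le> Suc j" using Max_in[OF fin] unfolding i_def by blast+
    have ge1: "1 \<le> a i" "a (Suc i) \<le> m" "1 \<le> a (Suc i)" using staircase_bounds[OF a] i by auto
    have up: "Suc (j - i) \<le> a (Suc i)"
    proof (cases "Suc i < g")
      case True
      have "\<not> Suc i + a (Suc i) \<le> Suc j"
        using Max_ge[OF fin, of "Suc i"] True unfolding i_def[symmetric] by auto
      then show ?thesis using ge1(3) by linarith
    next
      case False
      then have "Suc i = g" using i by simp
      then have "a (Suc i) = m" "j < i + m" using a j unfolding staircase_def by auto
      then show ?thesis using i ge1(1) by linarith
    qed
    have "j - i < m" using up ge1 by simp
    moreover have "i \<le> j" using i ge1 by simp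
    moreover have "(i * m + (j - i)) div m = i" "(i * m + (j - i)) mod m = j - i"
      using \<open>j - i < m\<close> by (simp_all del: Nat.add_diff_assoc)
    ultimately have "diagonal m (i * m + (j - i)) = j" "on_path a m (i * m + (j - i))"
      using i up m unfolding diagonal_def on_path_def by (auto simp del: Nat.add_diff_assoc)
    moreover have "i * m + (j - i) < g * m" using block_index_less i \<open>j - i < m\<close> by blast
    ultimately show "j \<in> diagonal m ` {q. q < g * m \<and> on_path a m q}" by (metis (mono_tags, lifting) image_eqI mem_Collect_eq)
  qed
qed

section \<open>Elements of the generic link\<close>

lemma block_set:
  fixes i g m :: nat
  assumes "i < g"
  shows "{r \<in> {0..<g * m}. r div m = i} = (\<lambda>s. i * m + s) ` {0..<m}"
proof (intro equalityI subsetI)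
  fix r assume "r \<in> {r \<in> {0..<g * m}. r div m = i}"
  then have r: "r < g * m" "r div m = i" by auto
  then have "0 < m" by (cases m) auto
  then have "r mod m < m" by simp
  moreover have "r = i * m + r mod m" using r by (metis div_mult_mod_eq)
  ultimately show "r \<in> (\<lambda>s. i * m + s) ` {0..<m}" by auto
next
  fix r assume "r \<in> (\<lambda>s. i * m + s) ` {0..<m}"
  then obtain s where "r = i * m + s" "s < m" by (auto simp del: image_add_atLeastLessThan)
  then show "r \<in> {r \<in> {0..<g * m}. r div m = i}" using block_index_less[OF assms, of s m] by auto
qed

text \<open>The matrix factors through the identity matrix with \<open>X\<close> put in block \<open>i\<close> of the diagonal.\<close>

lemma det_factor_block:
  fixes M :: "'a :: comm_ring_1 mat"
  assumes M: "M \<in> carrier_mat (g * m) (g * m)" and i: "i < g"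
    and fac: "\<And>q c. q < g * m \<Longrightarrow> c < m \<Longrightarrow> M $$ (q, i * m + c) = (\<Sum>s = 0..<m. E q s * X s c)"
  shows "det M = det (mat (g * m) (g * m) (\<lambda>(q, q'). if q' div m = i then E q (q' mod m) else M $$ (q, q')))
    * det (mat m m (\<lambda>(s, c). X s c))"
proof -
  let ?N = "g * m"
  define A where "A = mat ?N ?N (\<lambda>(q, q'). if q' div m = i then E q (q' mod m) else M $$ (q, q'))"
  define W where "W = mat ?N ?N (\<lambda>(r, q'). if r div m = i then (if q' div m = i then X (r mod m) (q' mod m) else 0)
    else (if r = q' then 1 else 0))"
  have A: "A \<in> carrier_mat ?N ?N" and W: "W \<in> carrier_mat ?N ?N" unfolding A_def W_def by auto
  have "M = A * W"
  proof (rule eq_matI)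
    fix q q' assume "q < dim_row (A * W)" "q' < dim_col (A * W)"
    then have q: "q < ?N" "q' < ?N" using A W by auto
    have "(A * W) $$ (q, q') = (\<Sum>r = 0..<?N. A $$ (q, r) * W $$ (r, q'))"
      using q A W by (simp add: scalar_prod_def)
    also have "\<dots> = M $$ (q, q')"
    proof (cases "q' div m = i")
      case False
      have "(\<Sum>r = 0..<?N. A $$ (q, r) * W $$ (r, q')) = (\<Sum>r = 0..<?N. if r = q' then M $$ (q, q') else 0)"
        by (rule sum.cong) (use q False in \<open>auto simp: A_def W_def\<close>)
      then show ?thesis using q by simp
    next
      case True
      have m0: "0 < m" using q by (cases m) auto
      have q': "q' = i * m + q' mod m" using True by (metis div_mult_mod_eq)
      have "(\<Sum>r = 0..<?N. A $$ (q, r) * W $$ (r, q')) =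
          (\<Sum>r\<in>{r \<in> {0..<?N}. r div m = i}. A $$ (q, r) * W $$ (r, q'))"
        by (rule sum.mono_neutral_right) (use q True in \<open>auto simp: W_def\<close>)
      also have "\<dots> = (\<Sum>s = 0..<m. A $$ (q, i * m + s) * W $$ (i * m + s, q'))"
        unfolding block_set[OF i] by (subst sum.reindex) (auto simp: inj_on_def)
      also have "\<dots> = (\<Sum>s = 0..<m. E q s * X s (q' mod m))"
        by (rule sum.cong) (use q True block_index_less[OF i] in \<open>auto simp: A_def W_def\<close>)
      also have "\<dots> = M $$ (q, i * m + q' mod m)" using fac[OF q(1), of "q' mod m"] m0 by simp
      finally show ?thesis using q' by simp
    qed
    finally show "M $$ (q, q') = (A * W) $$ (q, q')" by simp
  qed (use A W M in auto)
  then have "det M = det A * det W" using det_mult[OF A W] by simp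
  also have "det W = det (mat m m (\<lambda>(s, c). W $$ (i * m + s, i * m + c)))"
  proof (rule det_unit_rows_outside[OF W])
    show "inj_on (\<lambda>s. i * m + s) {0..<m}" by (simp add: inj_on_def)
    show "(\<lambda>s. i * m + s) ` {0..<m} \<subseteq> {0..<?N}"
      using block_index_less[OF i] by (auto simp del: image_add_atLeastLessThan)
    fix q q' assume q: "q < ?N" "q' < ?N" "q \<notin> (\<lambda>s. i * m + s) ` {0..<m}"
    have "q div m \<noteq> i"
    proof
      assume "q div m = i"
      then have "q \<in> {r \<in> {0..<?N}. r div m = i}" using q by simp
      then show False using q(3) unfolding block_set[OF i] by contradiction
    qed
    then show "W $$ (q, q') = (if q = q' then 1 else 0)" using q unfolding W_def by simp
  qed
  also have "mat m m (\<lambda>(s, c). W $$ (i * m + s, i * m + c)) = mat m m (\<lambda>(s, c). X s c)"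
    by (rule eq_matI) (use block_index_less[OF i] in \<open>auto simp: W_def\<close>)
  finally show ?thesis unfolding A_def .
qed

definition col_of :: "(nat \<Rightarrow> nat \<Rightarrow> nat) \<Rightarrow> nat \<Rightarrow> (nat \<Rightarrow> nat) \<Rightarrow> nat \<Rightarrow> nat" where
  "col_of P m k q = P (k (q div m)) (q mod m)"

text \<open>Rows off the path are rows of \<open>X\<close> on the columns of their own block; rows on the path are unit vectors of
  \<open>n\<close>-space, written out in all blocks.\<close>

definition link_matrix ::
  "(nat \<Rightarrow> nat \<Rightarrow> 'a::comm_ring_1) \<Rightarrow> (nat \<Rightarrow> nat \<Rightarrow> nat) \<Rightarrow> nat \<Rightarrow> nat \<Rightarrow> (nat \<Rightarrow> nat) \<Rightarrow> (nat \<Rightarrow> nat) \<Rightarrow> 'a mat" where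
  "link_matrix x P g m a k = mat (g * m) (g * m) (\<lambda>(q, q').
     if on_path a m q then (if col_of P m k q' = diagonal m q then 1 else 0)
     else if q' div m = q div m then x (m - 1 - q mod m) (col_of P m k q') else 0)"

text \<open>The coefficient, up to sign, of the wedge product of the rows of \<open>Y\<close>, seen as alternating \<open>m\<close>-forms and contracted
  with the rows of \<open>X\<close> off the path. The determinants are the structure constants of this
  product. A sum over all permutations of the arguments of the wedge product would instead carry factorials, which
  may vanish in positive characteristic; a single determinant counts every distribution of the arguments once.\<close>

definition link_poly ::
  "(nat \<Rightarrow> nat \<Rightarrow> 'a::comm_ring_1) \<Rightarrow> (nat \<Rightarrow> nat \<Rightarrow> 'a) \<Rightarrow> (nat \<Rightarrow> nat \<Rightarrow> nat) \<Rightarrow> nat \<Rightarrow> nat \<Rightarrow> nat \<Rightarrow> (nat \<Rightarrow> nat) \<Rightarrow> 'a" where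
  "link_poly Y x P g m \<eta> a = (\<Sum>k\<in>PiE {..<g} (\<lambda>_. {..<\<eta>}). (\<Prod>i<g. Y i (k i)) * det (link_matrix x P g m a k))"

text \<open>Multiplication by the minor on the columns \<open>b\<close> amounts to a row operation that turns \<open>m\<close> of the unit
  vectors on the path into rows of \<open>X\<close>. It leaves \<open>n - m = g - 1\<close> unit vectors. When
  every row is restricted to one block, some block \<open>i\<close> therefore receives only rows of \<open>X\<close>. The
  determinant then splits off the minor on the columns of \<open>P (k i)\<close>, the other factor does not depend on \<open>k i\<close>, and
  the sum over \<open>k i\<close> yields \<open>F i\<close>.\<close>

theorem link_poly_mult_minor:
  fixes Y x :: "nat \<Rightarrow> nat \<Rightarrow> ('v, 'k::comm_ring_1) mpoly"
  assumes st: "staircase g m a" and m: "1 \<le> m" and g: "1 \<le> g" and n: "n = g + m - 1"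
    and P: "\<And>k c. k < \<eta> \<Longrightarrow> c < m \<Longrightarrow> P k c < n"
    and b: "inj_on b {0..<m}" "\<And>s. s < m \<Longrightarrow> b s < n"
    and I: "ideal I (poly_ring V)"
    and Y: "\<And>i k. i < g \<Longrightarrow> k < \<eta> \<Longrightarrow> Y i k \<in> polys V"
    and x: "\<And>r c. r < m \<Longrightarrow> c < n \<Longrightarrow> x r c \<in> polys V"
    and F: "\<And>i. i < g \<Longrightarrow> (\<Sum>k<\<eta>. Y i k * det (mat m m (\<lambda>(r, c). x r (P k c)))) \<in> I"
  shows "link_poly Y x P g m \<eta> a * det (mat m m (\<lambda>(s, c). x s (b c))) \<in> I"
proof -
  let ?N = "g * m"
  let ?Path = "{q. q < ?N \<and> on_path a m q}"
  let ?D = "link_matrix x P g m a"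
  let ?K = "PiE {..<g} (\<lambda>_. {..<\<eta>})"
  have bij: "bij_betw (diagonal m) ?Path {..<n}" unfolding n by (rule path_bij[OF st m g])
  define pos where "pos = inv_into ?Path (diagonal m)"
  have pos: "pos j < ?N" "on_path a m (pos j)" "diagonal m (pos j) = j" if "j < n" for j
  proof -
    have "pos j \<in> ?Path" unfolding pos_def using bij_betw_inv_into[OF bij] that by (auto simp: bij_betw_def)
    then show "pos j < ?N" "on_path a m (pos j)" by auto
    show "diagonal m (pos j) = j" unfolding pos_def using bij_betw_inv_into_right[OF bij] that by auto
  qed
  have blk: "q div m < g" if "q < ?N" for q using that by (simp add: less_mult_imp_div_less)
  have mod: "q mod m < m" for q using m by simp
  define e where "e s = pos (b s)" for s
  have e_lt: "e s < ?N" "on_path a m (e s)" "diagonal m (e s) = b s" if "s < m" for s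
    using pos b(2)[OF that] by (auto simp: e_def)
  have e_inj: "inj_on e {0..<m}"
    using b(1) e_lt(3) unfolding inj_on_def by (metis atLeastLessThan_iff)
  let ?E = "e ` {0..<m}"
  have E_sub: "?E \<subseteq> {0..<?N}" "?E \<subseteq> ?Path" using e_lt by auto
  define idx where "idx = inv_into {0..<m} e"
  have idx: "idx q < m" "e (idx q) = q" if "q \<in> ?E" for q
    using that inv_into_into[of q e "{0..<m}"] f_inv_into_f[of q e "{0..<m}"] unfolding idx_def by auto
  have idx_e: "idx (e s) = s" if "s < m" for s using e_inj that unfolding idx_def by simp
  \<comment> \<open>Row \<open>e s\<close> of \<open>Nh\<close> combines the unit vectors on the path to row \<open>s\<close> of \<open>X\<close>.\<close>
  define Nh where "Nh = mat ?N ?N (\<lambda>(q, q'). if q \<in> ?E then (if on_path a m q' then x (idx q) (diagonal m q') else 0)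
    else (if q = q' then 1 else 0))"
  have Nh: "Nh \<in> carrier_mat ?N ?N" unfolding Nh_def by simp
  have "det Nh = det (mat m m (\<lambda>(s, c). Nh $$ (e s, e c)))"
    by (rule det_unit_rows_outside[OF Nh e_inj E_sub(1)]) (simp add: Nh_def)
  also have "mat m m (\<lambda>(s, c). Nh $$ (e s, e c)) = mat m m (\<lambda>(s, c). x s (b c))"
    by (rule eq_matI) (auto simp: Nh_def e_lt idx_e)
  finally have detN: "det Nh = det (mat m m (\<lambda>(s, c). x s (b c)))" .
  define row where "row q = (if q \<in> ?E then idx q else m - 1 - q mod m)" for q
  have row: "row q < m" for q using idx m unfolding row_def by auto
  define D' where "D' k = mat ?N ?N (\<lambda>(q, q'). if q \<in> ?E then x (row q) (col_of P m k q')
    else if on_path a m q then (if col_of P m k q' = diagonal m q then 1 else 0)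
    else if q' div m = q div m then x (row q) (col_of P m k q') else 0)" for k
  have D'c: "D' k \<in> carrier_mat ?N ?N" for k unfolding D'_def by simp
  have Dc: "?D k \<in> carrier_mat ?N ?N" for k unfolding link_matrix_def by simp
  have col_lt: "col_of P m k q < n" if "k \<in> ?K" "q < ?N" for k q
    unfolding col_of_def using that blk[OF that(2)] mod by (intro P) auto
  have D'_eq: "D' k = Nh * ?D k" if k: "k \<in> ?K" for k
  proof (rule eq_matI)
    fix q q' assume "q < dim_row (Nh * ?D k)" "q' < dim_col (Nh * ?D k)"
    then have q: "q < ?N" "q' < ?N" using Nh Dc[of k] by auto
    have "(Nh * ?D k) $$ (q, q') = (\<Sum>r = 0..<?N. Nh $$ (q, r) * ?D k $$ (r, q'))"
      using q Nh Dc[of k] by (simp add: scalar_prod_def)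
    also have "\<dots> = D' k $$ (q, q')"
    proof (cases "q \<in> ?E")
      case False
      have "(\<Sum>r = 0..<?N. Nh $$ (q, r) * ?D k $$ (r, q')) = (\<Sum>r = 0..<?N. if r = q then ?D k $$ (q, q') else 0)"
        by (rule sum.cong) (use q False in \<open>auto simp: Nh_def\<close>)
      also have "\<dots> = D' k $$ (q, q')" using q False by (simp add: link_matrix_def D'_def row_def)
      finally show ?thesis .
    next
      case True
      have j: "col_of P m k q' < n" by (rule col_lt[OF k q(2)])
      have uniq: "r = pos (col_of P m k q')" if "r < ?N" "on_path a m r" "col_of P m k q' = diagonal m r" for r
        using bij that pos[OF j] unfolding bij_betw_def inj_on_def by auto
      have "(\<Sum>r = 0..<?N. Nh $$ (q, r) * ?D k $$ (r, q')) =
          (\<Sum>r = 0..<?N. if r = pos (col_of P m k q') then x (idx q) (col_of P m k q') else 0)"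
      proof (rule sum.cong[OF refl])
        fix r assume r: "r \<in> {0..<?N}"
        have iff: "on_path a m r \<and> col_of P m k q' = diagonal m r \<longleftrightarrow> r = pos (col_of P m k q')"
          using uniq[of r] r pos[OF j] by auto
        have "Nh $$ (q, r) * ?D k $$ (r, q') =
            (if on_path a m r \<and> col_of P m k q' = diagonal m r then x (idx q) (diagonal m r) else 0)"
          using q r True by (simp add: Nh_def link_matrix_def)
        also have "\<dots> = (if on_path a m r \<and> col_of P m k q' = diagonal m r then x (idx q) (col_of P m k q') else 0)"
          by simp
        finally show "Nh $$ (q, r) * ?D k $$ (r, q') =
            (if r = pos (col_of P m k q') then x (idx q) (col_of P m k q') else 0)"
          unfolding iff .
      qed
      also have "\<dots> = D' k $$ (q, q')" using q True pos[OF j] by (simp add: D'_def row_def)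
      finally show ?thesis .
    qed
    finally show "D' k $$ (q, q') = (Nh * ?D k) $$ (q, q')" by simp
  qed (use Nh Dc[of k] in \<open>auto simp: D'_def\<close>)
  define M where "M \<phi> k = mat ?N ?N (\<lambda>(q, q'). if q' div m = \<phi> q then D' k $$ (q, q') else 0)" for \<phi> :: "nat \<Rightarrow> nat" and k
  have Mc: "M \<phi> k \<in> carrier_mat ?N ?N" for \<phi> k unfolding M_def by simp
  let ?\<Phi> = "PiE {0..<?N} (\<lambda>_. {..<g})"
  have "link_poly Y x P g m \<eta> a * det (mat m m (\<lambda>(s, c). x s (b c))) =
      (\<Sum>k\<in>?K. (\<Prod>i<g. Y i (k i)) * (det Nh * det (?D k)))"
    unfolding link_poly_def detN[symmetric] by (subst sum_distrib_right) (simp add: ac_simps)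
  also have "\<dots> = (\<Sum>k\<in>?K. (\<Prod>i<g. Y i (k i)) * (\<Sum>\<phi>\<in>?\<Phi>. det (M \<phi> k)))"
  proof (rule sum.cong[OF refl])
    fix k assume k: "k \<in> ?K"
    have "det Nh * det (?D k) = det (D' k)" using det_mult[OF Nh Dc] D'_eq[OF k] by simp
    also have "\<dots> = (\<Sum>\<phi>\<in>?\<Phi>. det (M \<phi> k))"
      unfolding M_def by (rule det_split_rows[OF D'c blk])
    finally show "(\<Prod>i<g. Y i (k i)) * (det Nh * det (?D k)) = (\<Prod>i<g. Y i (k i)) * (\<Sum>\<phi>\<in>?\<Phi>. det (M \<phi> k))"
      by simp
  qed
  also have "\<dots> = (\<Sum>\<phi>\<in>?\<Phi>. \<Sum>k\<in>?K. (\<Prod>i<g. Y i (k i)) * det (M \<phi> k))"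
    by (simp only: sum_distrib_left) (rule sum.swap)
  also have "\<dots> \<in> I"
  proof (rule poly_ideal_sum[OF I])
    fix \<phi> assume \<phi>: "\<phi> \<in> ?\<Phi>"
    have "\<exists>i<g. \<forall>q\<in>?Path - ?E. \<phi> q \<noteq> i"
    proof (rule ccontr)
      assume "\<not> ?thesis"
      then have sub: "{..<g} \<subseteq> \<phi> ` (?Path - ?E)" by force
      have cardP: "card ?Path = n" using bij_betw_same_card[OF bij] by simp
      have finP: "finite ?Path" by simp
      have "card (?Path - ?E) = n - m"
        using card_Diff_subset[of ?E ?Path] E_sub(2) cardP card_image[OF e_inj] by simp
      moreover have "g \<le> card (?Path - ?E)"
        using card_mono[OF _ sub] card_image_le[of "?Path - ?E" \<phi>] finP by simp
      ultimately show False using n m g by simp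
    qed
    then obtain i where i: "i < g" and free: "\<And>q. q < ?N \<Longrightarrow> on_path a m q \<Longrightarrow> q \<notin> ?E \<Longrightarrow> \<phi> q \<noteq> i" by blast
    \<comment> \<open>\<open>S\<close> expresses the rows restricted to block \<open>i\<close> by the rows of \<open>X\<close>.\<close>
    define S where "S q s = (if \<phi> q = i \<and> (q \<in> ?E \<or> q div m = i) \<and> s = row q then 1 else (0 :: ('v, 'k) mpoly))" for q s
    define A where "A k = mat ?N ?N (\<lambda>(q, q'). if q' div m = i then S q (q' mod m) else M \<phi> k $$ (q, q'))" for k
    have detM: "det (M \<phi> k) = det (A k) * det (mat m m (\<lambda>(s, c). x s (P (k i) c)))" if k: "k \<in> ?K" for k
      unfolding A_def
    proof (rule det_factor_block[OF Mc i])
      fix q c assume q: "q < ?N" and c: "c < m"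
      have col: "col_of P m k (i * m + c) = P (k i) c" using c unfolding col_of_def by simp
      have ic: "i * m + c < ?N" by (rule block_index_less[OF i c])
      have "(\<Sum>s = 0..<m. S q s * x s (P (k i) c)) =
          (\<Sum>s = 0..<m. if s = row q then (if \<phi> q = i \<and> (q \<in> ?E \<or> q div m = i) then x (row q) (P (k i) c) else 0) else 0)"
        by (rule sum.cong) (auto simp: S_def)
      also have "\<dots> = (if \<phi> q = i \<and> (q \<in> ?E \<or> q div m = i) then x (row q) (P (k i) c) else 0)"
        using row[of q] by simp
      also have "\<dots> = M \<phi> k $$ (q, i * m + c)"
        using q ic c col free[OF q] by (auto simp: M_def D'_def)
      finally show "M \<phi> k $$ (q, i * m + c) = (\<Sum>s = 0..<m. S q s * x s (P (k i) c))" by simp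
    qed
    have A_upd: "A (k(i := l)) = A k" for k l
      unfolding A_def by (rule eq_matI) (auto simp: M_def D'_def col_of_def)
    let ?J = "{..<g} - {i}"
    have insJ: "insert i ?J = {..<g}" using i by auto
    have "(\<Sum>k\<in>?K. (\<Prod>i<g. Y i (k i)) * det (M \<phi> k)) =
        (\<Sum>k\<in>?K. (\<Prod>i<g. Y i (k i)) * (det (A k) * det (mat m m (\<lambda>(s, c). x s (P (k i) c)))))"
      by (rule sum.cong) (auto simp: detM)
    also have "\<dots> = (\<Sum>k\<in>PiE ?J (\<lambda>_. {..<\<eta>}). \<Sum>l<\<eta>. (\<Prod>j<g. Y j ((k(i := l)) j)) *
        (det (A (k(i := l))) * det (mat m m (\<lambda>(s, c). x s (P ((k(i := l)) i) c)))))"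
      using sum_PiE_insert[of i ?J _ "{..<\<eta>}"] unfolding insJ by blast
    also have "\<dots> = (\<Sum>k\<in>PiE ?J (\<lambda>_. {..<\<eta>}). ((\<Prod>j\<in>?J. Y j (k j)) * det (A k)) *
        (\<Sum>l<\<eta>. Y i l * det (mat m m (\<lambda>(s, c). x s (P l c)))))"
    proof (rule sum.cong[OF refl], subst sum_distrib_left, rule sum.cong[OF refl])
      fix k l
      have "(\<Prod>j<g. Y j ((k(i := l)) j)) = Y i l * (\<Prod>j\<in>?J. Y j ((k(i := l)) j))"
        using i by (subst prod.remove[of _ i]) auto
      also have "(\<Prod>j\<in>?J. Y j ((k(i := l)) j)) = (\<Prod>j\<in>?J. Y j (k j))" by (rule prod.cong) auto
      finally show "(\<Prod>j<g. Y j ((k(i := l)) j)) *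
          (det (A (k(i := l))) * det (mat m m (\<lambda>(s, c). x s (P ((k(i := l)) i) c)))) =
          (\<Prod>j\<in>?J. Y j (k j)) * det (A k) * (Y i l * det (mat m m (\<lambda>(s, c). x s (P l c))))"
        unfolding A_upd by (simp add: ac_simps)
    qed
    also have "\<dots> \<in> I"
    proof (rule poly_ideal_sum[OF I], rule poly_ideal_mult[OF I _ F[OF i]])
      fix k assume k: "k \<in> PiE ?J (\<lambda>_. {..<\<eta>})"
      have "A k $$ (q, q') \<in> polys V" if q: "q < ?N" "q' < ?N" for q q'
      proof (cases "q' div m = i")
        case True
        then show ?thesis using q carrier_one carrier_zero by (auto simp: A_def S_def)
      next
        case False
        then have "k (q' div m) < \<eta>" using k blk[OF q(2)] by auto
        then have "col_of P m k q' < n" unfolding col_of_def using P mod by blast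
        then have "x (row q) (col_of P m k q') \<in> polys V" using x row by blast
        then show ?thesis using q False carrier_one carrier_zero by (auto simp: A_def M_def D'_def)
      qed
      then have "det (A k) \<in> polys V"
        by (intro carrier_det[of _ ?N]) (auto simp: A_def)
      then show "(\<Prod>j\<in>?J. Y j (k j)) * det (A k) \<in> polys V"
        using k Y by (intro carrier_mult carrier_prod) auto
    qed
    finally show "(\<Sum>k\<in>?K. (\<Prod>i<g. Y i (k i)) * det (M \<phi> k)) \<in> I" .
  qed
  finally show ?thesis .
qed

section \<open>Diagonals off the staircase path\<close>

lemma diagonal_block_inj: "q div m = q' div m \<Longrightarrow> diagonal m q = diagonal m q' \<Longrightarrow> q = q'"
  unfolding diagonal_def by (metis add_left_imp_eq div_mult_mod_eq)

definition off_path :: "nat \<Rightarrow> nat \<Rightarrow> (nat \<Rightarrow> nat) \<Rightarrow> nat set" where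
  "off_path g m a = {q \<in> {0..<g * m}. \<not> on_path a m q}"

text \<open>The double partial sums of the exponents of \<open>off_path_monomial\<close> below.\<close>

definition corner_count :: "nat \<Rightarrow> nat \<Rightarrow> (nat \<Rightarrow> nat) \<Rightarrow> (nat \<Rightarrow> nat) \<Rightarrow> nat \<Rightarrow> nat \<Rightarrow> nat" where
  "corner_count g m a p s b = card {q \<in> off_path g m a. q mod m < s \<and> diagonal m (p q) < b}"

context
  fixes g m :: nat and a p :: "nat \<Rightarrow> nat"
  assumes st: "staircase g m a" and m: "1 \<le> m" and g: "1 \<le> g"
    and p: "p permutes {0..<g * m}"
    and on: "\<And>q. q < g * m \<Longrightarrow> on_path a m q \<Longrightarrow> diagonal m (p q) = diagonal m q"
    and off: "\<And>q. q < g * m \<Longrightarrow> \<not> on_path a m q \<Longrightarrow> p q div m = q div m"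
begin

lemma p_less: "q < g * m \<Longrightarrow> p q < g * m"
  using permutes_in_image[OF p, of q] by simp

lemma card_preimage: "card {q \<in> {0..<g * m}. p q \<in> A} = card {q \<in> {0..<g * m}. q \<in> A}"
proof -
  have "p ` {q \<in> {0..<g * m}. p q \<in> A} = {q \<in> {0..<g * m}. q \<in> A}"
  proof (intro equalityI subsetI)
    fix q assume "q \<in> {q \<in> {0..<g * m}. q \<in> A}"
    then have q: "q < g * m" "q \<in> A" by auto
    obtain q' where q': "p q' = q" using permutes_surj[OF p] by (metis surjD)
    then have "q' < g * m" using permutes_in_image[OF p, of q'] q by simp
    then show "q \<in> p ` {q \<in> {0..<g * m}. p q \<in> A}" using q q' by (intro image_eqI[of _ _ q']) auto
  qed (use p_less in auto)
  moreover have "inj_on p {q \<in> {0..<g * m}. p q \<in> A}"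
    using permutes_inj[OF p] by (rule inj_on_subset) simp
  then have "card (p ` {q \<in> {0..<g * m}. p q \<in> A}) = card {q \<in> {0..<g * m}. p q \<in> A}" by (rule card_image)
  ultimately show ?thesis by simp
qed

lemma split_card: "card {q \<in> {0..<g * m}. Q q} =
    card {q \<in> {0..<g * m}. on_path a m q \<and> Q q} + card {q \<in> off_path g m a. Q q}"
proof -
  have "{q \<in> {0..<g * m}. Q q} = {q \<in> {0..<g * m}. on_path a m q \<and> Q q} \<union> {q \<in> off_path g m a. Q q}"
    unfolding off_path_def by auto
  moreover have "{q \<in> {0..<g * m}. on_path a m q \<and> Q q} \<inter> {q \<in> off_path g m a. Q q} = {}"
    unfolding off_path_def by auto
  moreover have "finite {q \<in> {0..<g * m}. on_path a m q \<and> Q q}" "finite {q \<in> off_path g m a. Q q}"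
    unfolding off_path_def by auto
  ultimately show ?thesis by (simp only: card_Un_disjoint)
qed

text \<open>The assumptions on \<open>p\<close> say that it keeps the diagonal on the path and the block off the path. Since \<open>p\<close>
  is a permutation, the claim is equivalent to one on the path: at least as many path positions with
  diagonal below \<open>b\<close> are sent to the blocks right of \<open>c\<close> as are situated there. The path is a chain, so either
  all its positions with diagonal below \<open>b\<close> are in the blocks up to \<open>c\<close>, or all its positions in these blocks have diagonal
  below \<open>b\<close>; in the second case the number of path positions sent to these blocks is known.\<close>

lemma right_blocks_count:
  "card {q \<in> off_path g m a. c < q div m \<and> diagonal m (p q) < b}
    \<le> card {q \<in> off_path g m a. c < q div m \<and> diagonal m q < b}"
proof -
  let ?on = "\<lambda>Q. card {q \<in> {0..<g * m}. on_path a m q \<and> Q q}"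
  let ?off = "\<lambda>Q. card {q \<in> off_path g m a. Q q}"
  have fin: "finite {q \<in> {0..<g * m}. Q q}" for Q by simp
  have offset: "{q \<in> off_path g m a. Q (p q div m) (p q)} = {q \<in> off_path g m a. Q (q div m) (p q)}" for Q
    using off unfolding off_path_def by auto
  \<comment> \<open>As many path positions are sent to the left blocks as are situated there.\<close>
  have left: "?on (\<lambda>q. p q div m \<le> c) = ?on (\<lambda>q. q div m \<le> c)"
    using card_preimage[of "{q. q div m \<le> c}"] split_card[of "\<lambda>q. p q div m \<le> c"]
      split_card[of "\<lambda>q. q div m \<le> c"] offset[of "\<lambda>i q. i \<le> c"] by simp
  have "?on (\<lambda>q. diagonal m q < b \<and> p q div m \<le> c) \<le> ?on (\<lambda>q. diagonal m q < b \<and> q div m \<le> c)"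
  proof (cases "\<exists>q<g * m. on_path a m q \<and> q div m \<le> c \<and> b \<le> diagonal m q")
    case True
    then obtain q1 where q1: "q1 < g * m" "on_path a m q1" "q1 div m \<le> c" "b \<le> diagonal m q1" by blast
    have "q div m \<le> c" if "q < g * m" "on_path a m q" "diagonal m q < b" for q
    proof (rule ccontr)
      assume "\<not> q div m \<le> c"
      then have "diagonal m q1 < diagonal m q" using path_less[OF st q1(1,2) that(1,2)] q1(3) by simp
      then show False using q1(4) that(3) by simp
    qed
    then have "?on (\<lambda>q. diagonal m q < b \<and> q div m \<le> c) = ?on (\<lambda>q. diagonal m q < b)"
      by (intro arg_cong[where f = card]) auto
    also have "\<dots> \<ge> ?on (\<lambda>q. diagonal m q < b \<and> p q div m \<le> c)" by (rule card_mono) auto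
    finally show ?thesis .
  next
    case False
    have "?on (\<lambda>q. diagonal m q < b \<and> p q div m \<le> c) \<le> ?on (\<lambda>q. p q div m \<le> c)"
      by (rule card_mono) auto
    also have "\<dots> = ?on (\<lambda>q. diagonal m q < b \<and> q div m \<le> c)"
      unfolding left using False by (intro arg_cong[where f = card]) (auto simp: not_le)
    finally show ?thesis .
  qed
  moreover have "?on (\<lambda>q. diagonal m q < b) = ?on (\<lambda>q. diagonal m q < b \<and> p q div m \<le> c) + ?on (\<lambda>q. c < p q div m \<and> diagonal m (p q) < b)"
    (is "card ?A = card ?B + card ?D")
  proof -
    have "?A = ?B \<union> ?D" "?B \<inter> ?D = {}" using on by auto
    then show ?thesis using card_Un_disjoint[of ?B ?D] by simp
  qed
  moreover have "?on (\<lambda>q. diagonal m q < b) = ?on (\<lambda>q. diagonal m q < b \<and> q div m \<le> c) + ?on (\<lambda>q. c < q div m \<and> diagonal m q < b)"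
    (is "card ?A = card ?B + card ?D")
  proof -
    have "?A = ?B \<union> ?D" "?B \<inter> ?D = {}" by auto
    then show ?thesis using card_Un_disjoint[of ?B ?D] by simp
  qed
  ultimately have "?on (\<lambda>q. c < q div m \<and> diagonal m q < b) \<le> ?on (\<lambda>q. c < p q div m \<and> diagonal m (p q) < b)"
    by linarith
  moreover have "?on (\<lambda>q. c < q div m \<and> diagonal m q < b) + ?off (\<lambda>q. c < q div m \<and> diagonal m q < b) =
      ?on (\<lambda>q. c < p q div m \<and> diagonal m (p q) < b) + ?off (\<lambda>q. c < p q div m \<and> diagonal m (p q) < b)"
    using card_preimage[of "{q. c < q div m \<and> diagonal m q < b}"]
      split_card[of "\<lambda>q. c < q div m \<and> diagonal m q < b"]
      split_card[of "\<lambda>q. c < p q div m \<and> diagonal m (p q) < b"] by simp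
  ultimately show ?thesis using offset[of "\<lambda>i q. c < i \<and> diagonal m q < b"] by simp
qed

lemma finite_off_path: "finite (off_path g m a)"
  unfolding off_path_def by simp

text \<open>For the identity, of the two conditions in a corner count the first implies the second in the blocks up to
  \<open>b - s\<close>, and the second implies the first in the other blocks. For \<open>p\<close> either condition alone gives an upper bound,
  in the latter blocks by \<open>right_blocks_count\<close>, and the identity attains these bounds.\<close>

lemma corner_count_mono:
  shows "corner_count g m a p s b \<le> corner_count g m a id s b"
    and "\<lbrakk>q0 \<in> off_path g m a; q0 div m + s \<le> b; q0 mod m < s; b \<le> diagonal m (p q0)\<rbrakk> \<Longrightarrow>
      corner_count g m a p s b < corner_count g m a id s b"
proof -
  let ?O = "off_path g m a"
  let ?L = "{q \<in> ?O. q div m + s \<le> b \<and> q mod m < s \<and> diagonal m (p q) < b}"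
  let ?R = "{q \<in> ?O. b < q div m + s \<and> q mod m < s \<and> diagonal m (p q) < b}"
  let ?L' = "{q \<in> ?O. q div m + s \<le> b \<and> q mod m < s}"
  let ?R' = "{q \<in> ?O. b < q div m + s \<and> diagonal m q < b}"
  note fin = finite_off_path
  have "{q \<in> ?O. q mod m < s \<and> diagonal m (p q) < b} = ?L \<union> ?R" "?L \<inter> ?R = {}" by auto
  then have 1: "corner_count g m a p s b = card ?L + card ?R"
    unfolding corner_count_def using card_Un_disjoint[of ?L ?R] fin by simp
  have "{q \<in> ?O. q mod m < s \<and> diagonal m (id q) < b} = ?L' \<union> ?R'" "?L' \<inter> ?R' = {}"
    by (auto simp: diagonal_def)
  then have 2: "corner_count g m a id s b = card ?L' + card ?R'"
    unfolding corner_count_def using card_Un_disjoint[of ?L' ?R'] fin by simp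
  have "card ?R \<le> card {q \<in> ?O. b < q div m + s \<and> diagonal m (p q) < b}"
    by (rule card_mono) (use fin in auto)
  also have "\<dots> \<le> card ?R'"
  proof (cases "s \<le> b")
    case True
    then have "b < i + s \<longleftrightarrow> b - s < i" for i by auto
    then show ?thesis using right_blocks_count[of "b - s" b] by simp
  next
    case False
    have "card {q \<in> ?O. diagonal m (p q) < b} = card {q \<in> ?O. diagonal m q < b}"
    proof -
      have "card {q \<in> {0..<g * m}. on_path a m q \<and> diagonal m (p q) < b} = card {q \<in> {0..<g * m}. on_path a m q \<and> diagonal m q < b}"
        using on by (intro arg_cong[where f = card]) auto
      then show ?thesis
        using card_preimage[of "{q. diagonal m q < b}"] split_card[of "\<lambda>q. diagonal m (p q) < b"]
          split_card[of "\<lambda>q. diagonal m q < b"] by simp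
    qed
    moreover have "b < i + s" for i using False by simp
    ultimately show ?thesis by simp
  qed
  finally have R: "card ?R \<le> card ?R'" .
  have L: "card ?L \<le> card ?L'" by (rule card_mono) (use fin in auto)
  show "corner_count g m a p s b \<le> corner_count g m a id s b" using 1 2 R L by simp
  show "corner_count g m a p s b < corner_count g m a id s b"
    if "q0 \<in> ?O" "q0 div m + s \<le> b" "q0 mod m < s" "b \<le> diagonal m (p q0)"
  proof -
    have "q0 \<in> ?L'" "q0 \<notin> ?L" using that by auto
    then have "?L \<noteq> ?L'" by blast
    then have "card ?L < card ?L'" by (intro psubset_card_mono) (use fin in auto)
    then show ?thesis using 1 2 R by simp
  qed
qed

lemma corner_count_boundary:
  "corner_count g m a p m b = corner_count g m a id m b"
  "corner_count g m a p s (g + m - 1) = corner_count g m a id s (g + m - 1)"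
proof -
  have mod: "q mod m < m" for q using m by simp
  have "card {q \<in> {0..<g * m}. on_path a m q \<and> diagonal m (p q) < b} = card {q \<in> {0..<g * m}. on_path a m q \<and> diagonal m q < b}"
    using on by (intro arg_cong[where f = card]) auto
  then show "corner_count g m a p m b = corner_count g m a id m b"
    unfolding corner_count_def
    using card_preimage[of "{q. diagonal m q < b}"] split_card[of "\<lambda>q. diagonal m (p q) < b"]
      split_card[of "\<lambda>q. diagonal m q < b"] mod by simp
  have d: "diagonal m q < g + m - 1" if "q < g * m" for q
    using mod[of q] less_mult_imp_div_less[OF that] unfolding diagonal_def by linarith
  show "corner_count g m a p s (g + m - 1) = corner_count g m a id s (g + m - 1)"
    unfolding corner_count_def
    by (intro arg_cong[where f = card]) (use d p_less in \<open>auto simp: off_path_def\<close>)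
qed

text \<open>The diagonals have the same sum before and after \<open>p\<close>. If none increases, all are kept, and a position
  is determined by its diagonal together with its block, or by its diagonal alone on the path.\<close>

lemma exists_diagonal_increase:
  assumes "p \<noteq> id"
  shows "\<exists>q0\<in>off_path g m a. diagonal m q0 < diagonal m (p q0)"
proof (rule ccontr)
  assume neg: "\<not> ?thesis"
  have le: "diagonal m (p q) \<le> diagonal m q" if "q \<in> {0..<g * m}" for q
  proof (cases "on_path a m q")
    case False
    then have "q \<in> off_path g m a" using that unfolding off_path_def by simp
    with neg show ?thesis by (meson not_less)
  qed (use that on in simp)
  have "(\<Sum>q = 0..<g * m. diagonal m (p q)) = (\<Sum>q = 0..<g * m. diagonal m q)"
    using sum.permute[OF p, of "diagonal m"] by (simp add: o_def)
  then have eq: "diagonal m (p q) = diagonal m q" if "q \<in> {0..<g * m}" for q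
    using sum_mono_inv[of "\<lambda>q. diagonal m (p q)" "{0..<g * m}" "diagonal m"] le that by auto
  have fix_off: "p q = q" if "q < g * m" "\<not> on_path a m q" for q
    using diagonal_block_inj[of "p q" m q] eq[of q] off[OF that] that by simp
  have "p q = q" for q
  proof (cases "q < g * m \<and> on_path a m q")
    case True
    have "on_path a m (p q)"
    proof (rule ccontr)
      assume "\<not> on_path a m (p q)"
      then have "p (p q) = p q" using fix_off p_less True by blast
      then have "p q = q" using permutes_inj[OF p] by (simp add: inj_eq)
      then show False using True \<open>\<not> on_path a m (p q)\<close> by simp
    qed
    then show ?thesis using bij_betw_imp_inj_on[OF path_bij[OF st m g]] True p_less[of q] eq[of q]
      unfolding inj_on_def by auto
  next
    case False
    then show ?thesis using fix_off permutes_not_in[OF p, of q] by auto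
  qed
  then show False using assms by auto
qed

end

text \<open>Rows are counted from the bottom, so that antidiagonals run through increasing rows and columns.\<close>

definition xmon :: "nat \<Rightarrow> nat \<Rightarrow> nat \<Rightarrow> var monomial" where
  "xmon m t b = single (XVar (m - 1 - t) b) 1"

definition off_path_monomial :: "nat \<Rightarrow> nat \<Rightarrow> (nat \<Rightarrow> nat) \<Rightarrow> (nat \<Rightarrow> nat) \<Rightarrow> var monomial" where
  "off_path_monomial g m a p = (\<Sum>q\<in>off_path g m a. xmon m (q mod m) (diagonal m (p q)))"

lemma xmon_monomials: "t < m \<Longrightarrow> b < n \<Longrightarrow> xmon m t b \<in> monomials (xvars m n)"
  unfolding xmon_def by (intro monomials_single) (auto simp: xvars_def)

lemma lookup_xmon:
  "s < m \<Longrightarrow> t < m \<Longrightarrow> lookup (xmon m s b) (XVar (m - 1 - t) b') = of_bool (s = t \<and> b = b')"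
  unfolding xmon_def lookup_single when_def by auto

context monomial_order
begin

lemma sum_le:
  assumes "\<And>x. x \<in> X \<Longrightarrow> f x \<in> monomials V \<and> h x \<in> monomials V \<and> (lt (f x) (h x) \<or> f x = h x)"
  shows "lt (sum f X) (sum h X) \<or> sum f X = sum h X"
  using assms
proof (induction X rule: infinite_finite_induct)
  case (insert x X)
  have IH: "lt (sum f X) (sum h X) \<or> sum f X = sum h X" using insert by blast
  have mon: "sum f X \<in> monomials V" "sum h X \<in> monomials V" using insert.prems by (auto intro: monomials_sum)
  have x: "f x \<in> monomials V" "h x \<in> monomials V" "lt (f x) (h x) \<or> f x = h x" using insert.prems by auto
  show ?case
    using add_less_le[OF x(1,2) mon x(3) IH] insert.hyps by (cases "f x = h x \<and> sum f X = sum h X") auto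
qed auto

lemma sum_less:
  assumes "finite X" "x \<in> X" "lt (f x) (h x)"
    and all: "\<And>x. x \<in> X \<Longrightarrow> f x \<in> monomials V \<and> h x \<in> monomials V \<and> (lt (f x) (h x) \<or> f x = h x)"
  shows "lt (sum f X) (sum h X)"
proof -
  have "lt (sum f (X - {x})) (sum h (X - {x})) \<or> sum f (X - {x}) = sum h (X - {x})"
    by (rule sum_le) (use all in auto)
  moreover have "sum f (X - {x}) \<in> monomials V" "sum h (X - {x}) \<in> monomials V"
    using all by (auto intro: monomials_sum)
  moreover have "f x \<noteq> h x" using assms(2,3) all[of x] irrefl[of "f x"] by metis
  ultimately have "lt (f x + sum f (X - {x})) (h x + sum h (X - {x}))"
    using all[OF assms(2)] assms(3) by (intro add_less_le) auto
  then show ?thesis using assms(1,2) by (simp add: sum.remove)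
qed

end

lemma corner_count_step:
  "card {q \<in> off_path g m a. q mod m = t \<and> diagonal m (p q) = b} + corner_count g m a p t (Suc b) + corner_count g m a p (Suc t) b
    = corner_count g m a p (Suc t) (Suc b) + corner_count g m a p t b"
proof -
  let ?O = "off_path g m a"
  have fin: "finite ?O" by (simp add: off_path_def)
  let ?row = "\<lambda>c. {q \<in> ?O. q mod m = t \<and> diagonal m (p q) < c}"
  have 1: "corner_count g m a p (Suc t) c = corner_count g m a p t c + card (?row c)" for c
  proof -
    have "{q \<in> ?O. q mod m < Suc t \<and> diagonal m (p q) < c} = {q \<in> ?O. q mod m < t \<and> diagonal m (p q) < c} \<union> ?row c"
      "{q \<in> ?O. q mod m < t \<and> diagonal m (p q) < c} \<inter> ?row c = {}" by auto
    then show ?thesis unfolding corner_count_def using fin by (simp add: card_Un_disjoint)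
  qed
  have 2: "card (?row (Suc b)) = card (?row b) + card {q \<in> ?O. q mod m = t \<and> diagonal m (p q) = b}"
  proof -
    have "?row (Suc b) = ?row b \<union> {q \<in> ?O. q mod m = t \<and> diagonal m (p q) = b}"
      "?row b \<inter> {q \<in> ?O. q mod m = t \<and> diagonal m (p q) = b} = {}" by auto
    then show ?thesis using fin by (simp add: card_Un_disjoint)
  qed
  show ?thesis using 1[of b] 1[of "Suc b"] 2 by simp
qed

lemma sum_sum_delta:
  fixes h :: "nat \<Rightarrow> nat \<Rightarrow> nat"
  shows "(\<Sum>s<M. \<Sum>b<K. h s b * of_bool (s = x \<and> b = y)) = (if x < M \<and> y < K then h x y else 0)"
proof -
  have inner: "(\<Sum>b<K. h s b * of_bool (s = x \<and> b = y)) = (if s = x then (if y < K then h x y else 0) else 0)" for s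
  proof -
    have "(\<Sum>b<K. h s b * of_bool (s = x \<and> b = y)) = (\<Sum>b<K. if b = y then (if s = x then h x y else 0) else 0)"
      by (rule sum.cong) auto
    then show ?thesis by simp
  qed
  show ?thesis unfolding inner by simp
qed

text \<open>Summation by parts. Let \<open>d\<close> be the difference of the corner counts; it is nonnegative and vanishes on the boundary.
  Replacing \<open>lo s b\<close> by \<open>hi s b\<close>, the diagonal by the antidiagonal of a 2-minor of adjacent rows
  and columns, raises a single corner count by one. So the second monomial arises from the first by making each of these
  replacements \<open>d (s + 1) (b + 1)\<close> times, and each of them goes up in the order.\<close>

lemma off_path_monomial_less:
  assumes st: "staircase g m a" and m: "1 \<le> m" and g: "1 \<le> g" and n: "n = g + m - 1"
    and p: "p permutes {0..<g * m}"
    and on: "\<And>q. q < g * m \<Longrightarrow> on_path a m q \<Longrightarrow> diagonal m (p q) = diagonal m q"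
    and off: "\<And>q. q < g * m \<Longrightarrow> \<not> on_path a m q \<Longrightarrow> p q div m = q div m"
    and pid: "p \<noteq> id"
    and lt: "monomial_order (xvars m n) lt"
    and adj: "\<And>s b. Suc s < m \<Longrightarrow> Suc b < n \<Longrightarrow>
      lt (xmon m s (Suc b) + xmon m (Suc s) b) (xmon m s b + xmon m (Suc s) (Suc b))"
  shows "lt (off_path_monomial g m a p) (off_path_monomial g m a id)"
proof -
  interpret monomial_order "xvars m n" lt by (rule lt)
  have mod: "q mod m < m" for q using m by simp
  let ?O = "off_path g m a"
  have fin: "finite ?O" by (simp add: off_path_def)
  note cc = st m g p on off
  define d where "d s b = corner_count g m a id s b - corner_count g m a p s b" for s b
  have mono: "corner_count g m a p s b \<le> corner_count g m a id s b" for s b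
    by (rule corner_count_mono(1)[OF cc])
  have d0: "d m b = 0" "d s n = 0" "d 0 b = 0" "d s 0 = 0" for s b
    unfolding d_def n using corner_count_boundary[OF cc] by (auto simp: corner_count_def)
  have p_less: "p q < g * m" if "q < g * m" for q by (rule p_less[OF cc that])
  have diag: "diagonal m q < n" if "q < g * m" for q
    using mod[of q] less_mult_imp_div_less[OF that] unfolding diagonal_def n by linarith
  define lo where "lo s b = xmon m s (Suc b) + xmon m (Suc s) b" for s b
  define hi where "hi s b = xmon m s b + xmon m (Suc s) (Suc b)" for s b
  define LO where "LO = (\<Sum>s<m-1. \<Sum>b<n-1. \<Sum>j<d (Suc s) (Suc b). lo s b)"
  define HI where "HI = (\<Sum>s<m-1. \<Sum>b<n-1. \<Sum>j<d (Suc s) (Suc b). hi s b)"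
  let ?M = "off_path_monomial g m a p" and ?U = "off_path_monomial g m a id"
  have lohi: "lo s b \<in> monomials (xvars m n)" "hi s b \<in> monomials (xvars m n)" "lt (lo s b) (hi s b)"
    if "s < m - 1" "b < n - 1" for s b
    unfolding lo_def hi_def using that adj by (auto intro!: monomials_add xmon_monomials)
  have MU: "?M \<in> monomials (xvars m n)" "?U \<in> monomials (xvars m n)"
    unfolding off_path_monomial_def off_path_def
    by (auto intro!: monomials_sum xmon_monomials mod diag p_less)
  have LH: "LO \<in> monomials (xvars m n)" "HI \<in> monomials (xvars m n)"
    unfolding LO_def HI_def by (auto intro!: monomials_sum lohi)
  have cnt: "lookup (off_path_monomial g m a f) (XVar (m - 1 - t) b) = card {q \<in> ?O. q mod m = t \<and> diagonal m (f q) = b}"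
    if "t < m" for f t b
  proof -
    have "lookup (off_path_monomial g m a f) (XVar (m - 1 - t) b) =
        (\<Sum>q\<in>?O. of_bool (q mod m = t \<and> diagonal m (f q) = b))"
      unfolding off_path_monomial_def lookup_sum
      by (rule sum.cong[OF refl]) (rule lookup_xmon[OF mod that])
    also have "\<dots> = card {q \<in> ?O. q mod m = t \<and> diagonal m (f q) = b}"
      unfolding card_eq_sum sum.inter_filter[OF fin] by (rule sum.cong) auto
    finally show ?thesis .
  qed
  have "?U + LO = ?M + HI"
  proof (rule poly_mapping_eqI)
    fix v
    show "lookup (?U + LO) v = lookup (?M + HI) v"
    proof (cases "v \<in> xvars m n")
      case False
      then show ?thesis
        using monomials_lookup[OF monomials_add[OF MU(2) LH(1)]] monomials_lookup[OF monomials_add[OF MU(1) LH(2)]] by simp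
    next
      case True
      then obtain r b where v: "v = XVar r b" "r < m" "b < n" unfolding xvars_def by auto
      define t where "t = m - 1 - r"
      have t: "t < m" "v = XVar (m - 1 - t) b" using v unfolding t_def by auto
      have LOv: "lookup LO v = d (Suc t) b + d t (Suc b)"
      proof -
        have L: "lookup (lo s b') (XVar (m - 1 - t) b) = of_bool (s = t \<and> Suc b' = b) + of_bool (Suc s = t \<and> b' = b)" if "s < m - 1" for s b'
        proof -
          have "s < m" "Suc s < m" using that by auto
          then show ?thesis unfolding lo_def lookup_add by (simp only: lookup_xmon t(1))
        qed
        have "lookup LO v = (\<Sum>s<m-1. \<Sum>b'<n-1. d (Suc s) (Suc b') * (of_bool (s = t \<and> Suc b' = b) + of_bool (Suc s = t \<and> b' = b)))"
          unfolding LO_def lookup_sum t(2)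
          by (intro sum.cong refl) (simp only: L lessThan_iff sum_constant card_lessThan of_nat_id)
        also have "\<dots> = (\<Sum>s<m-1. \<Sum>b'<n-1. d (Suc s) (Suc b') * of_bool (s = t \<and> Suc b' = b)) +
            (\<Sum>s<m-1. \<Sum>b'<n-1. d (Suc s) (Suc b') * of_bool (Suc s = t \<and> b' = b))"
          by (simp add: distrib_left sum.distrib)
        also have "(\<Sum>s<m-1. \<Sum>b'<n-1. d (Suc s) (Suc b') * of_bool (s = t \<and> Suc b' = b)) = d (Suc t) b"
        proof (cases b)
          case 0 then show ?thesis using d0 by simp
        next
          case (Suc y)
          show ?thesis unfolding Suc nat.inject sum_sum_delta[where h = "\<lambda>s b. d (Suc s) (Suc b)"]
            using Suc v(3) t(1) d0(1)[of b] by (cases "t = m - 1") auto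
        qed
        also have "(\<Sum>s<m-1. \<Sum>b'<n-1. d (Suc s) (Suc b') * of_bool (Suc s = t \<and> b' = b)) = d t (Suc b)"
        proof (cases t)
          case 0 then show ?thesis using d0 by simp
        next
          case (Suc y)
          show ?thesis unfolding Suc nat.inject sum_sum_delta[where h = "\<lambda>s b. d (Suc s) (Suc b)"]
            using Suc v(3) t(1) d0(2)[of t] by (cases "b = n - 1") auto
        qed
        finally show ?thesis .
      qed
      have HIv: "lookup HI v = d (Suc t) (Suc b) + d t b"
      proof -
        have L: "lookup (hi s b') (XVar (m - 1 - t) b) = of_bool (s = t \<and> b' = b) + of_bool (Suc s = t \<and> Suc b' = b)" if "s < m - 1" for s b'
        proof -
          have "s < m" "Suc s < m" using that by auto
          then show ?thesis unfolding hi_def lookup_add by (simp only: lookup_xmon t(1))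
        qed
        have "lookup HI v = (\<Sum>s<m-1. \<Sum>b'<n-1. d (Suc s) (Suc b') * (of_bool (s = t \<and> b' = b) + of_bool (Suc s = t \<and> Suc b' = b)))"
          unfolding HI_def lookup_sum t(2)
          by (intro sum.cong refl) (simp only: L lessThan_iff sum_constant card_lessThan of_nat_id)
        also have "\<dots> = (\<Sum>s<m-1. \<Sum>b'<n-1. d (Suc s) (Suc b') * of_bool (s = t \<and> b' = b)) +
            (\<Sum>s<m-1. \<Sum>b'<n-1. d (Suc s) (Suc b') * of_bool (Suc s = t \<and> Suc b' = b))"
          by (simp add: distrib_left sum.distrib)
        also have "(\<Sum>s<m-1. \<Sum>b'<n-1. d (Suc s) (Suc b') * of_bool (s = t \<and> b' = b)) = d (Suc t) (Suc b)"
          unfolding sum_sum_delta[where h = "\<lambda>s b. d (Suc s) (Suc b)"]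
          using v(3) t(1) d0(1)[of "Suc b"] d0(2)[of "Suc t"]
          by (cases "t = m - 1"; cases "b = n - 1") auto
        also have "(\<Sum>s<m-1. \<Sum>b'<n-1. d (Suc s) (Suc b') * of_bool (Suc s = t \<and> Suc b' = b)) = d t b"
        proof (cases "t = 0 \<or> b = 0")
          case True then show ?thesis using d0 by auto
        next
          case False
          then obtain x y where xy: "t = Suc x" "b = Suc y" by (metis not0_implies_Suc)
          show ?thesis unfolding xy nat.inject sum_sum_delta[where h = "\<lambda>s b. d (Suc s) (Suc b)"]
            using xy v(3) t(1) by auto
        qed
        finally show ?thesis .
      qed
      have dd: "corner_count g m a id s c = corner_count g m a p s c + d s c" for s c
        unfolding d_def using mono[of s c] by simp
      have "lookup ?U v + d (Suc t) b + d t (Suc b) = lookup ?M v + d (Suc t) (Suc b) + d t b"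
        using corner_count_step[of g m a t id b] corner_count_step[of g m a t p b] dd
        unfolding t(2) cnt[OF t(1)] by simp
      then show ?thesis unfolding lookup_add LOv HIv by simp
    qed
  qed
  moreover have "lt LO HI"
  proof -
    obtain q0 where q0: "q0 \<in> ?O" "diagonal m q0 < diagonal m (p q0)"
      using exists_diagonal_increase[OF cc pid] by blast
    define s where "s = q0 mod m" define b where "b = diagonal m q0"
    have "corner_count g m a p (Suc s) (Suc b) < corner_count g m a id (Suc s) (Suc b)"
      by (rule corner_count_mono(2)[OF cc q0(1)]) (use q0(2) in \<open>auto simp: s_def b_def diagonal_def\<close>)
    then have dpos: "0 < d (Suc s) (Suc b)" unfolding d_def by simp
    have "q0 < g * m" using q0 by (simp add: off_path_def)
    then have "b < n" "s < m" using diag mod unfolding b_def s_def by auto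
    moreover have "Suc s \<noteq> m" "Suc b \<noteq> n" using dpos d0 by (metis less_irrefl)+
    ultimately have sb: "s < m - 1" "b < n - 1" by auto
    have inner: "lt (\<Sum>j<d (Suc s) (Suc b). lo s b) (\<Sum>j<d (Suc s) (Suc b). hi s b)"
      by (rule sum_less[of _ 0]) (use dpos lohi[OF sb] in auto)
    have inner_le: "lt (\<Sum>j<d (Suc s) (Suc b). lo s b) (\<Sum>j<d (Suc s) (Suc b). hi s b) \<or>
        (\<Sum>j<d (Suc s) (Suc b). lo s b) = (\<Sum>j<d (Suc s) (Suc b). hi s b)" if "s < m - 1" "b < n - 1" for s b
      by (rule sum_le) (use lohi[OF that] in auto)
    have mid: "lt (\<Sum>b<n-1. \<Sum>j<d (Suc s) (Suc b). lo s b) (\<Sum>b<n-1. \<Sum>j<d (Suc s) (Suc b). hi s b)"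
      by (rule sum_less[where x = b], simp, use sb in simp, rule inner)
        (use inner_le[OF sb(1)] lohi(1,2)[OF sb(1)] in \<open>auto intro!: monomials_sum\<close>)
    have mid_le: "lt (\<Sum>b<n-1. \<Sum>j<d (Suc s) (Suc b). lo s b) (\<Sum>b<n-1. \<Sum>j<d (Suc s) (Suc b). hi s b) \<or>
        (\<Sum>b<n-1. \<Sum>j<d (Suc s) (Suc b). lo s b) = (\<Sum>b<n-1. \<Sum>j<d (Suc s) (Suc b). hi s b)" if "s < m - 1" for s
      by (rule sum_le) (use inner_le[OF that] lohi(1,2)[OF that] in \<open>auto intro!: monomials_sum\<close>)
    show ?thesis unfolding LO_def HI_def
      by (rule sum_less[where x = s], simp, use sb in simp, rule mid)
        (use mid_le lohi(1,2) in \<open>auto intro!: monomials_sum\<close>)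
  qed
  ultimately have "lt (?M + LO) (?U + LO)"
    using add_left[OF LH MU(1)] by simp
  then show ?thesis by (rule add_cancel[OF MU LH(1)])
qed

section \<open>Leading monomials of the minors\<close>

lemma pick_strict_mono_image:
  assumes h: "\<And>s t. s < t \<Longrightarrow> t < k \<Longrightarrow> h s < h t" and t: "t < k"
  shows "pick (h ` {..<k}) t = (h t :: nat)"
proof -
  have less: "h s < h t \<longleftrightarrow> s < t" if "s < k" for s
    using h[of s t] h[of t s] that t by (cases s t rule: linorder_cases) auto
  have "{a \<in> h ` {..<k}. a < h t} = h ` {..<t}" using less t by fastforce
  moreover have "inj_on h {..<t}"
  proof (rule inj_onI)
    fix x y assume "x \<in> {..<t}" "y \<in> {..<t}" "h x = h y"
    then show "x = y" using h[of x y] h[of y x] t by (cases x y rule: linorder_cases) auto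
  qed
  ultimately have "card {a \<in> h ` {..<k}. a < h t} = t" by (simp add: card_image)
  moreover have "h t \<in> h ` {..<k}" using t by simp
  ultimately show ?thesis using pick_card_in_set by metis
qed

lemma pick_interval: "t < k \<Longrightarrow> pick {i..<i + k} t = i + t"
  using pick_strict_mono_image[of k "\<lambda>t. i + t" t] by (simp add: lessThan_atLeast0 add.commute)

lemma pick_lessThan: "t < k \<Longrightarrow> pick {..<k} t = t"
  using pick_interval[of t k 0] by (simp add: lessThan_atLeast0)

lemma prod_pvar: "(\<Prod>x\<in>X. pvar (v x)) = (single (\<Sum>x\<in>X. single (v x) 1) 1 :: ('v, 'k::comm_ring_1) mpoly)"
  by (induction X rule: infinite_finite_induct) (auto simp: pvar_def mult_single)

lemma prod_single:
  "(\<Prod>x\<in>X. single (u x) (c x)) = (single (\<Sum>x\<in>X. u x) (\<Prod>x\<in>X. c x) :: ('v, 'k::comm_ring_1) mpoly)"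
  by (induction X rule: infinite_finite_induct) (auto simp: mult_single)

lemma det_two_by_two:
  "det (mat 2 2 f) = f (0, 0) * f (1, 1) - f (0, 1) * (f (1, 0) :: 'a::comm_ring_1)"
proof -
  let ?A = "mat 2 2 f"
  have "det ?A = (\<Sum>i<2. ?A $$ (i, 0) * cofactor ?A i 0)"
    by (rule laplace_expansion_column) auto
  also have "\<dots> = ?A $$ (0, 0) * cofactor ?A 0 0 + ?A $$ (1, 0) * cofactor ?A 1 0"
    by (simp add: numeral_2_eq_2)
  also have "cofactor ?A 0 0 = f (1, 1)" unfolding cofactor_def
    by (subst det_single) (auto simp: mat_delete_def)
  also have "cofactor ?A 1 0 = - f (0, 1)" unfolding cofactor_def
    by (subst det_single) (auto simp: mat_delete_def)
  finally show ?thesis by (simp add: algebra_simps)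
qed

context monomial_order
begin

lemma lead_sum:
  fixes f :: "'x \<Rightarrow> ('v, 'k::field) mpoly"
  assumes X: "finite X" "x0 \<in> X"
    and lead: "\<And>x. x \<in> X \<Longrightarrow> is_lead lt (f x) (u x)"
    and car: "\<And>x. x \<in> X \<Longrightarrow> keys (f x) \<subseteq> monomials V"
    and less: "\<And>x. x \<in> X \<Longrightarrow> x \<noteq> x0 \<Longrightarrow> lt (u x) (u x0)"
  shows "is_lead lt (\<Sum>x\<in>X. f x) (u x0)"
proof -
  have m: "u x \<in> monomials V" if "x \<in> X" for x using lead[OF that] car[OF that] by (auto simp: is_lead_def)
  have below: "lt t (u x0)" if x: "x \<in> X" and t: "t \<in> keys (f x)" and ne: "x \<noteq> x0 \<or> t \<noteq> u x0" for x t
  proof (cases "x = x0")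
    case True
    then show ?thesis using lead[OF x] t ne by (auto simp: is_lead_def)
  next
    case False
    have tm: "t \<in> monomials V" using car[OF x] t by blast
    show ?thesis
    proof (cases "t = u x")
      case True then show ?thesis using less[OF x False] by simp
    next
      case F: False
      then have "lt t (u x)" using lead[OF x] t by (auto simp: is_lead_def)
      then show ?thesis using trans[OF tm m[OF x] m[OF X(2)] _ less[OF x False]] by blast
    qed
  qed
  have "u x0 \<notin> keys (f x)" if "x \<in> X" "x \<noteq> x0" for x
    using below[OF that(1), of "u x0"] that(2) irrefl[OF m[OF X(2)]] by blast
  then have "lookup (\<Sum>x\<in>X. f x) (u x0) = (\<Sum>x\<in>X. if x = x0 then lookup (f x0) (u x0) else 0)"
    unfolding lookup_sum by (intro sum.cong) (auto simp: in_keys_iff)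
  also have "\<dots> = lookup (f x0) (u x0)" using X by simp
  finally have "u x0 \<in> keys (\<Sum>x\<in>X. f x)" using lead[OF X(2)] by (simp add: is_lead_def in_keys_iff)
  moreover have "lt t (u x0)" if "t \<in> keys (\<Sum>x\<in>X. f x)" "t \<noteq> u x0" for t
    using keys_sum_cases[OF that(1)] below that(2) by metis
  ultimately show ?thesis unfolding is_lead_def by blast
qed

lemma lead_from_initial_term:
  fixes f :: "('v, 'k::field) mpoly"
  assumes "keys f \<subseteq> monomials V" "initial_term lt f \<in> {single t 1, - single t 1}"
  shows "is_lead lt f t"
proof -
  have ne: "initial_term lt f \<noteq> 0" using assms(2)
    by (metis insert_iff lookup_single_eq lookup_uminus lookup_zero neg_equal_0_iff_equal singletonD zero_neq_one)
  have "f \<noteq> 0" using ne by (auto simp: initial_term_def)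
  then obtain s where s: "is_lead lt f s" using lead_exists assms(1) by blast
  have "initial_term lt f = single s (lookup f s)"
    unfolding initial_term_def initial_monomial_eq[OF s assms(1)] ..
  then have "lookup (single s (lookup f s)) t \<noteq> 0"
    using assms(2) by auto
  then have "s = t" by (auto simp: lookup_single when_def split: if_splits)
  then show ?thesis using s by simp
qed

end

locale generic_link_setting =
  fixes m n :: nat and C :: "nat \<Rightarrow> nat set" and lt :: "var monomial \<Rightarrow> var monomial \<Rightarrow> bool"
    and ys :: "(nat \<times> nat) list" and K :: "'k::field itself"
  assumes m: "1 \<le> m" and mn: "m < n" and enum: "minor_enumeration m n C"
    and ad: "antidiagonal_order TYPE('k) m n lt" and ys: "y_order m n ys"
begin

abbreviation (input) g where "g \<equiv> n - m + 1"
abbreviation (input) \<eta> where "\<eta> \<equiv> n choose m"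

definition P :: "nat \<Rightarrow> nat \<Rightarrow> nat" where "P k c = pick (C k) c"
definition x :: "nat \<Rightarrow> nat \<Rightarrow> (var, 'k) mpoly" where "x r b = pvar (XVar r b)"
definition y :: "nat \<Rightarrow> nat \<Rightarrow> (var, 'k) mpoly" where "y i k = pvar (YVar i k)"
definition \<Delta> :: "nat \<Rightarrow> (var, 'k) mpoly" where "\<Delta> k = det (mat m m (\<lambda>(r, c). x r (P k c)))"
definition F :: "nat \<Rightarrow> (var, 'k) mpoly" where "F i = (\<Sum>k<\<eta>. y i k * \<Delta> k)"

lemma n_eq: "n = g + m - 1" using mn by simp

lemma C: "k < \<eta> \<Longrightarrow> C k \<subseteq> {..<n}" "k < \<eta> \<Longrightarrow> card (C k) = m"
  and C_onto: "B \<subseteq> {..<n} \<Longrightarrow> card B = m \<Longrightarrow> \<exists>k<\<eta>. C k = B"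
  and C_interval: "i < g \<Longrightarrow> C i = {i..<i + m}"
proof -
  have b: "bij_betw C {..<\<eta>} {B. B \<subseteq> {..<n} \<and> card B = m}" and i: "\<forall>j<g. C j = {j..<j + m}"
    using enum unfolding minor_enumeration_def by auto
  show "k < \<eta> \<Longrightarrow> C k \<subseteq> {..<n}" "k < \<eta> \<Longrightarrow> card (C k) = m" using bij_betwE[OF b] by auto
  show "\<exists>k<\<eta>. C k = B" if "B \<subseteq> {..<n}" "card B = m"
    using b that unfolding bij_betw_def by (metis (mono_tags, lifting) imageE lessThan_iff mem_Collect_eq)
  show "i < g \<Longrightarrow> C i = {i..<i + m}" using i by blast
qed

lemma g_le: "g \<le> \<eta>"
proof -
  let ?S = "{B. B \<subseteq> {..<n} \<and> card B = m}"
  have "inj_on (\<lambda>i. {i..<i + m}) {..<g}"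
  proof (rule inj_onI)
    fix i j assume "{i..<i + m} = {j..<j + m}"
    then have "i \<in> {j..<j + m}" "j \<in> {i..<i + m}" using m by auto
    then show "i = j" by simp
  qed
  then have "card ((\<lambda>i. {i..<i + m}) ` {..<g}) = g" by (simp add: card_image)
  moreover have "(\<lambda>i. {i..<i + m}) ` {..<g} \<subseteq> ?S" using mn by auto
  moreover have "finite ?S" by (rule finite_subset[of _ "Pow {..<n}"]) auto
  moreover have "card ?S = \<eta>" using n_subsets[of "{..<n}" m] by simp
  ultimately show ?thesis using card_mono[of ?S "(\<lambda>i. {i..<i + m}) ` {..<g}"] by simp
qed

lemma P_less: "k < \<eta> \<Longrightarrow> c < m \<Longrightarrow> P k c < n"
  using C pick_in_set[of c "C k"] unfolding P_def by auto

lemma P_mono: "k < \<eta> \<Longrightarrow> c < c' \<Longrightarrow> c' < m \<Longrightarrow> P k c < P k c'"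
  using C(2) pick_mono[of c' "C k" c] unfolding P_def by auto

lemma P_inj: "k < \<eta> \<Longrightarrow> inj_on (P k) {0..<m}"
proof (rule inj_onI)
  fix c c' assume "k < \<eta>" "c \<in> {0..<m}" "c' \<in> {0..<m}" "P k c = P k c'"
  then show "c = c'" using P_mono[of k c c'] P_mono[of k c' c] by (cases c c' rule: linorder_cases) auto
qed

lemma P_interval: "i < g \<Longrightarrow> c < m \<Longrightarrow> P i c = i + c"
  unfolding P_def by (simp only: C_interval pick_interval)

lemma max_minor_eq:
  assumes k: "k < \<eta>"
  shows "max_minor m n C k = \<Delta> k"
proof -
  have 1: "{i. i < m \<and> i \<in> {..<m}} = {..<m}" "{j. j < n \<and> j \<in> C k} = C k" using C[OF k] by auto
  have "submatrix (xmat m n) {..<m} (C k) = mat m m (\<lambda>(r, c). x r (P k c))"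
    unfolding submatrix_def xmat_def dim_row_mat dim_col_mat 1 C(2)[OF k] card_lessThan
    by (rule eq_matI) (use P_less[OF k] in \<open>auto simp: pick_lessThan x_def P_def\<close>)
  then show ?thesis unfolding max_minor_def minor_def \<Delta>_def by simp
qed

lemma x_carrier: "r < m \<Longrightarrow> b < n \<Longrightarrow> x r b \<in> carrier (poly_ring (xvars m n))"
  unfolding x_def by (rule carrier_pvar) (auto simp: xvars_def)

lemma y_carrier: "i < g \<Longrightarrow> k < \<eta> \<Longrightarrow> y i k \<in> carrier (poly_ring (svars m n))"
  unfolding y_def by (rule carrier_pvar) (auto simp: svars_def yvars_def)

lemma xvars_carrier: "f \<in> carrier (poly_ring (xvars m n)) \<Longrightarrow> f \<in> carrier (poly_ring (svars m n))"
  by (rule carrier_mono) (auto simp: svars_def)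

lemma xvars_monomials: "t \<in> monomials (xvars m n) \<Longrightarrow> t \<in> monomials (svars m n)"
  unfolding monomials_def svars_def by auto

lemma \<Delta>_carrier: "k < \<eta> \<Longrightarrow> \<Delta> k \<in> carrier (poly_ring (xvars m n))"
  unfolding \<Delta>_def by (rule carrier_det[of _ m]) (auto intro!: x_carrier P_less)

lemma F_carrier: "i < g \<Longrightarrow> F i \<in> carrier (poly_ring (svars m n))"
  unfolding F_def by (intro carrier_sum carrier_mult y_carrier xvars_carrier \<Delta>_carrier) auto

lemma lt_term_order: "term_order (xvars m n) lt"
  using ad unfolding antidiagonal_order_def by blast

abbreviation (input) lo where "lo \<equiv> link_order ys lt"

lemma lo_term_order: "term_order (svars m n) lo"
  by (rule link_order_term_order[OF ys lt_term_order])

sublocale xo: monomial_order "xvars m n" lt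
  by (rule term_order_monomial_order[OF lt_term_order])

sublocale lo: monomial_order "svars m n" "lo"
  by (rule term_order_monomial_order[OF lo_term_order])

definition \<delta> :: "nat \<Rightarrow> var monomial" where "\<delta> k = (\<Sum>t<m. xmon m t (P k t))"

lemma \<delta>_monomials: "k < \<eta> \<Longrightarrow> \<delta> k \<in> monomials (xvars m n)"
  unfolding \<delta>_def by (auto intro!: monomials_sum xmon_monomials P_less)

lemma \<Delta>_lead:
  assumes k: "k < \<eta>"
  shows "is_lead lt (\<Delta> k) (\<delta> k)"
proof (rule xo.lead_from_initial_term)
  show "keys (\<Delta> k) \<subseteq> monomials (xvars m n)" using \<Delta>_carrier[OF k] by (simp add: poly_ring_carrier)
  have "(\<Prod>i<m. pvar (XVar (pick {..<m} i) (pick (C k) (m - 1 - i)))) =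
      (\<Prod>t<m. pvar (XVar (m - 1 - t) (P k t)) :: (var, 'k) mpoly)"
    by (rule prod.reindex_bij_witness[of _ "\<lambda>t. m - 1 - t" "\<lambda>t. m - 1 - t"]) (auto simp: pick_lessThan P_def)
  also have "\<dots> = single (\<delta> k) 1" unfolding prod_pvar \<delta>_def xmon_def ..
  finally have eq: "(\<Prod>i<m. pvar (XVar (pick {..<m} i) (pick (C k) (m - 1 - i)))) = (single (\<delta> k) 1 :: (var, 'k) mpoly)" .
  have "card {..<m} = card (C k)" "{..<m} \<noteq> {}" using C(2)[OF k] m by (auto simp: lessThan_empty_iff)
  then have "initial_term lt (minor m n {..<m} (C k) :: (var, 'k) mpoly) \<in> {single (\<delta> k) 1, - single (\<delta> k) 1}"
    using ad[unfolded antidiagonal_order_def, THEN conjunct2, rule_format, of "{..<m}" "C k"] C(1)[OF k]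
    unfolding card_lessThan eq Let_def by blast
  then show "initial_term lt (\<Delta> k) \<in> {single (\<delta> k) 1, - single (\<delta> k) 1}"
    using max_minor_eq[OF k] unfolding max_minor_def by simp
qed

lemma adjacent_less:
  assumes s: "Suc s < m" and b: "Suc b < n"
  shows "lt (xmon m s (Suc b) + xmon m (Suc s) b) (xmon m s b + xmon m (Suc s) (Suc b))"
proof -
  obtain r where r: "Suc r < m" "m - 1 - s = Suc r" "m - 1 - Suc s = r" using s by force
  let ?A = "{r..<r + 2}" and ?B = "{b..<b + 2}"
  let ?f = "minor m n ?A ?B :: (var, 'k) mpoly"
  let ?hi = "xmon m s b + xmon m (Suc s) (Suc b)" and ?lo = "xmon m s (Suc b) + xmon m (Suc s) b"
  have A: "{i. i < m \<and> i \<in> ?A} = ?A" "{j. j < n \<and> j \<in> ?B} = ?B" using r b by auto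
  have "submatrix (xmat m n) ?A ?B = mat 2 2 (\<lambda>(i, j). x (r + i) (b + j))"
    unfolding submatrix_def xmat_def dim_row_mat dim_col_mat A
  proof (rule eq_matI)
    fix i j assume "i < dim_row (mat 2 2 (\<lambda>(i, j). x (r + i) (b + j)))" "j < dim_col (mat 2 2 (\<lambda>(i, j). x (r + i) (b + j)))"
    then have ij: "i < 2" "j < 2" by auto
    then have "r + i < m" "b + j < n" using r b by auto
    then show "mat (card ?A) (card ?B) (\<lambda>(i, j). mat m n (\<lambda>(i, j). pvar (XVar i j)) $$ (pick ?A i, pick ?B j)) $$ (i, j) =
        mat 2 2 (\<lambda>(i, j). x (r + i) (b + j)) $$ (i, j)"
      using ij by (simp add: pick_interval x_def del: add_2_eq_Suc')
  qed auto
  then have "?f = det (mat 2 2 (\<lambda>(i, j). x (r + i) (b + j)))" unfolding minor_def by simp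
  also have "\<dots> = x r b * x (Suc r) (Suc b) - x r (Suc b) * x (Suc r) b"
    by (simp add: det_two_by_two)
  also have "\<dots> = single ?lo 1 - single ?hi 1"
    unfolding x_def pvar_def mult_single xmon_def r by (simp add: add.commute)
  finally have f: "?f = single ?lo 1 - single ?hi 1" .
  have mon: "?lo \<in> monomials (xvars m n)" "?hi \<in> monomials (xvars m n)"
    using s b by (auto intro!: monomials_add xmon_monomials)
  have ne: "?lo \<noteq> ?hi"
  proof
    assume "?lo = ?hi"
    then have "lookup ?lo (XVar (m - 1 - s) b) = lookup ?hi (XVar (m - 1 - s) b)" by simp
    then show False unfolding lookup_add using s by (simp only: lookup_xmon) simp
  qed
  have kf: "keys ?f \<subseteq> monomials (xvars m n)" unfolding f
    using mon by (auto simp: in_keys_iff lookup_minus lookup_single when_def split: if_splits)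
  have "(\<Prod>i<2. pvar (XVar (pick ?A i) (pick ?B (2 - 1 - i)))) = (single ?hi 1 :: (var, 'k) mpoly)"
  proof -
    have two: "{..<2::nat} = {0, 1}" by auto
    have pk: "pick {i..<i + 2} 0 = i" "pick {i..<i + 2} 1 = Suc i" for i
      using pick_interval[of 0 2 i] pick_interval[of 1 2 i] by simp_all
    have sub: "2 - 1 - 0 = (1::nat)" "2 - 1 - 1 = (0::nat)" by auto
    show ?thesis unfolding prod_pvar xmon_def r two
      by (subst sum.insert, simp, simp, subst sum.insert, simp, simp)
        (simp only: pk sub sum.empty add_0_right add_0_left add.commute)
  qed
  moreover have "card ?A = 2" "card ?B = 2" "?A \<noteq> {}" by auto
  ultimately have "initial_term lt ?f \<in> {single ?hi 1, - single ?hi 1}"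
    using ad[unfolded antidiagonal_order_def, THEN conjunct2, rule_format, of ?A ?B] r b
    unfolding Let_def by (auto simp: subset_iff)
  then have "is_lead lt ?f ?hi" by (rule xo.lead_from_initial_term[OF kf])
  moreover have "?lo \<in> keys ?f" unfolding f using ne by (simp add: in_keys_iff lookup_minus lookup_single when_def)
  ultimately show ?thesis using ne unfolding is_lead_def by blast
qed

end

section \<open>Leading monomials in the link\<close>

context generic_link_setting
begin

lemma y_order_facts: "g \<le> length ys" "i < g \<Longrightarrow> ys ! i = (i, i)"
proof -
  have "length ys = g * \<eta>" using ys distinct_card[of ys] unfolding y_order_def by (simp add: card_cartesian_product)
  moreover have "g * 1 \<le> g * \<eta>" using g_le by (intro mult_le_mono2) simp
  ultimately show "g \<le> length ys" by simp
  show "i < g \<Longrightarrow> ys ! i = (i, i)" using ys unfolding y_order_def by simp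
qed

lemma lo_of_lt:
  assumes "u \<in> monomials (xvars m n)" "v \<in> monomials (xvars m n)" "lt u v"
  shows "lo u v"
proof -
  have y0: "lookup w (YVar i j) = 0" if "w \<in> monomials (xvars m n)" for w i j
    by (rule monomials_lookup[OF that]) (auto simp: xvars_def)
  have x: "x_part w = w" if "w \<in> monomials (xvars m n)" for w
    using y0[OF that] by (intro poly_mapping_eqI) (simp add: lookup_x_part split: var.split)
  show ?thesis
    unfolding link_order_iff[OF ys xvars_monomials[OF assms(1)] xvars_monomials[OF assms(2)]]
    using assms y0 x by (simp add: y_exp_def)
qed

lemma lo_of_y:
  assumes u: "u \<in> monomials (svars m n)" and v: "v \<in> monomials (svars m n)" and i: "i < g"
    and eq: "\<And>j. j < i \<Longrightarrow> lookup u (YVar j j) = lookup v (YVar j j)"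
    and less: "lookup u (YVar i i) < lookup v (YVar i i)"
  shows "lo u v"
proof -
  have "y_exp ys j w = lookup w (YVar j j)" if "j < g" for j w
    using y_order_facts(2)[OF that] by (simp add: y_exp_def)
  then have "\<exists>k<length ys. (\<forall>j<k. y_exp ys j u = y_exp ys j v) \<and> y_exp ys k u < y_exp ys k v"
    using i eq less y_order_facts(1) by (intro exI[of _ i]) auto
  then show ?thesis unfolding link_order_iff[OF ys u v] by blast
qed

lemma single_y_monomials: "i < g \<Longrightarrow> k < \<eta> \<Longrightarrow> single (YVar i k) 1 \<in> monomials (svars m n)"
  by (rule monomials_single) (auto simp: svars_def yvars_def)

lemma \<Delta>_lead_lo:
  assumes k: "k < \<eta>"
  shows "is_lead lo (\<Delta> k) (\<delta> k)"
  using \<Delta>_lead[OF k] \<Delta>_carrier[OF k] lo_of_lt[OF _ \<delta>_monomials[OF k]]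
  unfolding is_lead_def poly_ring_carrier by blast

definition L :: "nat \<Rightarrow> var monomial" where "L i = single (YVar i i) 1 + \<delta> i"

lemma F_lead:
  assumes i: "i < g"
  shows "is_lead lo (F i) (L i)"
  unfolding F_def L_def
proof (rule lo.lead_sum[where u = "\<lambda>k. single (YVar i k) 1 + \<delta> k"])
  show "finite {..<\<eta>}" by simp
  show i\<eta>: "i \<in> {..<\<eta>}" using i g_le by simp
  fix k assume k: "k \<in> {..<\<eta>}"
  have \<Delta>k: "keys (\<Delta> k) \<subseteq> monomials (svars m n)"
    using xvars_carrier[OF \<Delta>_carrier] k by (simp add: poly_ring_carrier)
  have yk: "keys (y i k) \<subseteq> monomials (svars m n)"
    using y_carrier i k by (simp add: poly_ring_carrier)
  have "is_lead lo (y i k) (single (YVar i k) 1)"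
    unfolding y_def pvar_def is_lead_def by simp
  then show "is_lead lo (y i k * \<Delta> k) (single (YVar i k) 1 + \<delta> k)"
    using \<Delta>_lead_lo k \<Delta>k yk by (intro lo.lead_mult) auto
  show "keys (y i k * \<Delta> k) \<subseteq> monomials (svars m n)"
    using carrier_mult[OF y_carrier xvars_carrier[OF \<Delta>_carrier]] i k by (simp add: poly_ring_carrier)
  have \<delta>y: "lookup (\<delta> l) (YVar j j') = 0" if "l < \<eta>" for l j j'
    by (rule monomials_lookup[OF \<delta>_monomials[OF that]]) (auto simp: xvars_def)
  have mon: "single (YVar i l) 1 + \<delta> l \<in> monomials (svars m n)" if "l < \<eta>" for l
    using that i by (intro monomials_add single_y_monomials xvars_monomials \<delta>_monomials) auto
  assume ki: "k \<noteq> i"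
  show "lo (single (YVar i k) 1 + \<delta> k) (single (YVar i i) 1 + \<delta> i)"
    by (rule lo_of_y[OF mon mon i]) (use k i i\<eta> ki \<delta>y in \<open>auto simp: lookup_add lookup_single when_def\<close>)
qed

abbreviation (input) N where "N \<equiv> g * m"

definition term_monomial :: "(nat \<Rightarrow> nat) \<Rightarrow> (nat \<Rightarrow> nat) \<Rightarrow> (nat \<Rightarrow> nat) \<Rightarrow> var monomial" where
  "term_monomial a k p = (\<Sum>i<g. single (YVar i (k i)) 1) +
     (\<Sum>q\<in>off_path g m a. xmon m (q mod m) (col_of P m k (p q)))"

definition term_coeff :: "(nat \<Rightarrow> nat) \<Rightarrow> (nat \<Rightarrow> nat) \<Rightarrow> (nat \<Rightarrow> nat) \<Rightarrow> 'k" where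
  "term_coeff a k p = of_int (sign p) * (\<Prod>q = 0..<N. if on_path a m q
     then of_bool (col_of P m k (p q) = diagonal m q) else of_bool (p q div m = q div m))"

lemma link_poly_expand:
  "link_poly y x P g m \<eta> a = (\<Sum>(k, p)\<in>PiE {..<g} (\<lambda>_. {..<\<eta>}) \<times> {p. p permutes {0..<N}}.
     single (term_monomial a k p) (term_coeff a k p))"
proof -
  have "(\<Prod>i<g. y i (k i)) * det (link_matrix x P g m a k) =
      (\<Sum>p | p permutes {0..<N}. single (term_monomial a k p) (term_coeff a k p))" for k
  proof -
    let ?c = "\<lambda>p q. if on_path a m q then of_bool (col_of P m k (p q) = diagonal m q) else of_bool (p q div m = q div m) :: 'k"
    let ?u = "\<lambda>p q. if on_path a m q then 0 else xmon m (q mod m) (col_of P m k (p q))"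
    have entry: "(\<Prod>q = 0..<N. link_matrix x P g m a k $$ (q, p q)) =
        single (\<Sum>q\<in>off_path g m a. xmon m (q mod m) (col_of P m k (p q))) (\<Prod>q = 0..<N. ?c p q)"
      if p: "p permutes {0..<N}" for p
    proof -
      have "(\<Prod>q = 0..<N. link_matrix x P g m a k $$ (q, p q)) = (\<Prod>q = 0..<N. single (?u p q) (?c p q))"
      proof (rule prod.cong[OF refl])
        fix q assume q: "q \<in> {0..<N}"
        then have "p q < N" using permutes_in_image[OF p, of q] by simp
        then show "link_matrix x P g m a k $$ (q, p q) = single (?u p q) (?c p q)"
          using q by (simp add: link_matrix_def x_def pvar_def xmon_def)
      qed
      also have "\<dots> = single (\<Sum>q = 0..<N. ?u p q) (\<Prod>q = 0..<N. ?c p q)" by (rule prod_single)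
      also have "(\<Sum>q = 0..<N. ?u p q) = (\<Sum>q\<in>off_path g m a. xmon m (q mod m) (col_of P m k (p q)))"
        unfolding off_path_def by (subst sum.inter_filter) (auto intro!: sum.cong)
      finally show ?thesis .
    qed
    have "(\<Prod>i<g. y i (k i)) * det (link_matrix x P g m a k) =
        (\<Sum>p | p permutes {0..<N}. (\<Prod>i<g. y i (k i)) *
          (of_int (sign p) * (\<Prod>q = 0..<N. link_matrix x P g m a k $$ (q, p q))))"
      by (subst det_def'[of _ N]) (simp_all add: link_matrix_def sum_distrib_left)
    also have "\<dots> = (\<Sum>p | p permutes {0..<N}. single (term_monomial a k p) (term_coeff a k p))"
    proof (rule sum.cong[OF refl])
      fix p assume "p \<in> {p. p permutes {0..<N}}"
      then have p: "p permutes {0..<N}" by simp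
      show "(\<Prod>i<g. y i (k i)) * (of_int (sign p) * (\<Prod>q = 0..<N. link_matrix x P g m a k $$ (q, p q))) =
          single (term_monomial a k p) (term_coeff a k p)"
        unfolding entry[OF p] y_def prod_pvar term_monomial_def term_coeff_def single_of_int[symmetric] mult_single
        by simp
    qed
    finally show ?thesis .
  qed
  then show ?thesis unfolding link_poly_def by (simp add: sum.cartesian_product)
qed

definition U :: "(nat \<Rightarrow> nat) \<Rightarrow> var monomial" where
  "U a = (\<Sum>i<g. single (YVar i i) 1) + off_path_monomial g m a id"

text \<open>Each term contains one variable of every row of \<open>Y\<close>, so its \<open>Y\<close>-part is largest if \<open>k\<close> is the identity. Then
  column \<open>q\<close> of the matrix belongs to column \<open>diagonal m q\<close> of \<open>X\<close>. A permutation with nonzero term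
  keeps the diagonal on the path and the block off the path, and \<open>off_path_monomial_less\<close> puts it below the
  identity. As only one term has the top monomial, its coefficient is 1 in every characteristic.\<close>

lemma link_poly_lead:
  assumes st: "staircase g m a"
  shows "is_lead lo (link_poly y x P g m \<eta> a) (U a)"
proof -
  let ?K = "PiE {..<g} (\<lambda>_. {..<\<eta>})" and ?Perm = "{p. p permutes {0..<N}}"
  define k0 where "k0 = (\<lambda>i\<in>{..<g}. i)"
  have k0: "k0 \<in> ?K" using g_le unfolding k0_def by auto
  have mod: "q mod m < m" for q using m by simp
  have blk: "q div m < g" if "q < N" for q using that by (simp add: less_mult_imp_div_less)
  have col0: "col_of P m k0 q = diagonal m q" if "q < N" for q
    using P_interval[OF blk[OF that] mod] blk[OF that] unfolding col_of_def diagonal_def k0_def by simp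
  have col: "col_of P m k q < n" if "k \<in> ?K" "q < N" for k q
    unfolding col_of_def using that blk[OF that(2)] by (intro P_less mod) auto
  have yl: "lookup (\<Sum>i<g. single (YVar i (k i)) 1) (YVar j j') = (if j < g \<and> k j = j' then 1 else (0::nat))" for k j j'
  proof -
    have "lookup (\<Sum>i<g. single (YVar i (k i)) 1) (YVar j j') = (\<Sum>i<g. if i = j then (if k j = j' then 1 else 0) else (0::nat))"
      unfolding lookup_sum by (rule sum.cong) (auto simp: lookup_single when_def)
    then show ?thesis by simp
  qed
  let ?x = "\<lambda>k p. \<Sum>q\<in>off_path g m a. xmon m (q mod m) (col_of P m k (p q))"
  have xm: "?x k p \<in> monomials (xvars m n)" if "k \<in> ?K" "p permutes {0..<N}" for k p
    using that permutes_in_image[OF that(2)] by (intro monomials_sum xmon_monomials mod col) (auto simp: off_path_def)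
  have ym: "(\<Sum>i<g. single (YVar i (k i)) 1) \<in> monomials (svars m n)" if "k \<in> ?K" for k
    using that by (intro monomials_sum single_y_monomials) auto
  have tm: "term_monomial a k p \<in> monomials (svars m n)" if "k \<in> ?K" "p permutes {0..<N}" for k p
    unfolding term_monomial_def by (intro monomials_add ym xvars_monomials xm that)
  have tl: "lookup (term_monomial a k p) (YVar j j) = (if j < g \<and> k j = j then 1 else 0)"
    if "k \<in> ?K" "p permutes {0..<N}" for k p j
  proof -
    have "lookup (?x k p) (YVar j j) = 0"
      by (rule monomials_lookup[OF xm[OF that]]) (auto simp: xvars_def)
    then show ?thesis unfolding term_monomial_def lookup_add yl by simp
  qed
  have x0: "?x k0 p = off_path_monomial g m a p" if "p permutes {0..<N}" for p
    unfolding off_path_monomial_def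
    by (rule sum.cong[OF refl]) (use col0 permutes_in_image[OF that] in \<open>auto simp: off_path_def\<close>)
  have U: "U a = term_monomial a k0 id"
    unfolding U_def term_monomial_def x0[OF permutes_id] by (simp add: k0_def)
  have "is_lead lo (\<Sum>z\<in>?K \<times> ?Perm. single (case_prod (term_monomial a) z) (case_prod (term_coeff a) z))
      (case_prod (term_monomial a) (k0, id))"
  proof (rule lo.lead_sum_single)
    show "finite (?K \<times> ?Perm)" by (intro finite_cartesian_product finite_PiE finite_permutations) auto
    show "(k0, id) \<in> ?K \<times> ?Perm" using k0 permutes_id by auto
    have "(\<Prod>q = 0..<N. if on_path a m q then of_bool (col_of P m k0 (id q) = diagonal m q)
        else of_bool (id q div m = q div m)) = (1 :: 'k)"
      by (rule prod.neutral) (use col0 in auto)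
    then show "case_prod (term_coeff a) (k0, id) \<noteq> 0" unfolding term_coeff_def by simp
    show "case_prod (term_monomial a) (k0, id) \<in> monomials (svars m n)" using tm[OF k0 permutes_id] by simp
    fix z assume z: "z \<in> ?K \<times> ?Perm" "z \<noteq> (k0, id)" and c: "case_prod (term_coeff a) z \<noteq> 0"
    obtain k p where zkp: "z = (k, p)" by (cases z)
    have k: "k \<in> ?K" and p: "p permutes {0..<N}" using z zkp by auto
    have c': "term_coeff a k p \<noteq> 0" using c zkp by simp
    have nz: "(if on_path a m q then of_bool (col_of P m k (p q) = diagonal m q) else of_bool (p q div m = q div m)) \<noteq> (0 :: 'k)"
      if "q < N" for q
    proof
      assume z0: "(if on_path a m q then of_bool (col_of P m k (p q) = diagonal m q) else of_bool (p q div m = q div m)) = (0 :: 'k)"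
      have "(\<Prod>q = 0..<N. if on_path a m q then of_bool (col_of P m k (p q) = diagonal m q)
          else of_bool (p q div m = q div m)) = (0 :: 'k)"
        by (rule prod_zero, simp, rule bexI[of _ q], rule z0) (use that in simp)
      then have "term_coeff a k p = 0" unfolding term_coeff_def by simp
      then show False using c' by simp
    qed
    have "lo (term_monomial a k p) (term_monomial a k0 id)"
    proof (cases "k = k0")
      case False
      have "\<exists>j. j < g \<and> k j \<noteq> j"
      proof (rule ccontr)
        assume *: "\<not> ?thesis"
        have "k = k0" by (rule PiE_ext[OF k k0]) (use * in \<open>auto simp: k0_def\<close>)
        then show False using False by simp
      qed
      define j where "j = (LEAST j. j < g \<and> k j \<noteq> j)"
      have j: "j < g" "k j \<noteq> j" using LeastI_ex[OF \<open>\<exists>j. j < g \<and> k j \<noteq> j\<close>] unfolding j_def by auto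
      have below: "k i = i" if "i < j" for i
        using not_less_Least[of i "\<lambda>j. j < g \<and> k j \<noteq> j"] that j unfolding j_def[symmetric] by auto
      have k0i: "k0 i = i" if "i < g" for i using that unfolding k0_def by simp
      show ?thesis
        by (rule lo_of_y[OF tm[OF k p] tm[OF k0 permutes_id] j(1)])
          (use j below k0i in \<open>auto simp: tl[OF k p] tl[OF k0 permutes_id]\<close>)
    next
      case True
      have pN: "p q < N" if "q < N" for q using permutes_in_image[OF p, of q] that by simp
      have "lt (off_path_monomial g m a p) (off_path_monomial g m a id)"
      proof (rule off_path_monomial_less[OF st m _ n_eq p])
        show "1 \<le> g" by simp
        show "p \<noteq> id" using z zkp True by simp
        show "monomial_order (xvars m n) lt" by (rule xo.monomial_order_axioms)
        show "diagonal m (p q) = diagonal m q" if "q < N" "on_path a m q" for q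
          using nz[OF that(1)] that True col0[OF pN] by (simp split: if_splits)
        show "p q div m = q div m" if "q < N" "\<not> on_path a m q" for q
          using nz[OF that(1)] that by (simp split: if_splits)
      qed (rule adjacent_less)
      then have "lo (?x k0 p) (?x k0 id)"
        using xm[OF k0 p] xm[OF k0 permutes_id] unfolding x0[OF p] x0[OF permutes_id] by (intro lo_of_lt)
      then show ?thesis unfolding True term_monomial_def
        by (intro lo.add_left xvars_monomials xm k0 p permutes_id ym)
    qed
    then show "lo (case_prod (term_monomial a) z) (case_prod (term_monomial a) (k0, id))"
      using zkp by simp
  qed
  then show ?thesis unfolding link_poly_expand U by (simp add: case_prod_beta')
qed

end

section \<open>The initial ideal and its symbolic powers\<close>

lemma nat_pow_ideals_set:
  "I [^]\<^bsub>ideals_set R\<^esub> (0::nat) = carrier R"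
  "I [^]\<^bsub>ideals_set R\<^esub> Suc l = ideal_prod R (I [^]\<^bsub>ideals_set R\<^esub> l) I"
  unfolding nat_pow_def ideals_set_def by simp_all

lemma ideal_prod_mono: "I \<subseteq> I' \<Longrightarrow> H \<subseteq> H' \<Longrightarrow> ideal_prod R I H \<subseteq> ideal_prod R I' H'"
proof
  fix s assume sub: "I \<subseteq> I'" "H \<subseteq> H'" and "s \<in> ideal_prod R I H"
  from this(3) show "s \<in> ideal_prod R I' H'"
    by (induction rule: ideal_prod.induct) (use sub in \<open>auto intro: ideal_prod.intros\<close>)
qed

lemma ideals_pow_mono: "I \<subseteq> I' \<Longrightarrow> I [^]\<^bsub>ideals_set R\<^esub> (l::nat) \<subseteq> I' [^]\<^bsub>ideals_set R\<^esub> l"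
proof (induction l)
  case 0
  then show ?case by (simp add: nat_pow_ideals_set)
next
  case (Suc l)
  then show ?case unfolding nat_pow_ideals_set by (intro ideal_prod_mono)
qed

lemma ideals_pow_ideal:
  assumes "cring R" "ideal I R"
  shows "ideal (I [^]\<^bsub>ideals_set R\<^esub> (l::nat)) R"
proof -
  interpret cring R by (rule assms(1))
  show ?thesis
  proof (induction l)
    case 0
    then show ?case unfolding nat_pow_ideals_set by (rule oneideal)
  next
    case (Suc l)
    then show ?case unfolding nat_pow_ideals_set by (rule ideal_prod_is_ideal[OF _ assms(2)])
  qed
qed

lemma ideal_upward_closed:
  assumes "\<And>s t. s \<in> monomials V \<Longrightarrow> Q t \<Longrightarrow> Q (s + t)"
  shows "ideal {f \<in> polys V. \<forall>t\<in>keys f. Q t} (poly_ring V)" (is "ideal ?I _")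
proof (rule poly_idealI)
  show "0 \<in> ?I" by (simp add: carrier_zero)
  show "f + h \<in> ?I" if "f \<in> ?I" "h \<in> ?I" for f h
    using that keys_add[of f h] by (auto intro: carrier_add)
  show "f * h \<in> ?I" if f: "f \<in> polys V" and h: "h \<in> ?I" for f h
  proof -
    have "Q t" if t: "t \<in> keys (f * h)" for t
    proof -
      obtain s s' where "t = s + s'" "s \<in> keys f" "s' \<in> keys h" using t keys_mult[of f h] by blast
      then show ?thesis using assms[of s s'] f h by (auto simp: poly_ring_carrier)
    qed
    then show ?thesis using f h by (auto intro: carrier_mult)
  qed
qed auto

context generic_link_setting
begin

abbreviation (input) S where "S \<equiv> poly_ring (svars m n) :: (var, 'k) mpoly ring"
abbreviation (input) J where "J \<equiv> generic_link m n C :: (var, 'k) mpoly set"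

lemma link_ci_eq: "link_ci m n C = genideal S (F ` {..<g})"
proof -
  let ?v = "ymat m n *\<^sub>v vec \<eta> (max_minor m n C) :: (var, 'k) mpoly vec"
  have "?v $ i = F i" if "i < g" for i
  proof -
    have "?v $ i = (\<Sum>k = 0..<\<eta>. y i k * max_minor m n C k)"
      using that unfolding ymat_def y_def by (simp add: scalar_prod_def)
    also have "\<dots> = F i" unfolding F_def by (rule sum.cong) (auto simp: max_minor_eq)
    finally show ?thesis .
  qed
  moreover have "set\<^sub>v ?v = (\<lambda>i. ?v $ i) ` {..<g}"
    unfolding vec_set_def by (auto simp: ymat_def)
  ultimately have "set\<^sub>v ?v = F ` {..<g}" by auto
  then show ?thesis unfolding link_ci_def by simp
qed

lemma link_ci_ideal: "ideal (link_ci m n C) S" and F_link_ci: "i < g \<Longrightarrow> F i \<in> link_ci m n C"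
  using genideal_poly[OF image_subsetI, of "{..<g}" F "svars m n"] F_carrier unfolding link_ci_eq by auto

lemma J_carrier: "f \<in> J \<Longrightarrow> f \<in> carrier S"
  unfolding generic_link_def ideal_quotient_def by blast

lemma J_mult_minor:
  assumes "f \<in> J" "k < \<eta>"
  shows "f * \<Delta> k \<in> link_ci m n C"
proof -
  have "max_minor m n C k \<in> genideal S (minors_ideal m n C)"
    unfolding minors_ideal_def genideal_def using assms(2) by blast
  then show ?thesis using assms max_minor_eq unfolding generic_link_def ideal_quotient_def by force
qed

lemma J_intro:
  assumes f: "f \<in> carrier S" and minors: "\<And>k. k < \<eta> \<Longrightarrow> f * \<Delta> k \<in> link_ci m n C"
  shows "f \<in> J"
proof -
  note ci = link_ci_ideal
  have quot: "ideal {h \<in> polys V. f * h \<in> link_ci m n C} (poly_ring V)" (is "ideal (?I V) _")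
    if V: "V \<subseteq> svars m n" for V
  proof (rule poly_idealI)
    show "0 \<in> ?I V" using poly_ideal_zero[OF ci] by (simp add: carrier_zero)
    show "h + h' \<in> ?I V" if "h \<in> ?I V" "h' \<in> ?I V" for h h'
      using that poly_ideal_add[OF ci, of "f * h" "f * h'"] by (auto simp: distrib_left intro: carrier_add)
    show "r * h \<in> ?I V" if "r \<in> polys V" "h \<in> ?I V" for r h
      using that poly_ideal_mult[OF ci carrier_mono[OF V that(1)], of "f * h"]
      by (auto simp: ac_simps intro: carrier_mult)
  qed auto
  have "minors_ideal m n C \<subseteq> {h \<in> carrier (poly_ring (xvars m n)). f * h \<in> link_ci m n C}"
    unfolding minors_ideal_def
    by (rule genideal_least[OF quot]) (use minors max_minor_eq \<Delta>_carrier in \<open>auto simp: svars_def\<close>)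
  then have "minors_ideal m n C \<subseteq> {h \<in> carrier S. f * h \<in> link_ci m n C}"
    using xvars_carrier by blast
  from genideal_least[OF quot[OF subset_refl] this] show ?thesis
    using f unfolding generic_link_def ideal_quotient_def by auto
qed

lemma F_J: "i < g \<Longrightarrow> F i \<in> J"
  by (intro J_intro F_carrier poly_ideal_mult_right[OF link_ci_ideal] xvars_carrier \<Delta>_carrier F_link_ci)

text \<open>The columns \<open>b\<close> of \<open>link_poly_mult_minor\<close> run through those of all maximal minors.\<close>

lemma link_poly_J:
  assumes st: "staircase g m a"
  shows "link_poly y x P g m \<eta> a \<in> J"
proof (rule J_intro)
  have mod: "q mod m < m" for q using m by simp
  have blk: "q div m < g" if "q < g * m" for q using that by (simp add: less_mult_imp_div_less)
  show "link_poly y x P g m \<eta> a \<in> carrier S"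
    unfolding link_poly_def
  proof (intro carrier_sum carrier_mult carrier_prod)
    fix k assume k: "k \<in> PiE {..<g} (\<lambda>_. {..<\<eta>})"
    show "y i (k i) \<in> carrier S" if "i \<in> {..<g}" for i using k that by (intro y_carrier) auto
    have col: "col_of P m k q < n" if "q < g * m" for q
      unfolding col_of_def using k blk[OF that] by (intro P_less mod) auto
    show "det (link_matrix x P g m a k) \<in> carrier S"
    proof (rule carrier_det[of _ "g * m"])
      show "link_matrix x P g m a k \<in> carrier_mat (g * m) (g * m)" unfolding link_matrix_def by simp
      fix q q' assume q: "q < g * m" "q' < g * m"
      have "x (m - 1 - q mod m) (col_of P m k q') \<in> carrier S"
        using m by (intro xvars_carrier x_carrier col q) auto
      then show "link_matrix x P g m a k $$ (q, q') \<in> carrier S"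
        using q by (simp add: link_matrix_def carrier_one carrier_zero)
    qed
  qed
  fix k assume k: "k < \<eta>"
  show "link_poly y x P g m \<eta> a * \<Delta> k \<in> link_ci m n C"
    unfolding \<Delta>_def
  proof (rule link_poly_mult_minor[OF st m _ n_eq _ P_inj[OF k] P_less[OF k] link_ci_ideal])
    show "(\<Sum>k<\<eta>. y i k * det (mat m m (\<lambda>(r, c). x r (P k c)))) \<in> link_ci m n C" if "i < g" for i
      using F_link_ci[OF that] unfolding F_def \<Delta>_def .
  qed (auto intro: P_less y_carrier xvars_carrier x_carrier)
qed

definition vert :: "nat \<Rightarrow> nat \<Rightarrow> var" where
  "vert i s = (case s of 0 \<Rightarrow> YVar i i | Suc t \<Rightarrow> XVar (m - 1 - t) (i + t))"

lemma vert_inj: "s \<le> m \<Longrightarrow> s' \<le> m \<Longrightarrow> vert i s = vert j s' \<longleftrightarrow> i = j \<and> s = s'"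
  unfolding vert_def by (auto split: nat.splits)

lemma vert_svars: "i < g \<Longrightarrow> s \<le> m \<Longrightarrow> vert i s \<in> svars m n"
  unfolding vert_def svars_def xvars_def yvars_def using g_le mn by (auto split: nat.splits)

definition array_mon :: "(nat \<Rightarrow> nat \<Rightarrow> nat) \<Rightarrow> var monomial" where
  "array_mon H = (\<Sum>i<g. \<Sum>s\<le>m. single (vert i s) (H i s))"

lemma lookup_array_mon:
  assumes "i < g" "s \<le> m"
  shows "lookup (array_mon H) (vert i s) = H i s"
proof -
  have "lookup (array_mon H) (vert i s) = (\<Sum>j<g. \<Sum>s'\<le>m. if s' = s then (if j = i then H i s else 0) else 0)"
    unfolding array_mon_def lookup_sum
    by (intro sum.cong refl) (use assms in \<open>auto simp: lookup_single when_def vert_inj\<close>)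
  also have "\<dots> = H i s" using assms by simp
  finally show ?thesis .
qed

lemma array_mon_keys:
  assumes "v \<in> keys (array_mon H)"
  obtains i s where "i < g" "s \<le> m" "v = vert i s" "H i s \<noteq> 0"
proof -
  have v: "v \<in> keys (\<Sum>i<g. \<Sum>s\<le>m. single (vert i s) (H i s))"
    using assms unfolding array_mon_def .
  obtain i where i: "i \<in> {..<g}" "v \<in> keys (\<Sum>s\<le>m. single (vert i s) (H i s))"
    using keys_sum_cases[OF v] .
  obtain s where "s \<in> {..m}" "v \<in> keys (single (vert i s) (H i s))"
    using keys_sum_cases[OF i(2)] .
  then show ?thesis using that i(1) by (auto split: if_splits)
qed

lemma sum_atMost_vert: "(\<Sum>s\<le>m. f s) = f 0 + (\<Sum>t<m. f (Suc t))" for f :: "nat \<Rightarrow> var monomial"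
  by (simp add: sum.atMost_shift)

lemma L_array: "i < g \<Longrightarrow> L i = array_mon (column_array i)"
proof -
  assume i: "i < g"
  have "array_mon (column_array i) = (\<Sum>j<g. if j = i then (\<Sum>s\<le>m. single (vert i s) 1) else 0)"
    unfolding array_mon_def column_array_def by (intro sum.cong) auto
  also have "\<dots> = (\<Sum>s\<le>m. single (vert i s) 1)" using i by simp
  also have "\<dots> = single (YVar i i) 1 + (\<Sum>t<m. xmon m t (i + t))"
    unfolding sum_atMost_vert by (simp add: vert_def xmon_def)
  also have "(\<Sum>t<m. xmon m t (i + t)) = \<delta> i"
    unfolding \<delta>_def by (rule sum.cong) (use P_interval[OF i] in auto)
  finally show ?thesis unfolding L_def by simp
qed

lemma U_array:
  assumes st: "staircase g m a"
  shows "U a = array_mon (staircase_array a)"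
proof -
  let ?f = "\<lambda>q. if on_path a m q then 0 else xmon m (q mod m) (diagonal m q)"
  have "off_path_monomial g m a id = (\<Sum>q<g * m. ?f q)"
    unfolding off_path_monomial_def off_path_def
    by (subst sum.inter_filter) (auto simp: lessThan_atLeast0 intro!: sum.cong)
  also have "\<dots> = (\<Sum>i<g. sum ?f {i * m..<i * m + m})" by (rule sum.nat_group[symmetric])
  also have "\<dots> = (\<Sum>i<g. \<Sum>t<m. single (vert i (Suc t)) (staircase_array a i (Suc t)))"
  proof (rule sum.cong[OF refl])
    fix i
    have "sum ?f {i * m..<i * m + m} = (\<Sum>t = 0..<m. ?f (t + i * m))"
      using sum.shift_bounds_nat_ivl[of ?f 0 "i * m" m] by (simp only: add_0 add.commute[of m "i * m"])
    also have "\<dots> = (\<Sum>t<m. single (vert i (Suc t)) (staircase_array a i (Suc t)))"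
      unfolding lessThan_atLeast0
      by (rule sum.cong) (auto simp: on_path_def diagonal_def staircase_array_def vert_def xmon_def)
    finally show "sum ?f {i * m..<i * m + m} = (\<Sum>t<m. single (vert i (Suc t)) (staircase_array a i (Suc t)))" .
  qed
  finally have off: "off_path_monomial g m a id = (\<Sum>i<g. \<Sum>t<m. single (vert i (Suc t)) (staircase_array a i (Suc t)))" .
  have "single (vert i 0) (staircase_array a i 0) = single (YVar i i) 1" if "i < g" for i
    using staircase_bounds[OF st, of i] that by (simp add: staircase_array_def vert_def)
  then have "array_mon (staircase_array a) =
      (\<Sum>i<g. single (YVar i i) 1 + (\<Sum>t<m. single (vert i (Suc t)) (staircase_array a i (Suc t))))"
    unfolding array_mon_def sum_atMost_vert by (intro sum.cong) auto
  then show ?thesis unfolding U_def off by (simp add: sum.distrib)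
qed

lemma generator_lead:
  assumes "H \<in> generator_arrays g m"
  shows "\<exists>f\<in>J. is_lead lo f (array_mon H)"
  using assms unfolding generator_arrays_def
proof
  assume "H \<in> column_array ` {..<g}"
  then obtain i where "i < g" "H = column_array i" by auto
  then show ?thesis using F_J F_lead L_array by (intro bexI[of _ "F i"]) auto
next
  assume "H \<in> staircase_array ` {a. staircase g m a}"
  then obtain a where "staircase g m a" "H = staircase_array a" by auto
  then show ?thesis using link_poly_J link_poly_lead U_array by (intro bexI[of _ "link_poly y x P g m \<eta> a"]) auto
qed

definition wt :: "(nat \<Rightarrow> nat) \<Rightarrow> var monomial \<Rightarrow> nat" where
  "wt \<sigma> t = (\<Sum>i<g. lookup t (vert i (\<sigma> i)))"

lemma wt_add: "wt \<sigma> (s + t) = wt \<sigma> s + wt \<sigma> t"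
  unfolding wt_def by (simp add: lookup_add sum.distrib)

text \<open>Degree at least \<open>l\<close> with respect to the variables of each bad choice.\<close>

definition heavy :: "nat \<Rightarrow> var monomial \<Rightarrow> bool" where
  "heavy l t \<longleftrightarrow> (\<forall>\<sigma>. bad_choice g m \<sigma> \<longrightarrow> l \<le> wt \<sigma> t)"

text \<open>If \<open>\<sigma>\<close> chooses entry 0 in column \<open>i\<close>, stay in this column. At an inversion in columns \<open>i < j\<close>, follow column \<open>i\<close>
  below its chosen entry, and change to column \<open>j\<close>, whose chosen entry has then been passed.\<close>

lemma avoiding_path:
  assumes "bad_choice g m \<sigma>"
  shows "\<exists>c. (\<forall>t<m. c t < g \<and> \<sigma> (c t) \<noteq> Suc t) \<and> (\<forall>s t. s \<le> t \<longrightarrow> t < m \<longrightarrow> c s \<le> c t)"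
  using assms unfolding bad_choice_def
proof (elim conjE disjE exE)
  fix i assume "i < g" "\<sigma> i = 0"
  then show ?thesis by (intro exI[of _ "\<lambda>_. i"]) auto
next
  fix i j assume "i < j" "j < g" "\<sigma> j < \<sigma> i"
  then show ?thesis by (intro exI[of _ "\<lambda>t. if Suc t < \<sigma> i then i else j"]) auto
qed

text \<open>The path from \<open>avoiding_path\<close> is the antidiagonal of a maximal minor that contains no chosen variable. The product of
  \<open>f\<close> with this minor has a leading monomial divisible by some \<open>L i\<close>, which contains the chosen variable of column \<open>i\<close>.\<close>

lemma lead_J_heavy:
  assumes f: "f \<in> J" and t: "is_lead lo f t"
  shows "heavy 1 t"
  unfolding heavy_def
proof (intro allI impI)
  fix \<sigma> assume \<sigma>: "bad_choice g m \<sigma>"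
  from avoiding_path[OF \<sigma>] obtain c where
    path: "\<forall>t<m. c t < g \<and> \<sigma> (c t) \<noteq> Suc t" "\<forall>s t. s \<le> t \<longrightarrow> t < m \<longrightarrow> c s \<le> c t"
    by (elim exE conjE)
  have c: "c t < g" "\<sigma> (c t) \<noteq> Suc t" if "t < m" for t using path(1) that by auto
  have mono: "c s \<le> c t" if "s \<le> t" "t < m" for s t using path(2) that by auto
  let ?h = "\<lambda>t. c t + t"
  have h: "?h s < ?h t" if "s < t" "t < m" for s t using mono[of s t] that by simp
  have "inj_on ?h {..<m}"
  proof (rule inj_onI)
    fix s t assume "s \<in> {..<m}" "t \<in> {..<m}" "?h s = ?h t"
    then show "s = t" using h[of s t] h[of t s] by (cases s t rule: linorder_cases) auto
  qed
  then have "card (?h ` {..<m}) = m" by (simp add: card_image)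
  moreover have "?h ` {..<m} \<subseteq> {..<n}" using c(1) mn by fastforce
  ultimately obtain k where k: "k < \<eta>" "C k = ?h ` {..<m}" using C_onto by blast
  have Pk: "P k t = c t + t" if "t < m" for t
    unfolding P_def k(2) by (rule pick_strict_mono_image[OF h that])
  have fk: "keys f \<subseteq> monomials (svars m n)" using J_carrier[OF f] by (simp add: poly_ring_carrier)
  have \<Delta>k: "keys (\<Delta> k) \<subseteq> monomials (svars m n)"
    using xvars_carrier[OF \<Delta>_carrier[OF k(1)]] by (simp add: poly_ring_carrier)
  have lead: "is_lead lo (f * \<Delta> k) (t + \<delta> k)" by (rule lo.lead_mult[OF t \<Delta>_lead_lo[OF k(1)] fk \<Delta>k])
  have mem: "f * \<Delta> k \<in> genideal S (F ` {..<g})" using J_mult_minor[OF f k(1)] unfolding link_ci_eq .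
  have coprime: "keys (L i) \<inter> keys (L j) = {}" if ij: "i < j" "j < g" for i j
  proof (rule ccontr)
    assume "keys (L i) \<inter> keys (L j) \<noteq> {}"
    then obtain v where "v \<in> keys (array_mon (column_array i))" "v \<in> keys (array_mon (column_array j))"
      using L_array ij by auto
    then show False using ij
      by (elim array_mon_keys) (auto simp: vert_inj column_array_def split: if_splits)
  qed
  have "\<exists>i<g. mdvd (L i) (t + \<delta> k)"
    by (rule coprime_leads_groebner[OF finite_svars lo_term_order F_carrier F_lead coprime mem lead])
  then obtain i where i: "i < g" "mdvd (L i) (t + \<delta> k)" by blast
  have \<sigma>i: "\<sigma> i \<le> m" using \<sigma> i(1) unfolding bad_choice_def by simp
  let ?v = "vert i (\<sigma> i)"
  have "lookup (L i) ?v = 1" unfolding L_array[OF i(1)] by (subst lookup_array_mon[OF i(1) \<sigma>i]) (simp add: column_array_def)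
  then have "1 \<le> lookup t ?v + lookup (\<delta> k) ?v" using i(2) unfolding mdvd_def lookup_add by metis
  moreover have "lookup (\<delta> k) ?v = 0"
  proof (cases "\<sigma> i")
    case 0
    then have "?v \<notin> xvars m n" unfolding vert_def xvars_def by simp
    then show ?thesis using monomials_lookup[OF \<delta>_monomials[OF k(1)]] by blast
  next
    case (Suc s)
    then have s: "s < m" using \<sigma>i by simp
    have "lookup (\<delta> k) (XVar (m - 1 - s) (i + s)) = (\<Sum>t<m. of_bool (t = s \<and> P k t = i + s))"
      unfolding \<delta>_def lookup_sum by (rule sum.cong[OF refl]) (rule lookup_xmon; use s in simp)
    also have "\<dots> = 0" by (rule sum.neutral) (use c(2)[OF s] Pk s Suc in auto)
    finally show ?thesis using Suc unfolding vert_def by simp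
  qed
  ultimately have "1 \<le> lookup t ?v" by simp
  also have "\<dots> \<le> wt \<sigma> t" unfolding wt_def using i(1) by (intro member_le_sum) auto
  finally show "1 \<le> wt \<sigma> t" .
qed

definition heavy_ideal :: "nat \<Rightarrow> (var, 'k) mpoly set" where
  "heavy_ideal l = {f \<in> carrier S. \<forall>t\<in>keys f. heavy l t}"

lemma heavy_packing:
  assumes "heavy l t"
  shows "\<exists>H. (\<forall>k<l. H k \<in> generator_arrays g m) \<and> mdvd (\<Sum>k<l. array_mon (H k)) t"
proof -
  have g2: "2 \<le> g" using mn by simp
  have cover: "l \<le> (\<Sum>i<g. lookup t (vert i (\<sigma> i)))" if "bad_choice g m \<sigma>" for \<sigma>
    using assms that unfolding heavy_def wt_def by blast
  obtain H where H: "\<forall>k<l. H k \<in> generator_arrays g m"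
    "\<forall>i<g. \<forall>s\<le>m. (\<Sum>k<l. H k i s) \<le> lookup t (vert i s)"
    using array_packing[where w = "\<lambda>i s. lookup t (vert i s)", OF m g2 cover] by blast
  have "lookup (\<Sum>k<l. array_mon (H k)) v \<le> lookup t v" for v
  proof (cases "\<exists>i<g. \<exists>s\<le>m. v = vert i s")
    case True
    then show ?thesis using H(2) by (auto simp: lookup_sum lookup_array_mon)
  next
    case False
    have "v \<notin> keys (array_mon (H k))" for k
    proof
      assume "v \<in> keys (array_mon (H k))"
      then show False by (rule array_mon_keys) (use False in blast)
    qed
    then show ?thesis by (simp add: lookup_sum in_keys_iff)
  qed
  then show ?thesis using H(1) unfolding mdvd_def by blast
qed

abbreviation (input) in_J where "in_J \<equiv> initial_ideal (svars m n) lo J"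

lemma initial_term_lead:
  assumes "f \<in> J" "is_lead lo f t"
  shows "initial_term lo f = single t (lookup f t)" "lookup f t \<noteq> 0" "f \<noteq> 0" "t \<in> monomials (svars m n)"
proof -
  have "keys f \<subseteq> monomials (svars m n)" using J_carrier[OF assms(1)] by (simp add: poly_ring_carrier)
  then show "initial_term lo f = single t (lookup f t)"
    unfolding initial_term_def using lo.initial_monomial_eq[OF assms(2)] by simp
  show "lookup f t \<noteq> 0" "f \<noteq> 0" "t \<in> monomials (svars m n)"
    using assms(2) \<open>keys f \<subseteq> monomials (svars m n)\<close> by (auto simp: is_lead_def in_keys_iff)
qed

lemma J_lead_exists: "f \<in> J \<Longrightarrow> f \<noteq> 0 \<Longrightarrow> \<exists>t. is_lead lo f t"
  using lo.lead_exists J_carrier poly_ring_carrier by blast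

lemma in_J_ideal: "ideal in_J S" and in_J_gen: "f \<in> J \<Longrightarrow> f \<noteq> 0 \<Longrightarrow> initial_term lo f \<in> in_J"
proof -
  have "{initial_term lo f | f. f \<in> J \<and> f \<noteq> 0} \<subseteq> carrier S"
    using J_lead_exists initial_term_lead by (force intro: carrier_single)
  from genideal_poly[OF this] show "ideal in_J S" "f \<in> J \<Longrightarrow> f \<noteq> 0 \<Longrightarrow> initial_term lo f \<in> in_J"
    unfolding initial_ideal_def by auto
qed

lemma generator_in_J: "H \<in> generator_arrays g m \<Longrightarrow> single (array_mon H) 1 \<in> in_J"
proof -
  assume "H \<in> generator_arrays g m"
  then obtain f where f: "f \<in> J" "is_lead lo f (array_mon H)" using generator_lead by blast
  note l = initial_term_lead[OF f]
  have "single 0 (1 / lookup f (array_mon H)) * initial_term lo f \<in> in_J"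
    by (intro poly_ideal_mult[OF in_J_ideal] carrier_single monomials_zero in_J_gen f l(3))
  then show ?thesis unfolding l(1) mult_single using l(2) by simp
qed

lemma heavy_ideal_ideal: "ideal (heavy_ideal l) S"
  unfolding heavy_ideal_def
  by (rule ideal_upward_closed) (auto simp: heavy_def wt_add intro: order_trans)

text \<open>The arrays packed into the exponents of a monomial are leading monomials of elements of the link, so each of them
  contributes one factor from the initial ideal.\<close>

lemma heavy_ideal_subset_pow: "heavy_ideal l \<subseteq> in_J [^]\<^bsub>ideals_set S\<^esub> l"
proof
  fix f assume f: "f \<in> heavy_ideal l"
  note pow = ideals_pow_ideal[OF poly_ring_cring in_J_ideal]
  have prod: "single (\<Sum>k<j. array_mon (H k)) 1 \<in> in_J [^]\<^bsub>ideals_set S\<^esub> j"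
    if "\<forall>k<j. H k \<in> generator_arrays g m" for H and j :: nat
    using that
  proof (induction j)
    case 0
    then show ?case unfolding nat_pow_ideals_set by (simp add: carrier_one)
  next
    case (Suc j)
    have "single (\<Sum>k<j. array_mon (H k)) 1 * single (array_mon (H j)) 1 \<in> in_J [^]\<^bsub>ideals_set S\<^esub> Suc j"
      unfolding nat_pow_ideals_set
      using ideal_prod.prod[of "single (\<Sum>k<j. array_mon (H k)) 1" _ "single (array_mon (H j)) 1" _ S] Suc generator_in_J
      by simp
    then show ?case by (simp add: mult_single)
  qed
  have "single t (lookup f t) \<in> in_J [^]\<^bsub>ideals_set S\<^esub> l" if t: "t \<in> keys f" for t
  proof -
    have tm: "t \<in> monomials (svars m n)" "heavy l t" using f t by (auto simp: heavy_ideal_def poly_ring_carrier)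
    obtain H where H: "\<forall>k<l. H k \<in> generator_arrays g m" "mdvd (\<Sum>k<l. array_mon (H k)) t"
      using heavy_packing[OF tm(2)] by blast
    obtain u where u: "t = (\<Sum>k<l. array_mon (H k)) + u" using mdvdE[OF H(2)] .
    have "u \<in> monomials (svars m n)" using tm(1) u monomials_add_iff by blast
    then have "single u (lookup f t) * single (\<Sum>k<l. array_mon (H k)) 1 \<in> in_J [^]\<^bsub>ideals_set S\<^esub> l"
      by (intro poly_ideal_mult[OF pow] carrier_single prod H(1))
    then show ?thesis by (simp add: mult_single u add.commute)
  qed
  then have "(\<Sum>t\<in>keys f. single t (lookup f t)) \<in> in_J [^]\<^bsub>ideals_set S\<^esub> l"
    by (intro poly_ideal_sum[OF pow])
  then show "f \<in> in_J [^]\<^bsub>ideals_set S\<^esub> l" using poly_eq_sum_single[of f] by simp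
qed

theorem in_J_eq: "in_J = heavy_ideal 1"
proof
  show "in_J \<subseteq> heavy_ideal 1"
    unfolding initial_ideal_def
  proof (rule genideal_least[OF heavy_ideal_ideal])
    show "{initial_term lo f | f. f \<in> J \<and> f \<noteq> 0} \<subseteq> heavy_ideal 1"
    proof
      fix h assume "h \<in> {initial_term lo f | f. f \<in> J \<and> f \<noteq> 0}"
      then obtain f where f: "f \<in> J" "f \<noteq> 0" "h = initial_term lo f" by blast
      then obtain t where t: "is_lead lo f t" using J_lead_exists by blast
      note l = initial_term_lead[OF f(1) t]
      show "h \<in> heavy_ideal 1"
        unfolding heavy_ideal_def f(3) l(1) using lead_J_heavy[OF f(1) t] l by (auto intro: carrier_single)
    qed
  qed
  show "heavy_ideal 1 \<subseteq> in_J"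
  proof -
    interpret cring S by (rule poly_ring_cring)
    have "in_J [^]\<^bsub>ideals_set S\<^esub> (1::nat) \<subseteq> in_J"
    proof
      fix f assume "f \<in> in_J [^]\<^bsub>ideals_set S\<^esub> (1::nat)"
      then have "f \<in> ideal_prod S (carrier S) in_J" unfolding One_nat_def nat_pow_ideals_set .
      then show "f \<in> in_J" using ideal_prod_inter[OF oneideal in_J_ideal] by blast
    qed
    then show ?thesis using heavy_ideal_subset_pow[of 1] by blast
  qed
qed

text \<open>For a bad choice this is the \<open>l\<close>-th power of the prime ideal generated by the chosen variables.\<close>

definition wt_ideal :: "(nat \<Rightarrow> nat) \<Rightarrow> nat \<Rightarrow> (var, 'k) mpoly set" where
  "wt_ideal \<sigma> l = {f \<in> carrier S. \<forall>t\<in>keys f. l \<le> wt \<sigma> t}"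

lemma wt_ideal_ideal: "ideal (wt_ideal \<sigma> l) S"
  unfolding wt_ideal_def by (rule ideal_upward_closed) (simp add: wt_add)

lemma wt_ideal_pow: "wt_ideal \<sigma> 1 [^]\<^bsub>ideals_set S\<^esub> (l::nat) \<subseteq> wt_ideal \<sigma> l"
proof (induction l)
  case 0
  then show ?case unfolding nat_pow_ideals_set by (auto simp: wt_ideal_def)
next
  case (Suc l)
  show ?case
  proof
    fix f assume "f \<in> wt_ideal \<sigma> 1 [^]\<^bsub>ideals_set S\<^esub> Suc l"
    then show "f \<in> wt_ideal \<sigma> (Suc l)" unfolding nat_pow_ideals_set
    proof (induction rule: ideal_prod.induct)
      case (prod f h)
      then have fh: "f \<in> wt_ideal \<sigma> l" "h \<in> wt_ideal \<sigma> 1" using Suc by auto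
      have "Suc l \<le> wt \<sigma> t" if t: "t \<in> keys (f * h)" for t
      proof -
        obtain s s' where "t = s + s'" "s \<in> keys f" "s' \<in> keys h" using t keys_mult[of f h] by blast
        then show ?thesis using fh by (force simp: wt_ideal_def wt_add)
      qed
      then show ?case using fh by (auto simp: wt_ideal_def intro: carrier_mult)
    next
      case (sum f h)
      then show ?case using poly_ideal_add[OF wt_ideal_ideal] by simp
    qed
  qed
qed

text \<open>The terms of least weight multiply without cancellation. To see this, take leading monomials for the order
  that ranks monomials of smaller weight higher and breaks ties by the term order.\<close>

lemma wt_ideal_primary:
  assumes u: "u \<in> carrier S" "u \<notin> wt_ideal \<sigma> 1" and f: "f \<in> carrier S" and uf: "u * f \<in> wt_ideal \<sigma> l"
  shows "f \<in> wt_ideal \<sigma> l"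
proof (rule ccontr)
  assume nf: "f \<notin> wt_ideal \<sigma> l"
  define lw where "lw s t \<longleftrightarrow> wt \<sigma> t < wt \<sigma> s \<or> (wt \<sigma> s = wt \<sigma> t \<and> lo s t)" for s t
  interpret lw: monomial_order "svars m n" lw
  proof
    show "\<not> lw s s" if "s \<in> monomials (svars m n)" for s using lo.irrefl[OF that] by (simp add: lw_def)
    show "lw s u" if "s \<in> monomials (svars m n)" "t \<in> monomials (svars m n)" "u \<in> monomials (svars m n)"
      "lw s t" "lw t u" for s t u
      using that(4,5) lo.trans[OF that(1-3)] unfolding lw_def by auto
    show "lw s t \<or> lw t s" if "s \<in> monomials (svars m n)" "t \<in> monomials (svars m n)" "s \<noteq> t" for s t
      using lo.total[OF that] unfolding lw_def by auto
    show "lw (u + s) (u + t)" if "s \<in> monomials (svars m n)" "t \<in> monomials (svars m n)"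
      "u \<in> monomials (svars m n)" "lw s t" for s t u
      using that(4) lo.add_left[OF that(1-3)] unfolding lw_def wt_add by auto
  qed
  have key: "\<exists>t. is_lead lw h t \<and> wt \<sigma> t < k" if h: "h \<in> carrier S" "h \<notin> wt_ideal \<sigma> k" for h :: "(var, 'k) mpoly" and k
  proof -
    obtain s where s: "s \<in> keys h" "wt \<sigma> s < k" using h unfolding wt_ideal_def by auto
    then have "h \<noteq> 0" by auto
    then obtain t where t: "is_lead lw h t" using lw.lead_exists h(1) poly_ring_carrier by blast
    then have "s = t \<or> lw s t" using s by (auto simp: is_lead_def)
    then have "wt \<sigma> t \<le> wt \<sigma> s" unfolding lw_def by auto
    then show ?thesis using t s by auto
  qed
  obtain s t where s: "is_lead lw u s" "wt \<sigma> s < 1" and t: "is_lead lw f t" "wt \<sigma> t < l"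
    using key[OF u] key[OF f nf] by blast
  have "is_lead lw (u * f) (s + t)"
    using lw.lead_mult[OF s(1) t(1)] u(1) f by (simp add: poly_ring_carrier)
  then have "l \<le> wt \<sigma> (s + t)" using uf by (simp add: is_lead_def wt_ideal_def)
  then show False using s(2) t(2) by (simp add: wt_add)
qed

lemma wt_ideal_prime: "primeideal (wt_ideal \<sigma> 1) S"
proof (rule primeidealI[OF wt_ideal_ideal poly_ring_cring])
  have "wt \<sigma> 0 = 0" by (simp add: wt_def)
  then have "1 \<notin> wt_ideal \<sigma> 1" by (simp add: wt_ideal_def)
  then show "carrier S \<noteq> wt_ideal \<sigma> 1" using carrier_one by blast
  show "f \<in> wt_ideal \<sigma> 1 \<or> h \<in> wt_ideal \<sigma> 1"
    if "f \<in> carrier S" "h \<in> carrier S" "f \<otimes>\<^bsub>S\<^esub> h \<in> wt_ideal \<sigma> 1" for f h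
    using wt_ideal_primary[of f \<sigma> h 1] that by auto
qed

text \<open>The prime is the annihilator of the product \<open>e\<close> of all array variables that are not chosen: \<open>e\<close> has weight 0
  itself, and if \<open>t\<close> contains the variable chosen in column \<open>i\<close>, then \<open>t + e\<close> contains all variables of this column,
  hence one from every choice.\<close>

lemma wt_ideal_ass:
  assumes \<sigma>: "bad_choice g m \<sigma>"
  shows "wt_ideal \<sigma> 1 \<in> ass_primes S in_J"
proof -
  have \<sigma>m: "\<sigma> i \<le> m" if "i < g" for i using \<sigma> that unfolding bad_choice_def by blast
  define e where "e = array_mon (\<lambda>i s. of_bool (s \<noteq> \<sigma> i))"
  have e: "lookup e (vert i s) = of_bool (s \<noteq> \<sigma> i)" if "i < g" "s \<le> m" for i s
    unfolding e_def by (rule lookup_array_mon[OF that])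
  have em: "e \<in> monomials (svars m n)"
    unfolding e_def array_mon_def by (intro monomials_sum monomials_single vert_svars) auto
  have we: "wt \<sigma> e = 0" unfolding wt_def using e \<sigma>m by simp
  have ek: "t + e \<in> keys (h * single e 1) \<longleftrightarrow> t \<in> keys h" for t and h :: "(var, 'k) mpoly"
  proof -
    have "lookup (h * single e 1) (t + e) = lookup h t"
      unfolding lookup_mult_sum by (auto simp: when_def in_keys_iff)
    then show ?thesis by (simp add: in_keys_iff)
  qed
  have "wt_ideal \<sigma> 1 = ideal_quotient S in_J {single e 1}"
  proof (intro equalityI subsetI)
    fix h assume h: "h \<in> wt_ideal \<sigma> 1"
    then have hS: "h \<in> carrier S" by (simp add: wt_ideal_def)
    have "heavy 1 u" if u: "u \<in> keys (h * single e 1)" for u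
    proof -
      obtain t where t: "u = t + e" "t \<in> keys h" using u keys_mult[of h "single e 1"] by auto
      then have "(\<Sum>i<g. lookup t (vert i (\<sigma> i))) \<noteq> 0"
        using h unfolding wt_def[symmetric] by (auto simp: wt_ideal_def)
      then obtain i where "i \<in> {..<g}" "lookup t (vert i (\<sigma> i)) \<noteq> 0"
        by (rule sum.not_neutral_contains_not_neutral)
      then have i: "i < g" "0 < lookup t (vert i (\<sigma> i))" by auto
      show ?thesis unfolding heavy_def
      proof (intro allI impI)
        fix \<tau> assume "bad_choice g m \<tau>"
        then have "\<tau> i \<le> m" using i unfolding bad_choice_def by blast
        then have "1 \<le> lookup u (vert i (\<tau> i))"
          using i e[OF i(1), of "\<tau> i"] by (cases "\<tau> i = \<sigma> i") (auto simp: t lookup_add)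
        also have "\<dots> \<le> wt \<tau> u" unfolding wt_def using i(1) by (intro member_le_sum) auto
        finally show "1 \<le> wt \<tau> u" .
      qed
    qed
    then show "h \<in> ideal_quotient S in_J {single e 1}"
      unfolding ideal_quotient_def in_J_eq heavy_ideal_def
      using hS em by (auto intro: carrier_mult carrier_single)
  next
    fix h assume h: "h \<in> ideal_quotient S in_J {single e 1}"
    then have hS: "h \<in> carrier S" and hv: "\<forall>t\<in>keys (h * single e 1). heavy 1 t"
      unfolding ideal_quotient_def in_J_eq heavy_ideal_def by auto
    have "1 \<le> wt \<sigma> t" if "t \<in> keys h" for t
    proof -
      have "heavy 1 (t + e)" using hv ek that by blast
      then have "1 \<le> wt \<sigma> (t + e)" using \<sigma> unfolding heavy_def by blast
      then show ?thesis using we by (simp add: wt_add)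
    qed
    then show "h \<in> wt_ideal \<sigma> 1" using hS by (simp add: wt_ideal_def)
  qed
  moreover have "single e 1 \<in> carrier S" using em by (rule carrier_single)
  ultimately show ?thesis unfolding ass_primes_def using wt_ideal_prime by blast
qed

theorem symbolic_power_eq: "symbolic_power S in_J l = in_J [^]\<^bsub>ideals_set S\<^esub> l"
proof
  show "symbolic_power S in_J l \<subseteq> in_J [^]\<^bsub>ideals_set S\<^esub> l"
  proof
    fix f assume f: "f \<in> symbolic_power S in_J l"
    have fS: "f \<in> carrier S" using f unfolding symbolic_power_def by blast
    have "f \<in> wt_ideal \<sigma> l" if \<sigma>: "bad_choice g m \<sigma>" for \<sigma>
    proof -
      have "f \<in> local_contraction S (wt_ideal \<sigma> 1) (wt_ideal \<sigma> 1 [^]\<^bsub>ideals_set S\<^esub> l)"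
        using f wt_ideal_ass[OF \<sigma>] unfolding symbolic_power_def by blast
      from primeideal.local_contraction_witness[OF wt_ideal_prime
          ideals_pow_ideal[OF poly_ring_cring wt_ideal_ideal] this]
      obtain u where u: "u \<in> carrier S" "u \<notin> wt_ideal \<sigma> 1" "u * f \<in> wt_ideal \<sigma> 1 [^]\<^bsub>ideals_set S\<^esub> l" by auto
      show ?thesis by (rule wt_ideal_primary[OF u(1,2) fS subsetD[OF wt_ideal_pow u(3)]])
    qed
    then have "f \<in> heavy_ideal l" using fS unfolding wt_ideal_def heavy_ideal_def heavy_def by blast
    then show "f \<in> in_J [^]\<^bsub>ideals_set S\<^esub> l" using heavy_ideal_subset_pow by blast
  qed
  show "in_J [^]\<^bsub>ideals_set S\<^esub> l \<subseteq> symbolic_power S in_J l"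
  proof
    fix f assume f: "f \<in> in_J [^]\<^bsub>ideals_set S\<^esub> l"
    have fS: "f \<in> carrier S"
      using poly_ideal_carrier[OF ideals_pow_ideal[OF poly_ring_cring in_J_ideal] f] .
    have "f \<in> local_contraction S p (p [^]\<^bsub>ideals_set S\<^esub> l)" if p: "p \<in> ass_primes S in_J" for p
    proof -
      obtain h where h: "h \<in> carrier S" "p = ideal_quotient S in_J {h}" and "primeideal p S"
        using p unfolding ass_primes_def by blast
      then have pI: "ideal p S" by (simp add: primeideal.axioms)
      have "in_J \<subseteq> p" unfolding h(2) ideal_quotient_def
        using poly_ideal_mult_right[OF in_J_ideal h(1)] poly_ideal_carrier[OF in_J_ideal] by auto
      from subsetD[OF ideals_pow_mono[OF this] f] have fp: "f \<in> p [^]\<^bsub>ideals_set S\<^esub> l" .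
      have "p [^]\<^bsub>ideals_set S\<^esub> l \<subseteq> carrier S"
        using poly_ideal_carrier[OF ideals_pow_ideal[OF poly_ring_cring pI]] by blast
      from subsetD[OF subset_local_contraction[OF this] fp] show ?thesis .
    qed
    then show "f \<in> symbolic_power S in_J l" using fS unfolding symbolic_power_def by blast
  qed
qed

end

theorem theorem4p9:
  fixes m n l :: nat
    and C :: "nat \<Rightarrow> nat set"
    and lt :: "var monomial \<Rightarrow> var monomial \<Rightarrow> bool"
    and ys :: "(nat \<times> nat) list"
    and in_J :: "(var, 'k::field) mpoly set"
  assumes "1 \<le> m" and "m < n"
    and "minor_enumeration m n C"
    and "antidiagonal_order TYPE('k) m n lt"
    and "y_order m n ys"
    and "in_J = initial_ideal (svars m n) (link_order ys lt) (generic_link m n C)"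
  shows "symbolic_power (poly_ring (svars m n)) in_J l =
         in_J [^]\<^bsub>ideals_set (poly_ring (svars m n))\<^esub> l"
proof -
  interpret generic_link_setting m n C lt ys "TYPE('k)"
    using assms by unfold_locales
  show ?thesis unfolding assms(6) by (rule symbolic_power_eq)
qed

end
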